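(* Let $n\ge4$ and let $M\subset\mathbb R^n$ be an origin-symmetric star-shaped body such that $\|x\|_M^{-1}$ is a positive definite distribution on $\mathbb R^n$. Fix $k$ such that $n-k\in\{2,3\}$. Then for any origin-symmetric convex bodies $K,L\subset\mathbb R^n$ such that for every $H\in G(n,n-k)$ $$\int_{K\cap H}\|x\|_M^{n-4}\,dx\le\int_{L\cap H}\|x\|_M^{n-4}\,dx,$$ we have $$\mathrm{Vol}_n(K)\le\mathrm{Vol}_n(L).$$
   Context: $G(n,m)$ is the Grassmannian of $m$-dimensional linear subspaces of $\mathbb R^n$; integrals over $K\cap H$ are with respect to Lebesgue measure on $H$. A convex body is a compact convex set with non-empty interior. A star-shaped body is a compact set $M\subset\mathbb R^n$, star-shaped with respect to the origin and containing the origin in its interior, whose Minkowski functional $\|x\|_M=\min\{a>0: x\in aM\}$ (for $x\neq 0$, with $\|0\|_M=0$) is continuous and positive on $\mathbb R^n\setminus\{0\}$. For $n=4$ the integrand $\|x\|_M^{0}$ is $1$. The Fourier transform of a tempered distribution $f$ is defined by $\langle\hat f,\phi\rangle=\langle f,\hat\phi\rangle$ for Schwartz functions $\phi$, with $\hat\phi(\xi)=\int\phi(x)e^{-i(x,\xi)}dx$. A distribution $f$ is positive definite iff $\langle\hat f,\phi\rangle\ge0$ for every nonnegative Schwartz function $\phi$. *)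

theory Defs
  imports "HOL-Analysis.Analysis"
begin

definition origin_symmetric :: "'a::real_vector set \<Rightarrow> bool" where
  "origin_symmetric S \<longleftrightarrow> (\<forall>x\<in>S. - x \<in> S)"

definition convex_body :: "'a::euclidean_space set \<Rightarrow> bool" where
  "convex_body K \<longleftrightarrow> compact K \<and> convex K \<and> interior K \<noteq> {}"

definition minkowski_functional :: "'a::real_vector set \<Rightarrow> 'a \<Rightarrow> real" where
  "minkowski_functional M x =
     (if x = 0 then 0 else LEAST a::real. 0 < a \<and> x \<in> (*\<^sub>R) a ` M)"

definition star_body :: "'a::euclidean_space set \<Rightarrow> bool" where
  "star_body M \<longleftrightarrow>
     compact M \<and> (\<forall>x\<in>M. closed_segment 0 x \<subseteq> M) \<and> 0 \<in> interior M \<and>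
     continuous_on (- {0}) (minkowski_functional M) \<and>
     (\<forall>x. x \<noteq> 0 \<longrightarrow> 0 < minkowski_functional M x)"

definition Grassmannian :: "nat \<Rightarrow> 'a::euclidean_space set set" where
  "Grassmannian m = {H. subspace H \<and> dim H = m}"

text \<open>Lebesgue measure on a linear subspace \<open>H\<close>, as a Borel measure on the ambient space
  concentrated on \<open>H\<close>: the image of the product measure under orthonormal coordinates, just as
  \<^const>\<open>lborel\<close> is defined from the standard basis. By rotation invariance the choice of the
  orthonormal basis is immaterial.\<close>

definition orthonormal_basis_of :: "'a::euclidean_space set \<Rightarrow> 'a set \<Rightarrow> bool" where
  "orthonormal_basis_of H B \<longleftrightarrow>
     pairwise orthogonal B \<and> (\<forall>b\<in>B. norm b = 1) \<and> span B = H"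

definition subspace_lborel :: "'a::euclidean_space set \<Rightarrow> 'a measure" where
  "subspace_lborel H =
     (let B = (SOME B. orthonormal_basis_of H B)
      in distr (\<Pi>\<^sub>M b\<in>B. lborel) borel (\<lambda>y. \<Sum>b\<in>B. y b *\<^sub>R b))"

text \<open>Iterated partial derivatives; a list over \<^const>\<open>Basis\<close> plays the role of a multi-index.\<close>

primrec iter_partial :: "'a list \<Rightarrow> ('a::euclidean_space \<Rightarrow> complex) \<Rightarrow> 'a \<Rightarrow> complex" where
  "iter_partial [] f = f"
| "iter_partial (b # bs) f = (\<lambda>x. frechet_derivative (iter_partial bs f) (at x) b)"

definition schwartz :: "('a::euclidean_space \<Rightarrow> complex) \<Rightarrow> bool" where
  "schwartz \<phi> \<longleftrightarrow>
     (\<forall>bs\<in>lists Basis. iter_partial bs \<phi> differentiable_on UNIV \<and>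
        (\<forall>N::nat. bounded (range (\<lambda>x. norm x ^ N *\<^sub>R iter_partial bs \<phi> x))))"

definition fourier_transform :: "('a::euclidean_space \<Rightarrow> complex) \<Rightarrow> 'a \<Rightarrow> complex" where
  "fourier_transform \<phi> \<xi> =
     (\<integral>x. \<phi> x * exp (- (\<i> * complex_of_real (x \<bullet> \<xi>))) \<partial>lborel)"

text \<open>Tempered distributions are represented as functionals on functions, of which only the
  values on Schwartz functions matter.\<close>

type_synonym 'a distribution = "('a \<Rightarrow> complex) \<Rightarrow> complex"

definition distribution_of :: "('a::euclidean_space \<Rightarrow> real) \<Rightarrow> 'a distribution" where
  "distribution_of f \<phi> = (\<integral>x. complex_of_real (f x) * \<phi> x \<partial>lborel)"

definition fourier_distribution :: "'a::euclidean_space distribution \<Rightarrow> 'a distribution" where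
  "fourier_distribution T \<phi> = T (fourier_transform \<phi>)"

definition positive_definite :: "'a::euclidean_space distribution \<Rightarrow> bool" where
  "positive_definite T \<longleftrightarrow>
     (\<forall>\<phi>. schwartz \<phi> \<and> (\<forall>x. \<phi> x \<in> \<real>\<^sub>\<ge>\<^sub>0) \<longrightarrow> fourier_distribution T \<phi> \<in> \<real>\<^sub>\<ge>\<^sub>0)"

end

theory Submission
  imports Defs "HOL-Probability.Probability" "HOL-Real_Asymp.Real_Asymp"
begin

text \<open>
  Everything rests on one duality. Let \<open>N\<close> be even and homogeneous of degree \<open>-1\<close> on a subspace
  \<open>V\<close> of dimension \<open>d\<close>, with nonnegative Fourier transform. If \<open>\<integral>\<^sub>H G \<ge> 0\<close> for all hyperplanes
  \<open>H\<close> of \<open>V\<close>, then \<open>\<integral>\<^sub>V G N \<ge> 0\<close>: up to a constant, \<open>N\<close> is an average of the delta functions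
  \<open>\<delta>(x \<bullet> \<xi>)\<close> with weight the Fourier transform of \<open>N\<close>.

  For a convex body \<open>K\<close> the kernel \<open>N = 1 / \<parallel>x\<parallel>\<^sub>K\<close> is positive definite in dimensions 3 and 4, because
  parallel sections of \<open>K\<close> decrease away from the origin. Applied to \<open>G = \<parallel>x\<parallel>\<^sub>M\<^sup>n\<^sup>-\<^sup>4 (1\<^sub>L - 1\<^sub>K)\<close>,
  together with \<open>(1\<^sub>L - 1\<^sub>K) (1 / \<parallel>x\<parallel>\<^sub>K - 1) \<le> 0\<close>, the duality raises the hypothesis from dimension 2
  or 3 to dimension 4. From there on the duality is applied with \<open>N = 1 / \<parallel>x\<parallel>\<^sub>M\<close>: each further
  dimension removes one factor \<open>\<parallel>x\<parallel>\<^sub>M\<close> from the weight, and in dimension \<open>n\<close> the weight is gone.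
\<close>

subsection \<open>Lebesgue measure on the span of an orthonormal set\<close>

text \<open>The Fourier transform of N is only a distribution, so the average of delta functions has
  to be built from genuine functions: N is damped by \<open>E (\<tau> * p x)\<close>, which makes
  its transform a bounded nonnegative function \<open>P\<close>, and the delta function becomes a
  Gaussian of width e. The limit e \<rightarrow> 0 is taken before \<tau> \<rightarrow> 0. The bound
  4 for convex bodies has a concrete source. Slicing K orthogonally to \<xi> turns the transform of
  the damped kernel into a line integral of an even, decreasing section function against a function
  g, and the antiderivative of g decides the sign. In dimensions 3 and 4 it has the sign of its
  argument; the analogous formula in dimension 5 changes sign. The exponent n - 4 is the number of
  dimensions left to climb after that. The hypothesis on M concerns distributions on the whole
  space, while the climb uses it on subspaces of every dimension above 4. Gaussian test functions
  squeezed onto a subspace carry it over, because the gauge of M is continuous and positive off the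
  origin.\<close>

definition orthonormal_set :: "'a::euclidean_space set \<Rightarrow> bool" where
  "orthonormal_set B \<longleftrightarrow> finite B \<and> pairwise orthogonal B \<and> (\<forall>b\<in>B. norm b = 1)"

text \<open>\<open>subspace_lborel\<close> with an explicit basis in place of the one picked by
  \<open>SOME\<close>, so that inductions over the basis and splittings of it are possible. Once
  independence of the basis is known, \<open>subspace_lborel_eq_span_lborel\<close> identifies the
  two.\<close>

definition span_lborel :: "'a::euclidean_space set \<Rightarrow> 'a measure" where
  "span_lborel B = distr (\<Pi>\<^sub>M b\<in>B. lborel) borel (\<lambda>y. \<Sum>b\<in>B. y b *\<^sub>R b)"

lemma space_span_lborel [simp]: "space (span_lborel B) = UNIV"
  and sets_span_lborel [simp, measurable_cong]: "sets (span_lborel B) = sets borel"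
  by (simp_all add: span_lborel_def)

lemma borel_measurable_span_lborel [simp]: "borel_measurable (span_lborel B) = borel_measurable borel"
  by (simp cong: measurable_cong_sets)

lemma measurable_sum_PiM [measurable]:
  "(\<lambda>y. \<Sum>b\<in>B. y b *\<^sub>R b) \<in> borel_measurable (\<Pi>\<^sub>M b\<in>B. (lborel :: real measure))"
  for B :: "'a::euclidean_space set"
  by (intro borel_measurable_sum borel_measurable_scaleR) auto

interpretation lborel_product: product_sigma_finite "\<lambda>b::'a::euclidean_space. lborel :: real measure"
  by standard

lemma nn_integral_span_lborel_empty:
  assumes "f \<in> borel_measurable borel"
  shows "integral\<^sup>N (span_lborel {}) f = f 0"
  using assms by (simp add: span_lborel_def nn_integral_distr lborel_product.nn_integral_empty del: nn_integral_const)

lemma nn_integral_span_lborel_insert: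
  fixes f :: "'a::euclidean_space \<Rightarrow> ennreal"
  assumes "finite B" "b \<notin> B" and [measurable]: "f \<in> borel_measurable borel"
  shows "integral\<^sup>N (span_lborel (insert b B)) f =
    (\<integral>\<^sup>+ s. \<integral>\<^sup>+ x. f (x + s *\<^sub>R b) \<partial>span_lborel B \<partial>lborel)"
proof -
  have *: "(\<Sum>c\<in>insert b B. (x(b := s)) c *\<^sub>R c) = (\<Sum>c\<in>B. x c *\<^sub>R c) + s *\<^sub>R b" for x :: "'a \<Rightarrow> real" and s
  proof -
    have "(\<Sum>c\<in>B. (x(b := s)) c *\<^sub>R c) = (\<Sum>c\<in>B. x c *\<^sub>R c)"
      using assms by (intro sum.cong) auto
    then show ?thesis using assms by (simp add: add.commute)
  qed
  show ?thesis
    unfolding span_lborel_def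
    using assms(1,2)
    by (simp add: nn_integral_distr lborel_product.product_nn_integral_insert_rev * del: sum.insert fun_upd_apply)
qed

lemma AE_span_lborel: "AE x in span_lborel B. x \<in> span B"
proof (cases "finite B")
  case True
  have [measurable]: "span B \<in> sets borel"
    by (intro borel_closed closed_subspace subspace_span)
  show ?thesis
    unfolding span_lborel_def
    by (subst AE_distr_iff) (auto intro!: AE_I2 span_sum span_scale intro: span_base)
next
  \<comment> \<open>A sum over an infinite set is 0 by convention, so every point is mapped to the
    origin.\<close>
  case False
  then show ?thesis
    unfolding span_lborel_def
    by (subst AE_distr_iff) (auto intro!: borel_closed closed_subspace span_zero)
qed


lemma orthonormal_set_insertD:
  assumes "orthonormal_set (insert b B)" "b \<notin> B"
  shows "orthonormal_set B" "norm b = 1" "\<And>x. x \<in> span B \<Longrightarrow> x \<bullet> b = 0"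
proof -
  show "orthonormal_set B" "norm b = 1"
    using assms by (auto simp: orthonormal_set_def pairwise_insert)
  fix x assume "x \<in> span B"
  moreover have "orthogonal b c" if "c \<in> B" for c
    using assms that by (auto simp: orthonormal_set_def pairwise_insert)
  ultimately show "x \<bullet> b = 0"
    by (metis orthogonal_def inner_commute orthogonal_to_span)
qed

lemma orthonormal_set_independent:
  assumes "orthonormal_set B"
  shows "independent B"
proof (rule pairwise_orthogonal_independent)
  show "pairwise orthogonal B" "0 \<notin> B" using assms by (auto simp: orthonormal_set_def)
qed

lemma orthonormal_set_finite [dest]: "orthonormal_set B \<Longrightarrow> finite B"
  by (simp add: orthonormal_set_def)

lemma norm_add_orthogonal_unit:
  assumes "x \<bullet> b = 0" "norm b = 1"
  shows "(norm (x + s *\<^sub>R b))\<^sup>2 = (norm x)\<^sup>2 + s\<^sup>2"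
  using assms by (subst norm_add_Pythagorean) (auto simp: orthogonal_def)

lemma norm_add_orthogonal_unit_ge:
  assumes "x \<bullet> b = 0" "norm b = 1"
  shows "norm x \<le> norm (x + s *\<^sub>R b)" "\<bar>s\<bar> \<le> norm (x + s *\<^sub>R b)"
  using norm_add_orthogonal_unit[OF assms, of s]
    power2_le_imp_le[of "norm x" "norm (x + s *\<^sub>R b)"] power2_le_imp_le[of "\<bar>s\<bar>" "norm (x + s *\<^sub>R b)"]
  by simp_all

lemma norm_le_norm_add_orthogonal:
  assumes "a \<bullet> b = 0"
  shows "norm a \<le> norm (a + b)"
proof -
  have "(norm (a + b))\<^sup>2 = (norm a)\<^sup>2 + (norm b)\<^sup>2"
    using assms by (intro norm_add_Pythagorean) (simp add: orthogonal_def)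
  then show ?thesis using power2_le_imp_le[of "norm a" "norm (a + b)"] by simp
qed

lemma borel_measurable_indicator_cball [simp]:
  "(indicator (cball a r) :: 'a::metric_space \<Rightarrow> ennreal) \<in> borel_measurable borel"
  by (intro borel_measurable_indicator borel_closed closed_cball)

text \<open>The ball lies in the cube of side 2 r, so slicing off a basis vector costs at most a
  factor 2 r. The explicit constant gives finiteness on bounded sets and, in
  \<open>section_average\<close>, a bound on hyperplane sections that is uniform in the
  direction.\<close>

lemma emeasure_span_lborel_cball:
  fixes B :: "'a::euclidean_space set"
  assumes "orthonormal_set B" "r \<ge> 0"
  shows "emeasure (span_lborel B) (cball 0 r) \<le> ennreal ((2 * r) ^ card B)"
proof -
  have "finite B" using assms by auto
  then show ?thesis using assms
  proof (induction B rule: finite_induct)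
    case empty
    then show ?case
      using nn_integral_span_lborel_empty[of "indicator (cball (0::'a) r)"] by auto
  next
    case (insert b B)
    note o = orthonormal_set_insertD[OF insert.prems(1) insert.hyps(2)]
    have "emeasure (span_lborel (insert b B)) (cball 0 r)
      = (\<integral>\<^sup>+ s. \<integral>\<^sup>+ x. indicator (cball 0 r) (x + s *\<^sub>R b) \<partial>span_lborel B \<partial>lborel)"
      using nn_integral_span_lborel_insert[OF insert.hyps, of "indicator (cball 0 r)"] by simp
    also have "\<dots> \<le> (\<integral>\<^sup>+ s. indicator {-r..r} s * emeasure (span_lborel B) (cball 0 r) \<partial>lborel)"
    proof (rule nn_integral_mono)
      fix s :: real
      have "(\<integral>\<^sup>+ x. indicator (cball 0 r) (x + s *\<^sub>R b) \<partial>span_lborel B)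
        \<le> (\<integral>\<^sup>+ x. indicator {-r..r} s * indicator (cball 0 r) x \<partial>span_lborel B)"
      proof (rule nn_integral_mono_AE)
        show "AE x in span_lborel B. (indicator (cball 0 r) (x + s *\<^sub>R b) :: ennreal) \<le> indicator {-r..r} s * indicator (cball 0 r) x"
          using AE_span_lborel
        proof eventually_elim
          case (elim x)
          then show ?case
            using norm_add_orthogonal_unit_ge[OF o(3)[OF elim] o(2), of s]
            by (auto simp: indicator_def abs_le_iff)
        qed
      qed
      then show "(\<integral>\<^sup>+ x. indicator (cball 0 r) (x + s *\<^sub>R b) \<partial>span_lborel B)
        \<le> indicator {-r..r} s * emeasure (span_lborel B) (cball 0 r)"
        by (simp add: nn_integral_cmult)
    qed
    also have "\<dots> = ennreal (2 * r) * emeasure (span_lborel B) (cball 0 r)"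
      using insert.prems(2) by (simp add: nn_integral_multc)
    also have "\<dots> \<le> ennreal (2 * r) * ennreal ((2 * r) ^ card B)"
      using insert o by (intro mult_left_mono) auto
    finally show ?case
      using insert by (simp add: ennreal_mult)
  qed
qed

lemma integrable_bounded_support:
  fixes f :: "'a::euclidean_space \<Rightarrow> real"
  assumes "orthonormal_set B" "f \<in> borel_measurable borel" "R \<ge> 0"
    and bound: "\<And>x. \<bar>f x\<bar> \<le> C * indicator (cball 0 R) x"
  shows "integrable (span_lborel B) f"
proof (rule Bochner_Integration.integrable_bound)
  have "emeasure (span_lborel B) (cball 0 R) < \<infinity>"
    using emeasure_span_lborel_cball[OF assms(1,3)] by (auto intro: le_less_trans)
  then show "integrable (span_lborel B) (\<lambda>x. C * indicator (cball 0 R) x :: real)"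
    by (intro integrable_mult_right integrable_real_indicator) auto
  show "AE x in span_lborel B. norm (f x) \<le> norm (C * indicator (cball 0 R) x :: real)"
    using bound by (auto intro!: AE_I2 intro: order_trans[OF _ abs_ge_self])
qed (use assms in simp)

lemma sigma_finite_span_lborel:
  assumes "orthonormal_set B"
  shows "sigma_finite_measure (span_lborel B)"
proof
  show "\<exists>A. countable A \<and> A \<subseteq> sets (span_lborel B) \<and> \<Union> A = space (span_lborel B) \<and> (\<forall>a\<in>A. emeasure (span_lborel B) a \<noteq> \<infinity>)"
  proof (intro exI[of _ "range (\<lambda>n::nat. cball 0 (real n))"] conjI ballI)
    show "\<Union> (range (\<lambda>n::nat. cball (0::'a) (real n))) = space (span_lborel B)"
      by (auto simp: real_arch_simple)
    fix a assume "a \<in> range (\<lambda>n::nat. cball (0::'a) (real n))"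
    then obtain n :: nat where "a = cball 0 (real n)" by auto
    then show "emeasure (span_lborel B) a \<noteq> \<infinity>"
      using emeasure_span_lborel_cball[OF assms, of "real n"]
      by (auto simp: top_unique)
  qed auto
qed

lemma nn_integral_span_lborel_add:
  fixes f :: "'a::euclidean_space \<Rightarrow> ennreal"
  assumes B: "orthonormal_set B" and "x \<in> span B" and "f \<in> borel_measurable borel"
  shows "(\<integral>\<^sup>+ y. f (y + x) \<partial>span_lborel B) = integral\<^sup>N (span_lborel B) f"
proof -
  have "finite B" using B by auto
  then show ?thesis using assms
  proof (induction B arbitrary: f x rule: finite_induct)
    case empty
    then show ?case by simp
  next
    case (insert b B)
    note o = orthonormal_set_insertD[OF insert.prems(1) insert.hyps(2)]
    interpret sigma_finite_measure "span_lborel B" by (rule sigma_finite_span_lborel[OF o(1)])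
    note [measurable] = insert.prems(3)
    from insert.prems(2) obtain k where k: "x - k *\<^sub>R b \<in> span B"
      by (auto simp: span_insert)
    have "(\<integral>\<^sup>+ y. f (y + x) \<partial>span_lborel (insert b B))
      = (\<integral>\<^sup>+ s. \<integral>\<^sup>+ y. f ((y + (x - k *\<^sub>R b)) + (k + 1 * s) *\<^sub>R b) \<partial>span_lborel B \<partial>lborel)"
      using insert.hyps by (simp add: nn_integral_span_lborel_insert algebra_simps)
    also have "\<dots> = (\<integral>\<^sup>+ s. \<integral>\<^sup>+ y. f (y + (k + 1 * s) *\<^sub>R b) \<partial>span_lborel B \<partial>lborel)"
      using k o by (intro nn_integral_cong insert.IH[where f="\<lambda>y. f (y + c)" for c]) auto
    also have "\<dots> = (\<integral>\<^sup>+ s. \<integral>\<^sup>+ y. f (y + s *\<^sub>R b) \<partial>span_lborel B \<partial>lborel)"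
      by (subst nn_integral_real_affine[where c=1 and t=k and f="\<lambda>s. \<integral>\<^sup>+ y. f (y + s *\<^sub>R b) \<partial>span_lborel B"]) auto
    finally show ?case
      using insert by (simp add: nn_integral_span_lborel_insert)
  qed
qed

lemma nn_integral_span_lborel_scale:
  fixes f :: "'a::euclidean_space \<Rightarrow> ennreal"
  assumes B: "orthonormal_set B" and "c \<noteq> 0" and "f \<in> borel_measurable borel"
  shows "integral\<^sup>N (span_lborel B) f = ennreal (\<bar>c\<bar> ^ card B) * (\<integral>\<^sup>+ y. f (c *\<^sub>R y) \<partial>span_lborel B)"
proof -
  have "finite B" using B by auto
  then show ?thesis using assms
  proof (induction B arbitrary: f rule: finite_induct)
    case empty
    then show ?case by (simp add: nn_integral_span_lborel_empty)
  next
    case (insert b B)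
    note o = orthonormal_set_insertD[OF insert.prems(1) insert.hyps(2)]
    interpret sigma_finite_measure "span_lborel B" by (rule sigma_finite_span_lborel[OF o(1)])
    note [measurable] = insert.prems(3)
    have "integral\<^sup>N (span_lborel (insert b B)) f = (\<integral>\<^sup>+ s. \<integral>\<^sup>+ y. f (y + s *\<^sub>R b) \<partial>span_lborel B \<partial>lborel)"
      using insert.hyps by (simp add: nn_integral_span_lborel_insert)
    also have "\<dots> = \<bar>c\<bar> * (\<integral>\<^sup>+ s. \<integral>\<^sup>+ y. f (y + (c * s) *\<^sub>R b) \<partial>span_lborel B \<partial>lborel)"
      using insert.prems(2)
      by (subst nn_integral_real_affine[where c=c and t=0 and f="\<lambda>s. \<integral>\<^sup>+ y. f (y + s *\<^sub>R b) \<partial>span_lborel B"]) auto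
    also have "(\<integral>\<^sup>+ s. \<integral>\<^sup>+ y. f (y + (c * s) *\<^sub>R b) \<partial>span_lborel B \<partial>lborel)
      = (\<integral>\<^sup>+ s. ennreal (\<bar>c\<bar> ^ card B) * \<integral>\<^sup>+ y. f (c *\<^sub>R y + (c * s) *\<^sub>R b) \<partial>span_lborel B \<partial>lborel)"
      using insert.prems(2) o by (intro nn_integral_cong insert.IH[where f="\<lambda>y. f (y + c)" for c]) auto
    also have "\<dots> = ennreal (\<bar>c\<bar> ^ card B) * (\<integral>\<^sup>+ s. \<integral>\<^sup>+ y. f (c *\<^sub>R (y + s *\<^sub>R b)) \<partial>span_lborel B \<partial>lborel)"
      by (subst nn_integral_cmult) (auto simp: scaleR_add_right)
    finally show ?case
      using insert.hyps by (simp add: nn_integral_span_lborel_insert ennreal_mult mult.assoc)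
  qed
qed

text \<open>At height s along a basis vector the ball of radius r is a ball of radius
  \<open>sqrt (r\<^sup>2 - s\<^sup>2)\<close>, so the measures of balls satisfy a recursion that
  only knows the number of basis vectors. This is the normalisation in the uniqueness argument of
  \<open>span_lborel_cong_span\<close>.\<close>

lemma emeasure_span_lborel_cball_cong:
  fixes A B :: "'a::euclidean_space set"
  assumes A: "orthonormal_set A" and B: "orthonormal_set B" and "card A = card B"
  shows "emeasure (span_lborel A) (cball 0 r) = emeasure (span_lborel B) (cball 0 r)"
proof -
  have "finite A" using A by auto
  then show ?thesis using assms
  proof (induction A arbitrary: B r rule: finite_induct)
    case empty
    then have "B = {}" by (auto simp: orthonormal_set_def)
    then show ?case by simp
  next
    case (insert a A)
    then have "finite B" "card B = Suc (card A)" by (auto simp: orthonormal_set_def)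
    then obtain b B' where B': "B = insert b B'" "b \<notin> B'" "finite B'" "card B' = card A"
      by (metis card_Suc_eq_finite)
    have *: "emeasure (span_lborel (insert b B)) (cball 0 r)
      = (\<integral>\<^sup>+ s. (if \<bar>s\<bar> \<le> r then emeasure (span_lborel B) (cball 0 (sqrt (r\<^sup>2 - s\<^sup>2))) else 0) \<partial>lborel)"
      if ons: "orthonormal_set (insert b B)" and "b \<notin> B" for b :: 'a and B
    proof -
      note o = orthonormal_set_insertD[OF that]
      have "finite B" using o(1) by auto
      have "emeasure (span_lborel (insert b B)) (cball 0 r)
        = (\<integral>\<^sup>+ s. \<integral>\<^sup>+ x. indicator (cball 0 r) (x + s *\<^sub>R b) \<partial>span_lborel B \<partial>lborel)"
        using nn_integral_span_lborel_insert[OF \<open>finite B\<close> \<open>b \<notin> B\<close>, of "indicator (cball 0 r)"] by simp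
      also have "\<dots> = (\<integral>\<^sup>+ s. (if \<bar>s\<bar> \<le> r then emeasure (span_lborel B) (cball 0 (sqrt (r\<^sup>2 - s\<^sup>2))) else 0) \<partial>lborel)"
      proof (rule nn_integral_cong)
        fix s :: real
        have "(\<integral>\<^sup>+ x. indicator (cball 0 r) (x + s *\<^sub>R b) \<partial>span_lborel B)
          = (\<integral>\<^sup>+ x. (if \<bar>s\<bar> \<le> r then indicator (cball 0 (sqrt (r\<^sup>2 - s\<^sup>2))) x else 0) \<partial>span_lborel B)"
        proof (rule nn_integral_cong_AE)
          show "AE x in span_lborel B. (indicator (cball 0 r) (x + s *\<^sub>R b) :: ennreal) =
            (if \<bar>s\<bar> \<le> r then indicator (cball 0 (sqrt (r\<^sup>2 - s\<^sup>2))) x else 0)"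
            using AE_span_lborel
          proof eventually_elim
            case (elim x)
            note eq = norm_add_orthogonal_unit[OF o(3)[OF elim] o(2), of s]
            show ?case
            proof (cases "\<bar>s\<bar> \<le> r")
              case True
              then have "norm (x + s *\<^sub>R b) \<le> r \<longleftrightarrow> (norm (x + s *\<^sub>R b))\<^sup>2 \<le> r\<^sup>2"
                by (auto simp: abs_le_square_iff[symmetric])
              also have "\<dots> \<longleftrightarrow> norm x \<le> sqrt (r\<^sup>2 - s\<^sup>2)"
                unfolding eq using real_sqrt_le_iff[of "(norm x)\<^sup>2" "r\<^sup>2 - s\<^sup>2"] by (auto simp: le_diff_eq)
              finally show ?thesis using True by (auto simp: indicator_def)
            next
              case False
              then show ?thesis
                using norm_add_orthogonal_unit_ge[OF o(3)[OF elim] o(2), of s] by (auto simp: indicator_def)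
            qed
          qed
        qed
        then show "(\<integral>\<^sup>+ x. indicator (cball 0 r) (x + s *\<^sub>R b) \<partial>span_lborel B)
          = (if \<bar>s\<bar> \<le> r then emeasure (span_lborel B) (cball 0 (sqrt (r\<^sup>2 - s\<^sup>2))) else 0)"
          by (simp split: if_splits)
      qed
      finally show ?thesis .
    qed
    have IH: "emeasure (span_lborel A) (cball 0 t) = emeasure (span_lborel B') (cball 0 t)" for t
      using insert.IH[of B' t] orthonormal_set_insertD(1)[OF insert.prems(1) insert.hyps(2)]
        orthonormal_set_insertD(1)[of b B'] insert.prems(2) B' by simp
    show ?case
      using *[OF insert.prems(1) insert.hyps(2)] *[of b B'] insert.prems(2) B' unfolding IH by simp
  qed
qed


text \<open>Uniqueness of Haar measure: both measures are invariant under translations by the common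
  span. Evaluating the double integral of f (x) g (y - x) in two ways, with g the indicator of the
  unit ball, gives \<open>?J f * ?I g = ?I f * ?J g\<close>, and the two measures agree on the ball.
  No change of variables under rotations is involved.\<close>

lemma span_lborel_cong_span:
  fixes A B :: "'a::euclidean_space set"
  assumes A: "orthonormal_set A" and B: "orthonormal_set B" and AB: "span A = span B"
  shows "span_lborel A = span_lborel B"
proof (rule measure_eqI)
  fix S assume "S \<in> sets (span_lborel A)"
  then have S [measurable]: "S \<in> sets borel" by simp
  interpret A: sigma_finite_measure "span_lborel A" by (rule sigma_finite_span_lborel[OF A])
  interpret B: sigma_finite_measure "span_lborel B" by (rule sigma_finite_span_lborel[OF B])
  interpret pair_sigma_finite "span_lborel A" "span_lborel B" ..
  define g :: "'a \<Rightarrow> ennreal" where "g = indicator (cball 0 1)"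
  define f :: "'a \<Rightarrow> ennreal" where "f = indicator S"
  have [measurable]: "f \<in> borel_measurable borel" "g \<in> borel_measurable borel"
    by (auto simp: f_def g_def)
  have gm: "g (- x) = g x" for x by (simp add: g_def indicator_def)
  let ?I = "\<lambda>h. \<integral>\<^sup>+ x. h x \<partial>span_lborel A" and ?J = "\<lambda>h. \<integral>\<^sup>+ x. h x \<partial>span_lborel B"
  have card: "card A = card B"
  proof -
    have "independent A" "independent B"
      using A B by (auto simp: orthonormal_set_independent)
    then show ?thesis using AB by (metis dim_eq_card_independent dim_span)
  qed
  have fin: "?I g = ?J g" "?J g < \<infinity>"
    using emeasure_span_lborel_cball_cong[OF A B card, of 1] emeasure_span_lborel_cball[OF B, of 1]
    by (auto simp: g_def intro: le_less_trans)
  \<comment> \<open>Cancelling needs a ball of positive mass. If the unit ball were null, then by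
    scaling so would be all balls of integer radius and hence the whole space, although the
    coordinate cube has mass 1.\<close>
  have pos: "?J g \<noteq> 0"
  proof
    assume "?J g = 0"
    then have "emeasure (span_lborel B) (cball 0 1) = 0" by (simp add: g_def)
    moreover have "emeasure (span_lborel B) (cball 0 (real (Suc n))) = ennreal (real (Suc n) ^ card B) * emeasure (span_lborel B) (cball 0 1)" for n
    proof -
      have "emeasure (span_lborel B) (cball 0 (real (Suc n))) = ennreal (\<bar>real (Suc n)\<bar> ^ card B) *
        (\<integral>\<^sup>+ y. indicator (cball 0 (real (Suc n))) (real (Suc n) *\<^sub>R y) \<partial>span_lborel B)"
        using nn_integral_span_lborel_scale[OF B, of "real (Suc n)" "indicator (cball 0 (real (Suc n)))"] by simp
      also have "(\<lambda>y. indicator (cball 0 (real (Suc n))) (real (Suc n) *\<^sub>R y)) = (indicator (cball 0 1) :: 'a \<Rightarrow> ennreal)"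
        by (auto simp: indicator_def fun_eq_iff mult_le_cancel_left1 simp del: of_nat_Suc)
      finally show ?thesis by simp
    qed
    ultimately have z: "emeasure (span_lborel B) (cball 0 (real (Suc n))) = 0" for n by simp
    have "emeasure (span_lborel B) (\<Union>n. cball 0 (real (Suc n))) = 0"
      by (rule emeasure_UN_eq_0) (use z in auto)
    moreover have "(\<Union>n. cball (0::'a) (real (Suc n))) = UNIV"
    proof -
      have "\<exists>n. norm x \<le> real (Suc n)" for x :: 'a
        by (meson le_SucI of_nat_le_iff order_trans real_arch_simple lessI less_imp_le)
      then show ?thesis by auto
    qed
    ultimately have "emeasure (span_lborel B) UNIV = 0" by simp
    moreover have "emeasure (span_lborel B) UNIV = emeasure (Pi\<^sub>M B (\<lambda>_. lborel :: real measure)) (space (Pi\<^sub>M B (\<lambda>_. lborel)))"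
      by (simp add: span_lborel_def emeasure_distr)
    moreover have "emeasure (Pi\<^sub>M B (\<lambda>_. lborel :: real measure)) (space (Pi\<^sub>M B (\<lambda>_. lborel)))
        \<ge> emeasure (Pi\<^sub>M B (\<lambda>_. lborel)) (Pi\<^sub>E B (\<lambda>_. {0..1::real}))"
      by (rule emeasure_mono) (auto simp: space_PiM intro: sets.top[of "Pi\<^sub>M B (\<lambda>_. lborel)", simplified space_PiM space_lborel space_borel])
    moreover have "emeasure (Pi\<^sub>M B (\<lambda>_. lborel)) (Pi\<^sub>E B (\<lambda>_. {0..1::real})) = 1"
      using B by (subst lborel_product.emeasure_PiM) auto
    ultimately show False by simp
  qed
  have "?J f * ?I g = (\<integral>\<^sup>+ x. f x * \<integral>\<^sup>+ y. g y \<partial>span_lborel A \<partial>span_lborel B)"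
    by (subst nn_integral_multc) auto
  also have "\<dots> = (\<integral>\<^sup>+ x. f x * \<integral>\<^sup>+ y. g (y - x) \<partial>span_lborel A \<partial>span_lborel B)"
  proof (rule nn_integral_cong_AE)
    show "AE x in span_lborel B. f x * \<integral>\<^sup>+ y. g y \<partial>span_lborel A = f x * \<integral>\<^sup>+ y. g (y - x) \<partial>span_lborel A"
      using AE_span_lborel
    proof eventually_elim
      case (elim x)
      then have "- x \<in> span A" using AB by (simp add: span_neg)
      from nn_integral_span_lborel_add[OF A this, of g] show ?case by simp
    qed
  qed
  also have "\<dots> = (\<integral>\<^sup>+ y. \<integral>\<^sup>+ x. f x * g (y - x) \<partial>span_lborel B \<partial>span_lborel A)"
    by (subst Fubini'[symmetric]) (auto simp: nn_integral_cmult)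
  \<comment> \<open>Translation by y in the variable x turns g (y - x) into g (- x), which is g (x)
    because the ball is symmetric.\<close>
  also have "\<dots> = (\<integral>\<^sup>+ y. \<integral>\<^sup>+ x. f (x + y) * g x \<partial>span_lborel B \<partial>span_lborel A)"
  proof (rule nn_integral_cong_AE)
    show "AE y in span_lborel A. (\<integral>\<^sup>+ x. f x * g (y - x) \<partial>span_lborel B) = (\<integral>\<^sup>+ x. f (x + y) * g x \<partial>span_lborel B)"
      using AE_span_lborel
    proof eventually_elim
      case (elim y)
      then have "y \<in> span B" using AB by simp
      from nn_integral_span_lborel_add[OF B this, of "\<lambda>x. f x * g (y - x)"] show ?case by (simp add: gm)
    qed
  qed
  also have "\<dots> = (\<integral>\<^sup>+ x. g x * \<integral>\<^sup>+ y. f (y + x) \<partial>span_lborel A \<partial>span_lborel B)"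
    by (subst Fubini'[symmetric]) (auto simp: nn_integral_cmult[symmetric] mult.commute add.commute intro!: nn_integral_cong)
  also have "\<dots> = (\<integral>\<^sup>+ x. g x * \<integral>\<^sup>+ y. f y \<partial>span_lborel A \<partial>span_lborel B)"
  proof (rule nn_integral_cong_AE)
    show "AE x in span_lborel B. g x * \<integral>\<^sup>+ y. f (y + x) \<partial>span_lborel A = g x * \<integral>\<^sup>+ y. f y \<partial>span_lborel A"
      using AE_span_lborel
    proof eventually_elim
      case (elim x)
      then show ?case using AB nn_integral_span_lborel_add[OF A, of x f] by simp
    qed
  qed
  also have "\<dots> = ?I f * ?J g"
    by (subst nn_integral_multc) (auto simp: mult.commute)
  finally have "?J g * ?J f = ?J g * ?I f" using fin by (simp add: mult.commute)
  then have "?J f = ?I f"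
    using fin pos by (auto simp: ennreal_mult_cancel_left less_top)
  then show "emeasure (span_lborel A) S = emeasure (span_lborel B) S"
    by (simp add: f_def)
qed simp


lemma subspace_lborel_eq_span_lborel:
  assumes "orthonormal_set A" "span A = H"
  shows "subspace_lborel H = span_lborel A"
proof -
  define B where "B = (SOME B. orthonormal_basis_of H B)"
  have "orthonormal_basis_of H A"
    using assms by (simp add: orthonormal_basis_of_def orthonormal_set_def)
  then have B: "orthonormal_basis_of H B"
    unfolding B_def by (rule someI)
  then have "0 \<notin> B" by (auto simp: orthonormal_basis_of_def)
  with B have "independent B"
    by (intro pairwise_orthogonal_independent) (auto simp: orthonormal_basis_of_def)
  then have "orthonormal_set B"
    using B by (simp add: orthonormal_set_def orthonormal_basis_of_def independent_imp_finite)
  moreover have "span B = H" using B by (simp add: orthonormal_basis_of_def)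
  ultimately have "span_lborel B = span_lborel A"
    using assms by (intro span_lborel_cong_span) auto
  then show ?thesis
    by (simp add: subspace_lborel_def span_lborel_def B_def Let_def)
qed

lemma orthonormal_set_Basis: "orthonormal_set (Basis :: 'a::euclidean_space set)"
  by (auto simp: orthonormal_set_def pairwise_def orthogonal_def inner_not_same_Basis)

lemma span_lborel_Basis: "span_lborel Basis = lborel"
  by (simp add: span_lborel_def lborel_eq[symmetric])

lemma orthonormal_set_subset: "orthonormal_set B \<Longrightarrow> A \<subseteq> B \<Longrightarrow> orthonormal_set A"
  by (auto simp: orthonormal_set_def intro: finite_subset pairwise_subset)

lemma nn_integral_span_lborel_Un:
  fixes f :: "'a::euclidean_space \<Rightarrow> ennreal"
  assumes "orthonormal_set (A \<union> B)" "A \<inter> B = {}" "f \<in> borel_measurable borel"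
  shows "integral\<^sup>N (span_lborel (A \<union> B)) f = (\<integral>\<^sup>+ x. \<integral>\<^sup>+ y. f (x + y) \<partial>span_lborel B \<partial>span_lborel A)"
proof -
  have "finite B" "finite A" using assms by (auto simp: orthonormal_set_def)
  from this(1) show ?thesis using assms
  proof (induction B arbitrary: f rule: finite_induct)
    case empty
    note [measurable] = empty.prems(3)
    have "(\<integral>\<^sup>+ y. f (x + y) \<partial>span_lborel {}) = f x" for x
      by (subst nn_integral_span_lborel_empty) auto
    then show ?case by simp
  next
    case (insert b B)
    note [measurable] = insert.prems(3)
    have o: "orthonormal_set A" "orthonormal_set B" "orthonormal_set (A \<union> B)"
      using insert.prems(1) by (auto elim!: orthonormal_set_subset)
    interpret A: sigma_finite_measure "span_lborel A" by (rule sigma_finite_span_lborel[OF o(1)])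
    interpret B: sigma_finite_measure "span_lborel B" by (rule sigma_finite_span_lborel[OF o(2)])
    interpret pair_sigma_finite "span_lborel A" "lborel :: real measure" ..
    have "integral\<^sup>N (span_lborel (A \<union> insert b B)) f
      = (\<integral>\<^sup>+ s. \<integral>\<^sup>+ z. f (z + s *\<^sub>R b) \<partial>span_lborel (A \<union> B) \<partial>lborel)"
      using insert \<open>finite A\<close> nn_integral_span_lborel_insert[of "A \<union> B" b f] by auto
    also have "\<dots> = (\<integral>\<^sup>+ s. \<integral>\<^sup>+ x. \<integral>\<^sup>+ y. f (x + y + s *\<^sub>R b) \<partial>span_lborel B \<partial>span_lborel A \<partial>lborel)"
      using insert.prems o by (intro nn_integral_cong insert.IH[where f="\<lambda>y. f (y + c)" for c]) auto
    also have "\<dots> = (\<integral>\<^sup>+ x. \<integral>\<^sup>+ s. \<integral>\<^sup>+ y. f (x + y + s *\<^sub>R b) \<partial>span_lborel B \<partial>lborel \<partial>span_lborel A)"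
      by (rule Fubini') simp
    also have "\<dots> = (\<integral>\<^sup>+ x. \<integral>\<^sup>+ y. f (x + y) \<partial>span_lborel (insert b B) \<partial>span_lborel A)"
      using insert.hyps by (simp add: nn_integral_span_lborel_insert add.assoc)
    finally show ?case .
  qed
qed

lemma span_lborel_Un:
  fixes A B :: "'a::euclidean_space set"
  assumes AB: "orthonormal_set (A \<union> B)" "A \<inter> B = {}"
  shows "span_lborel (A \<union> B) = distr (span_lborel A \<Otimes>\<^sub>M span_lborel B) borel (\<lambda>(x, y). x + y)"
proof (rule measure_eqI)
  fix S assume "S \<in> sets (span_lborel (A \<union> B))"
  then have [measurable]: "S \<in> sets borel" by simp
  have o: "orthonormal_set A" "orthonormal_set B"
    using AB(1) by (auto elim!: orthonormal_set_subset)
  interpret B: sigma_finite_measure "span_lborel B" by (rule sigma_finite_span_lborel[OF o(2)])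
  have "emeasure (distr (span_lborel A \<Otimes>\<^sub>M span_lborel B) borel (\<lambda>(x, y). x + y)) S
    = integral\<^sup>N (distr (span_lborel A \<Otimes>\<^sub>M span_lborel B) borel (\<lambda>(x, y). x + y)) (indicator S)"
    by simp
  also have "\<dots> = (\<integral>\<^sup>+ x. \<integral>\<^sup>+ y. indicator S (x + y) \<partial>span_lborel B \<partial>span_lborel A)"
    by (subst nn_integral_distr, simp, simp, subst B.nn_integral_fst[symmetric]) simp_all
  also have "\<dots> = integral\<^sup>N (span_lborel (A \<union> B)) (indicator S)"
    using AB by (subst nn_integral_span_lborel_Un) auto
  finally show "emeasure (span_lborel (A \<union> B)) S = emeasure (distr (span_lborel A \<Otimes>\<^sub>M span_lborel B) borel (\<lambda>(x, y). x + y)) S"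
    by simp
qed simp

lemma span_lborel_singleton: "span_lborel {b} = distr lborel borel (\<lambda>s. s *\<^sub>R b)"
proof (rule measure_eqI)
  fix S assume "S \<in> sets (span_lborel {b})"
  then have [measurable]: "S \<in> sets borel" by simp
  have "integral\<^sup>N (span_lborel {b}) (indicator S) = (\<integral>\<^sup>+ s. indicator S (s *\<^sub>R b) \<partial>lborel)"
    by (subst nn_integral_span_lborel_insert) (auto simp: nn_integral_span_lborel_empty)
  also have "\<dots> = integral\<^sup>N (distr lborel borel (\<lambda>s. s *\<^sub>R b)) (indicator S)"
    by (subst nn_integral_distr) auto
  finally show "emeasure (span_lborel {b}) S = emeasure (distr lborel borel (\<lambda>s. s *\<^sub>R b)) S"
    by simp
qed simp

text \<open>Scaling stated as an identity of measures, so that it transfers from nonnegative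
  integrals to Bochner integrals and to integrability.\<close>

lemma span_lborel_eq_density_scale:
  fixes B :: "'a::euclidean_space set"
  assumes B: "orthonormal_set B" and "c \<noteq> 0"
  shows "span_lborel B = density (distr (span_lborel B) borel ((*\<^sub>R) c)) (\<lambda>_. ennreal (\<bar>c\<bar> ^ card B))"
proof (rule measure_eqI)
  fix S assume "S \<in> sets (span_lborel B)"
  then have [measurable]: "S \<in> sets borel" by simp
  show "emeasure (span_lborel B) S = emeasure (density (distr (span_lborel B) borel ((*\<^sub>R) c)) (\<lambda>_. ennreal (\<bar>c\<bar> ^ card B))) S"
    using nn_integral_span_lborel_scale[OF assms, of "indicator S"]
    by (simp add: emeasure_density nn_integral_cmult nn_integral_distr del: nn_integral_indicator)
      (simp add: nn_integral_indicator)
qed simp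

lemma integral_span_lborel_scale:
  fixes f :: "'a::euclidean_space \<Rightarrow> 'b::{banach, second_countable_topology}"
  assumes "orthonormal_set B" and "c \<noteq> 0" and [measurable]: "f \<in> borel_measurable borel"
  shows "(\<integral>x. f x \<partial>span_lborel B) = (\<bar>c\<bar> ^ card B) *\<^sub>R (\<integral>x. f (c *\<^sub>R x) \<partial>span_lborel B)"
  by (subst span_lborel_eq_density_scale[OF assms(1,2)], subst integral_density)
     (auto simp: integral_distr)

lemma integrable_span_lborel_scale:
  fixes f :: "'a::euclidean_space \<Rightarrow> 'b::{banach, second_countable_topology}"
  assumes "orthonormal_set B" and "c \<noteq> 0" and [measurable]: "f \<in> borel_measurable borel"
  shows "integrable (span_lborel B) (\<lambda>x. f (c *\<^sub>R x)) \<longleftrightarrow> integrable (span_lborel B) f"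
proof -
  have "integrable (span_lborel B) f \<longleftrightarrow> integrable (span_lborel B) (\<lambda>x. (\<bar>c\<bar> ^ card B) *\<^sub>R f (c *\<^sub>R x))"
    by (subst span_lborel_eq_density_scale[OF assms(1,2)], subst integrable_density)
       (auto simp: integrable_distr_eq)
  moreover have "integrable (span_lborel B) (\<lambda>x. (\<bar>c\<bar> ^ card B) *\<^sub>R f (c *\<^sub>R x)) \<longleftrightarrow> integrable (span_lborel B) (\<lambda>x. f (c *\<^sub>R x))"
    using assms(2) integrable_scaleR_right[of "inverse (\<bar>c\<bar> ^ card B)" "span_lborel B" "\<lambda>x. (\<bar>c\<bar> ^ card B) *\<^sub>R f (c *\<^sub>R x)"]
    by auto
  ultimately show ?thesis by simp
qed

section \<open>Orthonormal bases adapted to a vector or a subspace\<close>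

lemma orthonormal_set_split:
  fixes B :: "'a::euclidean_space set"
  assumes B: "orthonormal_set B" and th: "\<theta> \<in> span B" "norm \<theta> = 1"
  obtains A where "orthonormal_set (insert \<theta> A)" "\<theta> \<notin> A" "span (insert \<theta> A) = span B" "card B = Suc (card A)"
proof -
  define H where "H = {x \<in> span B. x \<bullet> \<theta> = 0}"
  have H: "subspace H"
    unfolding H_def by (auto simp: subspace_def span_zero span_add span_scale inner_add_left)
  obtain A where A: "A \<subseteq> H" "pairwise orthogonal A" "\<And>x. x \<in> A \<Longrightarrow> norm x = 1"
    "independent A" "span A = H"
    using orthonormal_basis_subspace[OF H] by metis
  have fin: "finite A" using A(4) by (rule independent_imp_finite)
  have orth: "orthogonal \<theta> a" if "a \<in> A" for a
    using that A(1) by (auto simp: H_def orthogonal_def inner_commute)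
  have nth: "\<theta> \<notin> A"
    using orth[of \<theta>] th(2) by (auto simp: orthogonal_def)
  have o: "orthonormal_set (insert \<theta> A)"
    using A fin th(2) orth by (auto simp: orthonormal_set_def pairwise_insert orthogonal_commute)
  have sp: "span (insert \<theta> A) = span B"
  proof
    have "insert \<theta> A \<subseteq> span B" using A(1) th(1) by (auto simp: H_def)
    then show "span (insert \<theta> A) \<subseteq> span B" by (rule span_minimal) simp
    show "span B \<subseteq> span (insert \<theta> A)"
    proof
      fix x assume "x \<in> span B"
      then have "x - (x \<bullet> \<theta>) *\<^sub>R \<theta> \<in> H"
        using th by (auto simp: H_def span_diff span_scale inner_diff_left dot_square_norm)
      then show "x \<in> span (insert \<theta> A)" using A(5) by (auto simp: span_insert)
    qed
  qed
  have "independent B" "independent (insert \<theta> A)"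
    using B o by (auto simp: orthonormal_set_independent)
  then have "card B = card (insert \<theta> A)" using sp by (metis dim_eq_card_independent dim_span)
  then show thesis using that o nth sp fin by auto
qed

lemma orthonormal_set_extend:
  fixes A :: "'a::euclidean_space set"
  assumes A: "orthonormal_set A"
  obtains C where "orthonormal_set (A \<union> C)" "A \<inter> C = {}" "span (A \<union> C) = UNIV"
proof -
  define H where "H = {x. \<forall>a\<in>A. orthogonal a x}"
  have H: "subspace H"
    unfolding H_def by (auto simp: subspace_def orthogonal_def inner_add_right)
  obtain C where C: "C \<subseteq> H" "pairwise orthogonal C" "\<And>x. x \<in> C \<Longrightarrow> norm x = 1"
    "independent C" "span C = H"
    using orthonormal_basis_subspace[OF H] by metis
  have fin: "finite C" using C(4) by (rule independent_imp_finite)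
  have ac: "orthogonal a c" "orthogonal c a" if "a \<in> A" "c \<in> C" for a c
    using that C(1) by (auto simp: H_def orthogonal_commute)
  have disj: "A \<inter> C = {}"
  proof (rule ccontr)
    assume "A \<inter> C \<noteq> {}"
    then obtain a where "a \<in> A" "a \<in> C" by auto
    then show False using ac(1)[of a a] C(3)[of a] by (simp add: orthogonal_def)
  qed
  have o: "orthonormal_set (A \<union> C)"
    using A C(2,3) fin ac by (auto simp: orthonormal_set_def pairwise_def)
  have "x \<in> span (A \<union> C)" for x
  proof -
    define y where "y = (\<Sum>a\<in>A. (x \<bullet> a) *\<^sub>R a)"
    have fA: "finite A" using A by auto
    have aa: "a \<bullet> b = (if a = b then 1 else 0)" if "a \<in> A" "b \<in> A" for a b
      using A that by (auto simp: orthonormal_set_def pairwise_def orthogonal_def dot_square_norm)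
    have "y \<bullet> b = x \<bullet> b" if "b \<in> A" for b
    proof -
      have "y \<bullet> b = (\<Sum>a\<in>A. if a = b then x \<bullet> a else 0)"
        unfolding y_def inner_sum_left using that aa by (intro sum.cong) auto
      then show ?thesis using that fA by (simp add: sum.delta)
    qed
    then have "x - y \<in> H" by (auto simp: H_def orthogonal_def inner_diff_right inner_commute)
    then have "x - y \<in> span (A \<union> C)"
      using C(5) span_mono[of C "A \<union> C"] by auto
    moreover have "y \<in> span (A \<union> C)"
      unfolding y_def by (intro span_sum span_scale span_base) auto
    ultimately have "(x - y) + y \<in> span (A \<union> C)" by (rule span_add)
    then show ?thesis by simp
  qed
  then show thesis using that o disj by auto
qed

lemma inner_orthonormal_sum:
  assumes "orthonormal_set B" "x \<in> span B"
  shows "(norm x)\<^sup>2 = (\<Sum>b\<in>B. (x \<bullet> b)\<^sup>2)"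
proof -
  have "finite B" using assms by auto
  then show ?thesis using assms
  proof (induction B arbitrary: x rule: finite_induct)
    case (insert b B)
    note o = orthonormal_set_insertD[OF insert.prems(1) insert.hyps(2)]
    obtain k where k: "x - k *\<^sub>R b \<in> span B" using insert.prems by (auto simp: span_insert)
    define y where "y = x - k *\<^sub>R b"
    have x: "x = y + k *\<^sub>R b" by (simp add: y_def)
    have yb: "y \<bullet> b = 0" using o k by (simp add: y_def)
    have bb: "b \<bullet> c = 0" if "c \<in> B" for c
      using o(3)[of c] that by (simp add: span_base inner_commute)
    have "(norm x)\<^sup>2 = (norm y)\<^sup>2 + k\<^sup>2"
      unfolding x using norm_add_orthogonal_unit[OF yb o(2)] by simp
    also have "(norm y)\<^sup>2 = (\<Sum>c\<in>B. (y \<bullet> c)\<^sup>2)" using insert.IH[of y] k o by (simp add: y_def)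
    also have "\<dots> = (\<Sum>c\<in>B. (x \<bullet> c)\<^sup>2)" unfolding x by (intro sum.cong) (auto simp: inner_add_left bb)
    also have "k = x \<bullet> b" unfolding x using yb o(2) by (simp add: inner_add_left dot_square_norm)
    finally show ?case using insert.hyps by simp
  qed simp
qed

subsection \<open>Gaussian integrals and concentration\<close>

lemma pair_sigma_finite_span_lborel:
  "orthonormal_set A \<Longrightarrow> orthonormal_set B \<Longrightarrow> pair_sigma_finite (span_lborel A) (span_lborel B)"
  by (simp add: pair_sigma_finite_def sigma_finite_span_lborel)

lemma AE_pair_span_lborel:
  assumes "orthonormal_set A" "orthonormal_set B"
  shows "AE z in span_lborel A \<Otimes>\<^sub>M span_lborel B. fst z \<in> span A \<and> snd z \<in> span B"
proof -
  interpret pair_sigma_finite "span_lborel A" "span_lborel B"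
    using assms by (rule pair_sigma_finite_span_lborel)
  have [measurable]: "span A \<in> sets borel" "span B \<in> sets borel"
    by (auto intro!: borel_closed closed_subspace subspace_span)
  have "{z \<in> space (span_lborel A \<Otimes>\<^sub>M span_lborel B). fst z \<in> span A \<and> snd z \<in> span B} = span A \<times> span B"
    by (auto simp: space_pair_measure)
  then have "{z \<in> space (span_lborel A \<Otimes>\<^sub>M span_lborel B). fst z \<in> span A \<and> snd z \<in> span B}
    \<in> sets (span_lborel A \<Otimes>\<^sub>M span_lborel B)" by simp
  then show ?thesis
    by (rule AE_pair_measure) (use AE_span_lborel[of A] AE_span_lborel[of B] in \<open>auto elim!: eventually_mono\<close>)
qed

lemma AE_pair_fst:
  fixes A B :: "'a::euclidean_space set"
  assumes o: "orthonormal_set A" "orthonormal_set B" and P: "AE a in span_lborel A. P a"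
  shows "AE z in span_lborel A \<Otimes>\<^sub>M span_lborel B. P (fst z)"
proof -
  interpret pair_sigma_finite "span_lborel A" "span_lborel B"
    using o by (rule pair_sigma_finite_span_lborel)
  obtain N where N: "N \<in> null_sets (span_lborel A)" "{a. \<not> P a} \<subseteq> N"
    using P by (auto simp: eventually_ae_filter)
  have [measurable]: "N \<in> sets borel" using N(1) by (auto dest: null_setsD2)
  have "AE z in span_lborel A \<Otimes>\<^sub>M span_lborel B. fst z \<notin> N"
  proof (rule AE_pair_measure)
    have "{z \<in> space (span_lborel A \<Otimes>\<^sub>M span_lborel B). fst z \<notin> N} = (- N) \<times> UNIV"
      by (auto simp: space_pair_measure)
    moreover have "(- N) \<times> (UNIV :: 'a set) \<in> sets (span_lborel A \<Otimes>\<^sub>M span_lborel B)"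
      by (intro pair_measureI) auto
    ultimately show "{z \<in> space (span_lborel A \<Otimes>\<^sub>M span_lborel B). fst z \<notin> N} \<in> sets (span_lborel A \<Otimes>\<^sub>M span_lborel B)" by metis
    show "AE x in span_lborel A. AE y in span_lborel B. fst (x, y) \<notin> N"
      using AE_not_in[OF N(1)] by (auto elim!: eventually_mono)
  qed
  then show ?thesis by (rule eventually_mono) (use N in auto)
qed

lemma inner_orthonormal_set:
  assumes "orthonormal_set B" "b \<in> B" "c \<in> B"
  shows "b \<bullet> c = (if b = c then 1 else 0)"
  using assms by (auto simp: orthonormal_set_def pairwise_def orthogonal_def dot_square_norm)

lemma inner_span_orthogonal:
  assumes AB: "orthonormal_set (A \<union> B)" "A \<inter> B = {}" and "x \<in> span A" "y \<in> span B"
  shows "x \<bullet> y = 0"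
proof -
  have 1: "orthogonal a b" if "a \<in> A" "b \<in> B" for a b
    using AB that by (metis Un_iff disjoint_iff orthonormal_set_def pairwise_def)
  have "orthogonal a y" if "a \<in> A" for a
    using 1[OF that] assms(4) by (metis orthogonal_to_span)
  then have "orthogonal y x"
    using assms(3) by (metis orthogonal_commute orthogonal_to_span)
  then show ?thesis by (simp add: orthogonal_def inner_commute)
qed

lemma inner_orthonormal_expand:
  assumes B: "orthonormal_set B" and x: "x \<in> span B"
  shows "x \<bullet> y = (\<Sum>b\<in>B. (x \<bullet> b) * (y \<bullet> b))"
proof -
  have "x = (\<Sum>b\<in>B. (x \<bullet> b) *\<^sub>R b)"
  proof -
    define z where "z = x - (\<Sum>b\<in>B. (x \<bullet> b) *\<^sub>R b)"
    have "z \<in> span B" unfolding z_def using x by (auto intro!: span_diff span_sum span_scale intro: span_base)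
    have fin: "finite B" using B by auto
    have "z \<bullet> c = 0" if "c \<in> B" for c
    proof -
      have "(\<Sum>b\<in>B. (x \<bullet> b) *\<^sub>R b) \<bullet> c = (\<Sum>b\<in>B. if b = c then x \<bullet> b else 0)"
        unfolding inner_sum_left using that B by (intro sum.cong) (auto simp: inner_orthonormal_set)
      then show ?thesis using that fin by (simp add: z_def inner_diff_left sum.delta)
    qed
    then have "(norm z)\<^sup>2 = 0" using inner_orthonormal_sum[OF B \<open>z \<in> span B\<close>] by simp
    then show ?thesis by (simp add: z_def)
  qed
  then have "x \<bullet> y = (\<Sum>b\<in>B. (x \<bullet> b) *\<^sub>R b) \<bullet> y" by simp
  also have "\<dots> = (\<Sum>b\<in>B. (x \<bullet> b) * (y \<bullet> b))" by (simp add: inner_sum_left inner_commute[of y])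
  finally show ?thesis .
qed

lemma integral_span_lborel_prod:
  fixes h :: "'a::euclidean_space \<Rightarrow> real \<Rightarrow> 'b::{real_normed_field, banach, second_countable_topology}"
  assumes B: "orthonormal_set B" and h: "\<And>b. b \<in> B \<Longrightarrow> integrable lborel (h b)"
  shows "(\<integral>x. (\<Prod>b\<in>B. h b (x \<bullet> b)) \<partial>span_lborel B) = (\<Prod>b\<in>B. (\<integral>s. h b s \<partial>lborel))" (is ?I)
    and "integrable (span_lborel B) (\<lambda>x. \<Prod>b\<in>B. h b (x \<bullet> b))" (is ?J)
proof -
  have fin: "finite B" using B by auto
  have [measurable]: "\<And>b. b \<in> B \<Longrightarrow> h b \<in> borel_measurable borel"
    using h by (auto dest!: borel_measurable_integrable)
  have eq: "(\<Sum>c\<in>B. y c *\<^sub>R c) \<bullet> b = y b" if "b \<in> B" for b y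
  proof -
    have "(\<Sum>c\<in>B. y c *\<^sub>R c) \<bullet> b = (\<Sum>c\<in>B. if c = b then y c else 0)"
      unfolding inner_sum_left using that B by (intro sum.cong) (auto simp: inner_orthonormal_set)
    then show ?thesis using fin that by (simp add: sum.delta)
  qed
  then have eq': "(\<Prod>b\<in>B. h b ((\<Sum>c\<in>B. y c *\<^sub>R c) \<bullet> b)) = (\<Prod>b\<in>B. h b (y b))" for y
    by (intro prod.cong) auto
  have meas [measurable]: "(\<lambda>x. \<Prod>b\<in>B. h b (x \<bullet> b)) \<in> borel_measurable borel" by measurable
  show ?I
    unfolding span_lborel_def
    by (subst integral_distr) (use meas in \<open>auto simp: eq' lborel_product.product_integral_prod[OF fin h]\<close>)
  show ?J
    unfolding span_lborel_def
    by (subst integrable_distr_eq) (use meas in \<open>auto simp: eq' intro!: lborel_product.product_integrable_prod[OF fin h]\<close>)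
qed

lemma borel_measurable_cis [measurable]: "cis \<in> borel_measurable borel"
  by (intro borel_measurable_continuous_onI continuous_intros)

text \<open>This is the characteristic function of the standard normal distribution after the
  substitution s \<mapsto> \<open>sqrt c * s\<close>.\<close>

lemma gaussian_Fourier_real:
  fixes c v :: real
  assumes c: "c > 0"
  shows "integrable lborel (\<lambda>s. complex_of_real (exp (- (c * s\<^sup>2) / 2)) * cis (s * v))" (is ?I)
    and "(\<integral>s. complex_of_real (exp (- (c * s\<^sup>2) / 2)) * cis (s * v) \<partial>lborel)
      = complex_of_real (sqrt (2 * pi / c) * exp (- (v\<^sup>2 / (2 * c))))" (is ?J)
proof -
  have 1: "integrable lborel (\<lambda>s. complex_of_real (std_normal_density s) * cis (s * w))" for w
    by (rule Bochner_Integration.integrable_bound[of _ std_normal_density])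
      (auto simp: norm_mult integrable_std_normal_moment[of 0, simplified])
  have 2: "(\<integral>s. complex_of_real (std_normal_density s) * cis (s * w) \<partial>lborel) = complex_of_real (exp (- (w\<^sup>2) / 2))" for w
    using fun_cong[OF char_std_normal_distribution, of w]
    by (simp add: char_def integral_density mult.commute scaleR_conv_of_real cis_conv_exp)
  define k where "k = sqrt c"
  have k: "k > 0" "k\<^sup>2 = c" using c by (auto simp: k_def)
  have e: "complex_of_real (exp (- (c * s\<^sup>2) / 2)) * cis (s * v)
    = sqrt (2 * pi) *\<^sub>R (complex_of_real (std_normal_density (0 + k * s)) * cis ((0 + k * s) * (v / k)))" for s
    using k by (auto simp: std_normal_density_def power_mult_distrib scaleR_conv_of_real simp flip: of_real_mult)
  show ?I
    unfolding e by (intro integrable_scaleR_right lborel_integrable_real_affine 1) (use k in auto)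
  have "(\<integral>s. complex_of_real (exp (- (c * s\<^sup>2) / 2)) * cis (s * v) \<partial>lborel)
    = sqrt (2 * pi) *\<^sub>R (\<integral>s. complex_of_real (std_normal_density (0 + k * s)) * cis ((0 + k * s) * (v / k)) \<partial>lborel)"
    unfolding e by simp
  also have "(\<integral>s. complex_of_real (std_normal_density (0 + k * s)) * cis ((0 + k * s) * (v / k)) \<partial>lborel)
     = complex_of_real (exp (- ((v / k)\<^sup>2) / 2)) /\<^sub>R k"
  proof -
    have "k *\<^sub>R (\<integral>s. complex_of_real (std_normal_density (0 + k * s)) * cis ((0 + k * s) * (v / k)) \<partial>lborel)
      = complex_of_real (exp (- ((v / k)\<^sup>2) / 2))"
      using lborel_integral_real_affine[of k "\<lambda>s. complex_of_real (std_normal_density s) * cis (s * (v / k))" 0] k(1) 2[of "v / k"]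
      by (simp del: of_real_exp)
    from arg_cong[OF this, of "\<lambda>z. z /\<^sub>R k"] show ?thesis using k(1) by simp
  qed
  finally have J: "(\<integral>s. complex_of_real (exp (- (c * s\<^sup>2) / 2)) * cis (s * v) \<partial>lborel)
    = complex_of_real (sqrt (2 * pi) * (exp (- ((v / k)\<^sup>2) / 2) / k))"
    by (simp only: scaleR_conv_of_real of_real_mult of_real_divide of_real_inverse divide_inverse mult.commute[of "inverse _"])
  have "sqrt (2 * pi / c) = sqrt (2 * pi) / k" by (simp add: real_sqrt_divide k_def)
  moreover have "- ((v / k)\<^sup>2) / 2 = - (v\<^sup>2 / (2 * c))" using k by (simp add: power_divide)
  ultimately show ?J unfolding J by (simp only: times_divide_eq_right times_divide_eq_left)
qed

lemma gaussian_Fourier: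
  fixes B :: "'a::euclidean_space set"
  assumes B: "orthonormal_set B" and c: "\<And>b. b \<in> B \<Longrightarrow> c b > 0"
  shows "integrable (span_lborel B) (\<lambda>x. complex_of_real (exp (- (\<Sum>b\<in>B. c b * (x \<bullet> b)\<^sup>2) / 2)) * cis (x \<bullet> y))" (is ?I)
    and "(\<integral>x. complex_of_real (exp (- (\<Sum>b\<in>B. c b * (x \<bullet> b)\<^sup>2) / 2)) * cis (x \<bullet> y) \<partial>span_lborel B)
      = complex_of_real ((\<Prod>b\<in>B. sqrt (2 * pi / c b)) * exp (- (\<Sum>b\<in>B. (y \<bullet> b)\<^sup>2 / c b) / 2))" (is ?J)
proof -
  define h where "h = (\<lambda>b s. complex_of_real (exp (- (c b * s\<^sup>2) / 2)) * cis (s * (y \<bullet> b)))"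
  have fin: "finite B" using B by auto
  have hi: "integrable lborel (h b)" "(\<integral>s. h b s \<partial>lborel) = complex_of_real (sqrt (2 * pi / c b) * exp (- ((y \<bullet> b)\<^sup>2 / (2 * c b))))"
    if "b \<in> B" for b
    unfolding h_def using gaussian_Fourier_real[OF c[OF that]] by auto
  have cis_sum: "cis (\<Sum>b\<in>B. g b) = (\<Prod>b\<in>B. cis (g b))" for g :: "'a \<Rightarrow> real"
    using fin by (induction B rule: finite_induct) (auto simp: cis_mult[symmetric])
  have AEeq: "AE x in span_lborel B. complex_of_real (exp (- (\<Sum>b\<in>B. c b * (x \<bullet> b)\<^sup>2) / 2)) * cis (x \<bullet> y)
     = (\<Prod>b\<in>B. h b (x \<bullet> b))"
    using AE_span_lborel
  proof eventually_elim
    case (elim x)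
    have "complex_of_real (exp (- (\<Sum>b\<in>B. c b * (x \<bullet> b)\<^sup>2) / 2)) = (\<Prod>b\<in>B. complex_of_real (exp (- (c b * (x \<bullet> b)\<^sup>2) / 2)))"
      using fin by (simp add: exp_sum[symmetric] sum_negf sum_divide_distrib flip: of_real_prod)
    then show ?case
      unfolding h_def inner_orthonormal_expand[OF B elim, of y] cis_sum by (simp add: prod.distrib)
  qed
  have m1: "(\<lambda>x. complex_of_real (exp (- (\<Sum>b\<in>B. c b * (x \<bullet> b)\<^sup>2) / 2)) * cis (x \<bullet> y)) \<in> borel_measurable (span_lborel B)"
    by (auto simp: cis_conv_exp)
  have m2: "(\<lambda>x. \<Prod>b\<in>B. h b (x \<bullet> b)) \<in> borel_measurable (span_lborel B)"
    using integral_span_lborel_prod(2)[OF B hi(1)] by (rule borel_measurable_integrable)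
  show ?I
    using integrable_cong_AE[OF m1 m2 AEeq] integral_span_lborel_prod(2)[OF B hi(1)] by simp
  have "(\<integral>x. complex_of_real (exp (- (\<Sum>b\<in>B. c b * (x \<bullet> b)\<^sup>2) / 2)) * cis (x \<bullet> y) \<partial>span_lborel B)
     = (\<Prod>b\<in>B. complex_of_real (sqrt (2 * pi / c b) * exp (- ((y \<bullet> b)\<^sup>2 / (2 * c b)))))"
    using integral_cong_AE[OF m1 m2 AEeq] integral_span_lborel_prod(1)[OF B hi(1)] hi(2)
    by (simp cong: prod.cong)
  also have "\<dots> = complex_of_real ((\<Prod>b\<in>B. sqrt (2 * pi / c b)) * exp (\<Sum>b\<in>B. - ((y \<bullet> b)\<^sup>2 / (2 * c b))))"
    using fin by (simp add: prod.distrib exp_sum)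
  also have "(\<Sum>b\<in>B. - ((y \<bullet> b)\<^sup>2 / (2 * c b))) = - (\<Sum>b\<in>B. (y \<bullet> b)\<^sup>2 / c b) / 2"
    by (simp add: sum_negf sum_divide_distrib mult.commute)
  finally show ?J .
qed

lemma gaussian_integral:
  fixes B :: "'a::euclidean_space set"
  assumes B: "orthonormal_set B"
  shows "integrable (span_lborel B) (\<lambda>x. exp (- (\<Sum>b\<in>B. (x \<bullet> b)\<^sup>2) / 2))" (is ?I)
    and "(\<integral>x. exp (- (\<Sum>b\<in>B. (x \<bullet> b)\<^sup>2) / 2) \<partial>span_lborel B) = sqrt (2 * pi) ^ card B" (is ?J)
proof -
  have 1: "integrable (span_lborel B) (\<lambda>x. complex_of_real (exp (- (\<Sum>b\<in>B. (x \<bullet> b)\<^sup>2) / 2)))"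
    using gaussian_Fourier(1)[OF B, of "\<lambda>_. 1" 0] by (simp del: of_real_exp)
  have 2: "(\<integral>x. complex_of_real (exp (- (\<Sum>b\<in>B. (x \<bullet> b)\<^sup>2) / 2)) \<partial>span_lborel B) = complex_of_real (sqrt (2 * pi) ^ card B)"
    using gaussian_Fourier(2)[OF B, of "\<lambda>_. 1" 0] by (simp del: of_real_exp)
  show ?I using 1 by (simp only: complex_of_real_integrable_eq)
  show ?J using 2 unfolding integral_complex_of_real of_real_eq_iff .
qed


text \<open>Dilating the directions of B by \<tau> turns the Gaussian of width \<tau> into the fixed
  weight \<open>w\<close> and moves \<tau> into the argument of f; \<open>\<tau> ^ card B\<close> is
  the Jacobian. In this form the majorant \<open>g (fst z) * w (snd z)\<close> does not depend on
  \<tau>, which is what the uniform bound and the limit below rest on.\<close>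

lemma gaussian_scaled:
  fixes f :: "'a::euclidean_space \<Rightarrow> real"
  assumes AB: "orthonormal_set (A \<union> B)" "A \<inter> B = {}"
    and f [measurable]: "f \<in> borel_measurable borel"
    and g: "integrable (span_lborel A) g"
    and fg: "AE a in span_lborel A. \<forall>b\<in>span B. \<bar>f (a + b)\<bar> \<le> g a"
    and \<tau>: "\<tau> > 0"
  defines "w \<equiv> \<lambda>b. exp (- (\<Sum>c\<in>B. (b \<bullet> c)\<^sup>2) / 2)"
  shows "(\<integral>x. f x * exp (- (\<Sum>c\<in>B. (x \<bullet> c)\<^sup>2) / (2 * \<tau>\<^sup>2)) \<partial>span_lborel (A \<union> B)) / \<tau> ^ card B
      = (\<integral>z. f (fst z + \<tau> *\<^sub>R snd z) * w (snd z) \<partial>(span_lborel A \<Otimes>\<^sub>M span_lborel B))" (is ?eq)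
    and "integrable (span_lborel (A \<union> B)) (\<lambda>x. f x * exp (- (\<Sum>c\<in>B. (x \<bullet> c)\<^sup>2) / (2 * \<tau>\<^sup>2)))" (is ?int)
    and "integrable (span_lborel A \<Otimes>\<^sub>M span_lborel B) (\<lambda>z. g (fst z) * w (snd z))" (is ?gw)
    and "(\<integral>z. g (fst z) * w (snd z) \<partial>(span_lborel A \<Otimes>\<^sub>M span_lborel B)) = sqrt (2 * pi) ^ card B * (\<integral>a. g a \<partial>span_lborel A)" (is ?gwint)
    and "AE z in span_lborel A \<Otimes>\<^sub>M span_lborel B. \<bar>f (fst z + \<tau> *\<^sub>R snd z) * w (snd z)\<bar> \<le> g (fst z) * w (snd z)" (is ?bd)
proof -
  have o: "orthonormal_set A" "orthonormal_set B"
    using AB(1) by (auto elim!: orthonormal_set_subset)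
  interpret pair_sigma_finite "span_lborel A" "span_lborel B"
    using o by (rule pair_sigma_finite_span_lborel)
  have g' [measurable]: "g \<in> borel_measurable borel" using g by (auto dest: borel_measurable_integrable)
  have [measurable]: "w \<in> borel_measurable borel" by (simp add: w_def)
  have w0: "w b > 0" for b by (simp add: w_def)
  have wi: "integrable (span_lborel B) w" "(\<integral>b. w b \<partial>span_lborel B) = sqrt (2 * pi) ^ card B"
    unfolding w_def using gaussian_integral[OF o(2)] by auto
  have gwi: "integrable (span_lborel A \<Otimes>\<^sub>M span_lborel B) (\<lambda>z. g (fst z) * h (snd z))"
    if hi: "integrable (span_lborel B) h" for h :: "'a \<Rightarrow> real"
  proof (rule Fubini_integrable)
    have [measurable]: "h \<in> borel_measurable borel" using hi by (auto dest: borel_measurable_integrable)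
    show "(\<lambda>z. g (fst z) * h (snd z)) \<in> borel_measurable (span_lborel A \<Otimes>\<^sub>M span_lborel B)" by simp
    show "integrable (span_lborel A) (\<lambda>x. \<integral>y. norm (g (fst (x, y)) * h (snd (x, y))) \<partial>span_lborel B)"
      using g by (simp add: norm_mult abs_mult)
    show "AE x in span_lborel A. integrable (span_lborel B) (\<lambda>y. g (fst (x, y)) * h (snd (x, y)))"
      using hi by simp
  qed
  show ?gw using gwi[OF wi(1)] .
  show ?gwint
    using integral_fst'[OF gwi[OF wi(1)]] wi by (simp add: mult.commute)
  have ae: "AE z in span_lborel A \<Otimes>\<^sub>M span_lborel B. fst z \<in> span A \<and> snd z \<in> span B \<and>
      (\<forall>b\<in>span B. \<bar>f (fst z + b)\<bar> \<le> g (fst z))"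
    using AE_pair_span_lborel[OF o] AE_pair_fst[OF o fg] by eventually_elim auto
  show bd: ?bd
    using ae
  proof eventually_elim
    case (elim z)
    then have "\<bar>f (fst z + \<tau> *\<^sub>R snd z)\<bar> \<le> g (fst z)" by (auto simp: span_scale)
    then show ?case using w0[of "snd z"] by (simp add: abs_mult)
  qed
  have c0: "a \<bullet> c = 0" if "a \<in> span A" "c \<in> B" for a c
    using inner_span_orthogonal[OF AB that(1)] that(2) by (simp add: span_base)
  have wt: "w (x /\<^sub>R \<tau>) = exp (- (\<Sum>c\<in>B. (x \<bullet> c)\<^sup>2) / (2 * \<tau>\<^sup>2))" for x
    unfolding w_def by (simp add: power_mult_distrib sum_distrib_left[symmetric] power_inverse field_simps sum_divide_distrib[symmetric])
  have wi2: "integrable (span_lborel B) (\<lambda>x. w (x /\<^sub>R \<tau>))"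
    using integrable_span_lborel_scale[OF o(2), of "inverse \<tau>" w] wi \<tau> by simp
  have wsum: "w ((a + b) /\<^sub>R \<tau>) = w (b /\<^sub>R \<tau>)" if "a \<in> span A" for a b
    unfolding w_def using c0[OF that] by (simp add: inner_add_left)
  have i1: "integrable (span_lborel A \<Otimes>\<^sub>M span_lborel B) (\<lambda>z. f (fst z + snd z) * w ((fst z + snd z) /\<^sub>R \<tau>))"
  proof (rule Bochner_Integration.integrable_bound[OF gwi[OF wi2]])
    show "AE z in span_lborel A \<Otimes>\<^sub>M span_lborel B. norm (f (fst z + snd z) * w ((fst z + snd z) /\<^sub>R \<tau>)) \<le> norm (g (fst z) * w (snd z /\<^sub>R \<tau>))"
      using ae
    proof eventually_elim
      case (elim z)
      then have "\<bar>f (fst z + snd z)\<bar> \<le> \<bar>g (fst z)\<bar>" by force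
      then show ?case using w0[of "snd z /\<^sub>R \<tau>"] wsum[of "fst z" "snd z"] elim by (simp add: abs_mult mult_right_mono)
    qed
  qed simp
  have sU: "span_lborel (A \<union> B) = distr (span_lborel A \<Otimes>\<^sub>M span_lborel B) borel (\<lambda>z. fst z + snd z)"
    using span_lborel_Un[OF AB] by (simp add: case_prod_beta')
  show ?int
    unfolding wt[symmetric] sU by (subst integrable_distr_eq) (use i1 in auto)
  have i2: "integrable (span_lborel A \<Otimes>\<^sub>M span_lborel B) (\<lambda>z. f (fst z + \<tau> *\<^sub>R snd z) * w (snd z))"
    by (rule Bochner_Integration.integrable_bound[OF gwi[OF wi(1)]]) (use bd in \<open>auto elim!: eventually_mono\<close>)
  have "(\<integral>x. f x * w (x /\<^sub>R \<tau>) \<partial>span_lborel (A \<union> B)) = (\<integral>z. f (fst z + snd z) * w ((fst z + snd z) /\<^sub>R \<tau>) \<partial>(span_lborel A \<Otimes>\<^sub>M span_lborel B))"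
    unfolding sU by (subst integral_distr) auto
  also have "\<dots> = (\<integral>a. \<integral>b. f (a + b) * w ((a + b) /\<^sub>R \<tau>) \<partial>span_lborel B \<partial>span_lborel A)"
    using integral_fst'[OF i1] by simp
  also have "\<dots> = (\<integral>a. (\<tau> ^ card B) *\<^sub>R (\<integral>b. f (a + \<tau> *\<^sub>R b) * w (b) \<partial>span_lborel B) \<partial>span_lborel A)"
  proof (rule integral_cong_AE)
    show "AE a in span_lborel A. (\<integral>b. f (a + b) * w ((a + b) /\<^sub>R \<tau>) \<partial>span_lborel B) = (\<tau> ^ card B) *\<^sub>R (\<integral>b. f (a + \<tau> *\<^sub>R b) * w (b) \<partial>span_lborel B)"
      using AE_span_lborel
    proof eventually_elim
      case (elim a)
      have "(\<integral>b. f (a + b) * w (b /\<^sub>R \<tau>) \<partial>span_lborel B) = (\<tau> ^ card B) *\<^sub>R (\<integral>b. f (a + \<tau> *\<^sub>R b) * w (b) \<partial>span_lborel B)"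
        using integral_span_lborel_scale[OF o(2), of \<tau> "\<lambda>b. f (a + b) * w (b /\<^sub>R \<tau>)"] \<tau> by simp
      then show ?case by (simp only: wsum[OF elim])
    qed
  qed simp_all
  also have "\<dots> = \<tau> ^ card B * (\<integral>z. f (fst z + \<tau> *\<^sub>R snd z) * w (snd z) \<partial>(span_lborel A \<Otimes>\<^sub>M span_lborel B))"
    using integral_fst'[OF i2] by simp
  finally show ?eq
    unfolding wt using \<tau> by (simp add: field_simps)
qed

lemma gaussian_concentration_bound:
  fixes f :: "'a::euclidean_space \<Rightarrow> real"
  assumes AB: "orthonormal_set (A \<union> B)" "A \<inter> B = {}"
    and f [measurable]: "f \<in> borel_measurable borel"
    and g: "integrable (span_lborel A) g"
    and fg: "AE a in span_lborel A. \<forall>b\<in>span B. \<bar>f (a + b)\<bar> \<le> g a"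
    and \<tau>: "\<tau> > 0"
  shows "\<bar>(\<integral>x. f x * exp (- (\<Sum>c\<in>B. (x \<bullet> c)\<^sup>2) / (2 * \<tau>\<^sup>2)) \<partial>span_lborel (A \<union> B)) / \<tau> ^ card B\<bar>
    \<le> sqrt (2 * pi) ^ card B * (\<integral>a. g a \<partial>span_lborel A)"
proof -
  note s = gaussian_scaled[OF assms]
  have [measurable]: "g \<in> borel_measurable borel" using g by (auto dest: borel_measurable_integrable)
  have [measurable]: "(\<lambda>z. f (fst z + \<tau> *\<^sub>R snd z) * exp (- (\<Sum>c\<in>B. (snd z \<bullet> c)\<^sup>2) / 2)) \<in> borel_measurable (span_lborel A \<Otimes>\<^sub>M span_lborel B)"
    by measurable
  show ?thesis
    unfolding s(1) s(4)[symmetric]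
    using s(5) by (intro integral_abs_bound[THEN order_trans] integral_mono_AE integrable_abs
        Bochner_Integration.integrable_bound[OF s(3)]) (auto elim!: eventually_mono)
qed

text \<open>Dominated convergence in the form provided by \<open>gaussian_scaled\<close>. This is
  the passage from a space to a subspace, used for a line in \<open>T_limit\<close>, for a
  hyperplane in \<open>section_average\<close> and for a general subspace in
  \<open>positive_definite_span\<close>. Continuity of f is understood in the ambient space: if B is
  nonempty, \<open>span A\<close> is a null set there, and integrals over the large space see f on
  it only through nearby points.\<close>

lemma gaussian_concentration:
  fixes f :: "'a::euclidean_space \<Rightarrow> real"
  assumes AB: "orthonormal_set (A \<union> B)" "A \<inter> B = {}"
    and f [measurable]: "f \<in> borel_measurable borel"
    and g: "integrable (span_lborel A) g"
    and fg: "AE a in span_lborel A. \<forall>b\<in>span B. \<bar>f (a + b)\<bar> \<le> g a"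
    and cont: "AE a in span_lborel A. isCont f a"
    and \<tau>: "\<And>n. \<tau> n > 0" "\<tau> \<longlonglongrightarrow> 0"
  shows "(\<lambda>n. (\<integral>x. f x * exp (- (\<Sum>c\<in>B. (x \<bullet> c)\<^sup>2) / (2 * (\<tau> n)\<^sup>2)) \<partial>span_lborel (A \<union> B)) / \<tau> n ^ card B)
    \<longlonglongrightarrow> sqrt (2 * pi) ^ card B * (\<integral>a. f a \<partial>span_lborel A)"
proof -
  note s = gaussian_scaled[OF AB f g fg \<tau>(1)]
  have o: "orthonormal_set A" "orthonormal_set B"
    using AB(1) by (auto elim!: orthonormal_set_subset)
  interpret pair_sigma_finite "span_lborel A" "span_lborel B"
    using o by (rule pair_sigma_finite_span_lborel)
  define w where "w = (\<lambda>b::'a. exp (- (\<Sum>c\<in>B. (b \<bullet> c)\<^sup>2) / 2))"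
  have [measurable]: "w \<in> borel_measurable borel" by (simp add: w_def)
  have wi: "integrable (span_lborel B) w" "(\<integral>b. w b \<partial>span_lborel B) = sqrt (2 * pi) ^ card B"
    unfolding w_def using gaussian_integral[OF o(2)] by auto
  have cont': "AE z in span_lborel A \<Otimes>\<^sub>M span_lborel B. isCont f (fst z)"
    by (rule AE_pair_fst[OF o cont])
  have "(\<lambda>n. \<integral>z. f (fst z + \<tau> n *\<^sub>R snd z) * w (snd z) \<partial>(span_lborel A \<Otimes>\<^sub>M span_lborel B))
    \<longlonglongrightarrow> (\<integral>z. f (fst z) * w (snd z) \<partial>(span_lborel A \<Otimes>\<^sub>M span_lborel B))"
  proof (rule integral_dominated_convergence)
    show "integrable (span_lborel A \<Otimes>\<^sub>M span_lborel B) (\<lambda>z. g (fst z) * w (snd z))"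
      using s(3) by (simp add: w_def)
    show "AE z in span_lborel A \<Otimes>\<^sub>M span_lborel B. norm (f (fst z + \<tau> n *\<^sub>R snd z) * w (snd z)) \<le> g (fst z) * w (snd z)" for n
      using s(5)[of n] by (simp add: w_def)
    show "AE z in span_lborel A \<Otimes>\<^sub>M span_lborel B. (\<lambda>n. f (fst z + \<tau> n *\<^sub>R snd z) * w (snd z)) \<longlonglongrightarrow> f (fst z) * w (snd z)"
      using cont'
    proof eventually_elim
      case (elim z)
      have "(\<lambda>n. fst z + \<tau> n *\<^sub>R snd z) \<longlonglongrightarrow> fst z + 0 *\<^sub>R snd z"
        by (intro tendsto_intros \<tau>)
      then have "(\<lambda>n. f (fst z + \<tau> n *\<^sub>R snd z)) \<longlonglongrightarrow> f (fst z)"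
        using elim isCont_tendsto_compose by fastforce
      then show ?case by (intro tendsto_intros)
    qed
  qed simp_all
  moreover have "(\<integral>z. f (fst z) * w (snd z) \<partial>(span_lborel A \<Otimes>\<^sub>M span_lborel B)) = sqrt (2 * pi) ^ card B * (\<integral>a. f a \<partial>span_lborel A)"
  proof -
    have "AE a in span_lborel A. norm (f a) \<le> norm (g a)"
      using fg
    proof eventually_elim
      case (elim a)
      then show ?case using elim[rule_format, OF span_zero] by simp
    qed
    then have fi: "integrable (span_lborel A) f"
      by (intro Bochner_Integration.integrable_bound[OF g]) auto
    have "integrable (span_lborel A \<Otimes>\<^sub>M span_lborel B) (\<lambda>z. f (fst z) * w (snd z))"
      by (rule Fubini_integrable) (use fi wi in \<open>auto simp: norm_mult abs_mult\<close>)
    from integral_fst'[OF this] show ?thesis using wi by (simp add: mult.commute)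
  qed
  ultimately show ?thesis
    unfolding s(1) by (simp add: w_def)
qed

subsection \<open>Integrals of functions of homogeneous functionals\<close>

lemma emeasure_homogeneous_le:
  fixes p :: "'a::euclidean_space \<Rightarrow> real"
  assumes B: "orthonormal_set B" and [measurable]: "p \<in> borel_measurable borel"
    and hom: "\<And>c x. c > 0 \<Longrightarrow> p (c *\<^sub>R x) = c * p x" and t: "t > 0"
  shows "emeasure (span_lborel B) {x. p x \<le> t} = ennreal (t ^ card B) * emeasure (span_lborel B) {x. p x \<le> 1}"
proof -
  have "emeasure (span_lborel B) {x. p x \<le> t} = ennreal (\<bar>t\<bar> ^ card B) * (\<integral>\<^sup>+ x. indicator {x. p x \<le> t} (t *\<^sub>R x) \<partial>span_lborel B)"
    using nn_integral_span_lborel_scale[OF B, of t "indicator {x. p x \<le> t}"] t by simp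
  also have "(\<lambda>x. indicator {x. p x \<le> t} (t *\<^sub>R x)) = (indicator {x. p x \<le> 1} :: 'a \<Rightarrow> ennreal)"
    using t by (auto simp: indicator_def fun_eq_iff hom mult_le_cancel_left1)
  finally show ?thesis using t by simp
qed

text \<open>Tonelli, with \<open>{x. p x \<le> t}\<close> being the t-fold dilate of
  \<open>{x. p x \<le> 1}\<close>. A function of p that is written as the integral of k over t \<ge>
  p x thus reduces to an integral over the half-line, which replaces polar coordinates.\<close>

lemma nn_integral_layer_homogeneous:
  fixes p :: "'a::euclidean_space \<Rightarrow> real"
  assumes B: "orthonormal_set B" and [measurable]: "p \<in> borel_measurable borel"
    and hom: "\<And>c x. c > 0 \<Longrightarrow> p (c *\<^sub>R x) = c * p x"
    and [measurable]: "k \<in> borel_measurable borel"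
  shows "(\<integral>\<^sup>+ x. \<integral>\<^sup>+ t. k t * indicator {0<..} t * indicator {x. p x \<le> t} x \<partial>lborel \<partial>span_lborel B)
    = emeasure (span_lborel B) {x. p x \<le> 1} * (\<integral>\<^sup>+ t. k t * indicator {0<..} t * ennreal (t ^ card B) \<partial>lborel)"
proof -
  interpret pair_sigma_finite "span_lborel B" "lborel :: real measure"
    by (simp add: pair_sigma_finite_def sigma_finite_span_lborel[OF B] sigma_finite_lborel)
  have ind: "(indicator {x. p x \<le> t} x :: ennreal) = indicator {z. p (fst z) \<le> snd z} (x, t)" for t x
    by (auto simp: indicator_def)
  have [measurable]: "{z. p (fst z) \<le> snd z} \<in> sets (span_lborel B \<Otimes>\<^sub>M (lborel :: real measure))"
  proof -
    have "{z \<in> space (span_lborel B \<Otimes>\<^sub>M (lborel :: real measure)). p (fst z) \<le> snd z} \<in> sets (span_lborel B \<Otimes>\<^sub>M lborel)"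
      by measurable
    then show ?thesis by (simp add: space_pair_measure)
  qed
  have "(\<integral>\<^sup>+ x. \<integral>\<^sup>+ t. k t * indicator {0<..} t * indicator {x. p x \<le> t} x \<partial>lborel \<partial>span_lborel B)
    = (\<integral>\<^sup>+ t. \<integral>\<^sup>+ x. k t * indicator {0<..} t * indicator {x. p x \<le> t} x \<partial>span_lborel B \<partial>lborel)"
    unfolding ind by (rule Fubini'[symmetric]) measurable
  also have "\<dots> = (\<integral>\<^sup>+ t. emeasure (span_lborel B) {x. p x \<le> 1} * (k t * indicator {0<..} t * ennreal (t ^ card B)) \<partial>lborel)"
  proof (rule nn_integral_cong)
    fix t :: real
    have "(\<integral>\<^sup>+ x. k t * indicator {0<..} t * indicator {x. p x \<le> t} x \<partial>span_lborel B)
      = k t * indicator {0<..} t * emeasure (span_lborel B) {x. p x \<le> t}"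
      by (subst nn_integral_cmult) auto
    also have "\<dots> = emeasure (span_lborel B) {x. p x \<le> 1} * (k t * indicator {0<..} t * ennreal (t ^ card B))"
      using emeasure_homogeneous_le[OF B _ hom, of t] by (cases "t > 0") (auto simp: mult_ac)
    finally show "(\<integral>\<^sup>+ x. k t * indicator {0<..} t * indicator {x. p x \<le> t} x \<partial>span_lborel B)
      = emeasure (span_lborel B) {x. p x \<le> 1} * (k t * indicator {0<..} t * ennreal (t ^ card B))" .
  qed
  also have "\<dots> = emeasure (span_lborel B) {x. p x \<le> 1} * (\<integral>\<^sup>+ t. k t * indicator {0<..} t * ennreal (t ^ card B) \<partial>lborel)"
    by (subst nn_integral_cmult) auto
  finally show ?thesis .
qed

text \<open>The weight is minus the derivative of exp (- t) / t. Since it is positive,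
  \<open>exp (- p x) / p x\<close> is a positive superposition of indicators of the dilates
  \<open>{x. p x \<le> t}\<close>; integrability and later positive definiteness are both read off
  from this.\<close>

lemma exp_over_layer:
  fixes r :: real
  assumes "r > 0"
  shows "(\<integral>\<^sup>+ t. ennreal ((1 + t) / t\<^sup>2 * exp (- t)) * indicator {r..} t \<partial>lborel) = ennreal (exp (- r) / r)"
proof -
  have "(\<integral>\<^sup>+ t. ennreal ((1 + t) / t\<^sup>2 * exp (- t)) * indicator {r..} t \<partial>lborel) = ennreal (0 - (- (exp (- r) / r)))"
  proof (rule nn_integral_FTC_atLeast)
    show "((\<lambda>t. - (exp (- t) / t)) has_real_derivative (1 + t) / t\<^sup>2 * exp (- t)) (at t)" if "r \<le> t" for t
      using that assms by (auto intro!: derivative_eq_intros simp: field_simps power2_eq_square)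
    show "((\<lambda>t::real. - (exp (- t) / t)) \<longlongrightarrow> 0) at_top" by real_asymp
  qed (use assms in \<open>auto intro!: mult_nonneg_nonneg divide_nonneg_nonneg\<close>)
  then show ?thesis by simp
qed

lemma exp_layer:
  fixes r :: real
  shows "(\<integral>\<^sup>+ t. ennreal (exp (- t)) * indicator {r..} t \<partial>lborel) = ennreal (exp (- r))"
proof -
  have "(\<integral>\<^sup>+ t. ennreal (exp (- t)) * indicator {r..} t \<partial>lborel) = ennreal (0 - (- (exp (- r))))"
  proof (rule nn_integral_FTC_atLeast)
    show "((\<lambda>t. - (exp (- t))) has_real_derivative exp (- t)) (at t)" if "r \<le> t" for t
      by (auto intro!: derivative_eq_intros)
    show "((\<lambda>t. - (exp (- t :: real))) \<longlongrightarrow> 0) at_top" by real_asymp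
  qed auto
  then show ?thesis by simp
qed

lemma nn_integral_power_exp_finite:
  "(\<integral>\<^sup>+ t. ennreal (t ^ k * exp (- t)) * indicator {0<..} t \<partial>lborel) < \<infinity>"
proof -
  have "(\<integral>\<^sup>+ t. ennreal (t ^ k * exp (- t)) * indicator {0<..} t \<partial>lborel)
    \<le> (\<integral>\<^sup>+ t. ennreal (t ^ k * exp (- t)) * indicator {0..} t \<partial>lborel)"
    by (intro nn_integral_mono) (auto simp: indicator_def)
  also have "\<dots> = ennreal (fact k)" by (simp add: nn_intergal_power_times_exp_Ici)
  finally show ?thesis by (auto intro: le_less_trans)
qed

lemma integrable_power_exp: "integrable lborel (\<lambda>t::real. t ^ k * exp (- t) * indicator {0<..} t)"
proof (rule integrableI_nonneg)
  have "(\<integral>\<^sup>+ t. ennreal (t ^ k * exp (- t) * indicator {0<..} t) \<partial>lborel) = (\<integral>\<^sup>+ t. ennreal (t ^ k * exp (- t)) * indicator {0<..} t \<partial>lborel)"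
    by (intro nn_integral_cong) (auto simp: indicator_def)
  then show "(\<integral>\<^sup>+ t. ennreal (t ^ k * exp (- t) * indicator {0<..} t) \<partial>lborel) < \<infinity>"
    using nn_integral_power_exp_finite[of k] by simp
qed (auto intro!: AE_I2 simp: indicator_def)

lemma emeasure_span_lborel_singleton_0:
  assumes B: "orthonormal_set B" "B \<noteq> {}"
  shows "emeasure (span_lborel B) {0} = 0"
proof -
  have "emeasure (span_lborel B) {0} = ennreal (2 ^ card B) * (\<integral>\<^sup>+ x. indicator {0} (2 *\<^sub>R x) \<partial>span_lborel B)"
    using nn_integral_span_lborel_scale[OF B(1), of 2 "indicator {0}"] by simp
  also have "(\<lambda>x. indicator {0} (2 *\<^sub>R x)) = (indicator {0} :: 'a \<Rightarrow> ennreal)"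
    by (auto simp: indicator_def fun_eq_iff)
  finally have eq: "emeasure (span_lborel B) {0} = ennreal (2 ^ card B) * emeasure (span_lborel B) {0}" by simp
  have "emeasure (span_lborel B) {0} \<le> emeasure (span_lborel B) (cball 0 0)"
    by (intro emeasure_mono) auto
  also have "\<dots> \<le> ennreal ((2 * 0) ^ card B)" by (rule emeasure_span_lborel_cball[OF B(1)]) simp
  also have "\<dots> = 0" using B by (simp add: orthonormal_set_def card_gt_0_iff)
  finally show ?thesis by simp
qed

lemma AE_span_lborel_neq_0:
  assumes "orthonormal_set B" "B \<noteq> {}"
  shows "AE x in span_lborel B. x \<noteq> 0"
  by (rule AE_I[of _ _ "{0}"]) (use emeasure_span_lborel_singleton_0[OF assms] in auto)

lemma emeasure_homogeneous_finite:
  fixes p :: "'a::euclidean_space \<Rightarrow> real"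
  assumes B: "orthonormal_set B" and c: "c > 0" and pc: "\<And>x. c * norm x \<le> p x"
  shows "emeasure (span_lborel B) {x. p x \<le> t} < \<infinity>"
proof -
  have "emeasure (span_lborel B) {x. p x \<le> t} \<le> emeasure (span_lborel B) (cball 0 (max 0 t / c))"
  proof (intro emeasure_mono subsetI)
    fix x assume "x \<in> {x. p x \<le> t}"
    then have "c * norm x \<le> max 0 t" using pc[of x] by simp
    then show "x \<in> cball 0 (max 0 t / c)" using c by (simp add: field_simps)
  qed auto
  also have "\<dots> \<le> ennreal ((2 * (max 0 t / c)) ^ card B)"
    using c by (intro emeasure_span_lborel_cball[OF B]) simp
  finally show ?thesis by (rule le_less_trans) simp
qed

text \<open>After layering, the weight (1 + t) / t^2 * exp (- t) meets the factor t^d coming from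
  the volume of \<open>{x. p x \<le> t}\<close>, where d = \<open>card B\<close>. What remains near
  0 is t^(d - 2), so the singularity of 1 / p is integrable from dimension 2 on; this is the origin
  of \<open>card_B\<close> in \<open>intersection_kernel\<close>.\<close>

lemma integrable_exp_neg_homogeneous:
  fixes p :: "'a::euclidean_space \<Rightarrow> real"
  assumes B: "orthonormal_set B" and p [measurable]: "p \<in> borel_measurable borel"
    and hom: "\<And>c x. c > 0 \<Longrightarrow> p (c *\<^sub>R x) = c * p x"
    and c: "c > 0" and pc: "\<And>x. c * norm x \<le> p x"
  shows "B \<noteq> {} \<Longrightarrow> integrable (span_lborel B) (\<lambda>x. exp (- p x))"
    and "card B \<ge> 2 \<Longrightarrow> integrable (span_lborel B) (\<lambda>x. exp (- p x) / p x)"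
proof -
  have p0: "p x > 0" if "x \<noteq> 0" for x
    using pc[of x] c that by (smt (verit) mult_pos_pos zero_less_norm_iff)
  have fin: "emeasure (span_lborel B) {x. p x \<le> 1} < \<infinity>"
    by (rule emeasure_homogeneous_finite[OF B c pc])
  show "integrable (span_lborel B) (\<lambda>x. exp (- p x))" if ne: "B \<noteq> {}"
  proof (rule integrableI_nonneg)
    have "(\<integral>\<^sup>+ x. ennreal (exp (- p x)) \<partial>span_lborel B)
      = (\<integral>\<^sup>+ x. \<integral>\<^sup>+ t. ennreal (exp (- t)) * indicator {0<..} t * indicator {x. p x \<le> t} x \<partial>lborel \<partial>span_lborel B)"
    proof (rule nn_integral_cong_AE)
      show "AE x in span_lborel B. ennreal (exp (- p x)) = (\<integral>\<^sup>+ t. ennreal (exp (- t)) * indicator {0<..} t * indicator {x. p x \<le> t} x \<partial>lborel)"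
        using AE_span_lborel_neq_0[OF B ne]
        by eventually_elim (subst exp_layer[symmetric], intro nn_integral_cong,
            auto simp: indicator_def dest!: p0)
    qed
    also have "\<dots> = emeasure (span_lborel B) {x. p x \<le> 1} * (\<integral>\<^sup>+ t. ennreal (exp (- t)) * indicator {0<..} t * ennreal (t ^ card B) \<partial>lborel)"
      using nn_integral_layer_homogeneous[OF B p hom, of "\<lambda>t. ennreal (exp (- t))"] by simp
    also have "(\<integral>\<^sup>+ t. ennreal (exp (- t)) * indicator {0<..} t * ennreal (t ^ card B) \<partial>lborel)
        = (\<integral>\<^sup>+ t. ennreal (t ^ card B * exp (- t)) * indicator {0<..} t \<partial>lborel)"
      by (intro nn_integral_cong) (auto simp: indicator_def ennreal_mult mult.commute)
    finally show "(\<integral>\<^sup>+ x. ennreal (exp (- p x)) \<partial>span_lborel B) < \<infinity>"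
      using fin nn_integral_power_exp_finite[of "card B"] by (simp add: ennreal_mult_less_top)
  qed auto
  show "integrable (span_lborel B) (\<lambda>x. exp (- p x) / p x)" if ge: "card B \<ge> 2"
  proof (rule integrableI_nonneg)
    have ne: "B \<noteq> {}" using ge by auto
    show "AE x in span_lborel B. 0 \<le> exp (- p x) / p x"
      using AE_span_lborel_neq_0[OF B ne] by eventually_elim (use p0 in \<open>auto intro: less_imp_le\<close>)
    have "(\<integral>\<^sup>+ x. ennreal (exp (- p x) / p x) \<partial>span_lborel B)
      = (\<integral>\<^sup>+ x. \<integral>\<^sup>+ t. ennreal ((1 + t) / t\<^sup>2 * exp (- t)) * indicator {0<..} t * indicator {x. p x \<le> t} x \<partial>lborel \<partial>span_lborel B)"
    proof (rule nn_integral_cong_AE)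
      show "AE x in span_lborel B. ennreal (exp (- p x) / p x) = (\<integral>\<^sup>+ t. ennreal ((1 + t) / t\<^sup>2 * exp (- t)) * indicator {0<..} t * indicator {x. p x \<le> t} x \<partial>lborel)"
        using AE_span_lborel_neq_0[OF B ne]
        by eventually_elim (subst exp_over_layer[symmetric], erule p0, intro nn_integral_cong,
            auto simp: indicator_def dest!: p0)
    qed
    also have "\<dots> = emeasure (span_lborel B) {x. p x \<le> 1} * (\<integral>\<^sup>+ t. ennreal ((1 + t) / t\<^sup>2 * exp (- t)) * indicator {0<..} t * ennreal (t ^ card B) \<partial>lborel)"
      using nn_integral_layer_homogeneous[OF B p hom, of "\<lambda>t. ennreal ((1 + t) / t\<^sup>2 * exp (- t))"] by simp
    also have "(\<integral>\<^sup>+ t. ennreal ((1 + t) / t\<^sup>2 * exp (- t)) * indicator {0<..} t * ennreal (t ^ card B) \<partial>lborel)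
        = (\<integral>\<^sup>+ t. ennreal (t ^ (card B - 2) * exp (- t)) * indicator {0<..} t + ennreal (t ^ (card B - 1) * exp (- t)) * indicator {0<..} t \<partial>lborel)"
    proof (intro nn_integral_cong)
      fix t :: real
      have *: "(1 + t) / t\<^sup>2 * exp (- t) * t ^ card B = t ^ (card B - 2) * exp (- t) + t ^ (card B - 1) * exp (- t)" if "t > 0"
      proof -
        obtain m where m: "card B = Suc (Suc m)" using ge by (metis add_2_eq_Suc le_Suc_ex)
        show ?thesis using that by (simp add: m field_simps power2_eq_square)
      qed
      show "ennreal ((1 + t) / t\<^sup>2 * exp (- t)) * indicator {0<..} t * ennreal (t ^ card B)
        = ennreal (t ^ (card B - 2) * exp (- t)) * indicator {0<..} t + ennreal (t ^ (card B - 1) * exp (- t)) * indicator {0<..} t"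
      proof (cases "t > 0")
        case True
        then have "ennreal ((1 + t) / t\<^sup>2 * exp (- t)) * ennreal (t ^ card B) = ennreal (t ^ (card B - 2) * exp (- t) + t ^ (card B - 1) * exp (- t))"
          unfolding *[OF True, symmetric] by (intro ennreal_mult[symmetric]) auto
        with True show ?thesis by (simp add: ennreal_plus)
      qed simp
    qed
    also have "\<dots> = (\<integral>\<^sup>+ t. ennreal (t ^ (card B - 2) * exp (- t)) * indicator {0<..} t \<partial>lborel) + (\<integral>\<^sup>+ t. ennreal (t ^ (card B - 1) * exp (- t)) * indicator {0<..} t \<partial>lborel)"
      by (rule nn_integral_add) auto
    finally show "(\<integral>\<^sup>+ x. ennreal (exp (- p x) / p x) \<partial>span_lborel B) < \<infinity>"
      using fin nn_integral_power_exp_finite[of "card B - 2"] nn_integral_power_exp_finite[of "card B - 1"]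
      by (simp add: ennreal_mult_less_top)
  qed auto
qed

text \<open>The surface p = 1 lies in every shell s < p \<le> 1, whose measure
  \<open>(1 - s ^ card B) * m\<close> vanishes as s \<rightarrow> 1. It follows that the indicator
  of a star-shaped body is continuous almost everywhere, on every subspace.\<close>

lemma AE_homogeneous_neq_1:
  fixes p :: "'a::euclidean_space \<Rightarrow> real"
  assumes B: "orthonormal_set B" "B \<noteq> {}" and p [measurable]: "p \<in> borel_measurable borel"
    and hom: "\<And>c x. c > 0 \<Longrightarrow> p (c *\<^sub>R x) = c * p x"
    and c: "c > 0" and pc: "\<And>x. c * norm x \<le> p x"
  shows "AE x in span_lborel B. p x \<noteq> 1"
proof -
  let ?M = "span_lborel B"
  define m where "m = measure ?M {x. p x \<le> 1}"
  have fin: "emeasure ?M {x. p x \<le> t} < \<infinity>" for t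
    by (rule emeasure_homogeneous_finite[OF B(1) c pc])
  have mt: "measure ?M {x. p x \<le> t} = t ^ card B * m" if "t > 0" for t
    using emeasure_homogeneous_le[OF B(1) p hom that] that by (simp add: measure_def m_def enn2real_mult)
  have le: "measure ?M {x. p x = 1} \<le> (1 - s ^ card B) * m" if s: "0 < s" "s < 1" for s
  proof -
    have "measure ?M {x. p x = 1} \<le> measure ?M ({x. p x \<le> 1} - {x. p x \<le> s})"
      using fin[of 1] s by (intro measure_mono_fmeasurable fmeasurable_Diff) (auto simp: fmeasurable_def)
    also have "\<dots> = measure ?M {x. p x \<le> 1} - measure ?M {x. p x \<le> s}"
      using fin[of 1] s by (intro measure_Diff) auto
    finally show ?thesis using mt[of s] s by (simp add: m_def algebra_simps)
  qed
  have "measure ?M {x. p x = 1} \<le> 0"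
  proof (rule tendsto_lowerbound)
    show "((\<lambda>s. (1 - s ^ card B) * m) \<longlongrightarrow> 0) (at_left 1)"
      by (rule tendsto_eq_intros refl | simp)+
    show "\<forall>\<^sub>F s in at_left 1. measure ?M {x. p x = 1} \<le> (1 - s ^ card B) * m"
      using eventually_at_left_real[of 0 "1::real", simplified] by (rule eventually_mono) (use le in auto)
  qed simp
  moreover have "emeasure ?M {x. p x = 1} < \<infinity>"
    using fin[of 1] by (rule le_less_trans[rotated]) (intro emeasure_mono, auto)
  ultimately have "emeasure ?M {x. p x = 1} = 0"
    by (simp add: emeasure_eq_ennreal_measure measure_le_0_iff less_top)
  then show ?thesis by (intro AE_I[of _ _ "{x. p x = 1}"]) auto
qed

subsection \<open>Positive definite kernels and hyperplane sections\<close>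

lemma inner_unit_square_le:
  assumes "norm \<theta> = 1"
  shows "(z \<bullet> \<theta>)\<^sup>2 \<le> (norm z)\<^sup>2"
  using Cauchy_Schwarz_ineq2[of z \<theta>] assms by (simp add: abs_le_square_iff[symmetric])

lemma integrable_pair_mult:
  fixes f g :: "'a::euclidean_space \<Rightarrow> real"
  assumes A: "orthonormal_set A" and B: "orthonormal_set B"
    and f: "integrable (span_lborel A) f" and g: "integrable (span_lborel B) g"
  shows "integrable (span_lborel A \<Otimes>\<^sub>M span_lborel B) (\<lambda>z. f (fst z) * g (snd z))"
proof -
  interpret pair_sigma_finite "span_lborel A" "span_lborel B"
    using A B by (rule pair_sigma_finite_span_lborel)
  have [measurable]: "f \<in> borel_measurable borel" "g \<in> borel_measurable borel"
    using f g by (auto dest: borel_measurable_integrable)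
  show ?thesis
  proof (rule Fubini_integrable)
    show "integrable (span_lborel A) (\<lambda>x. \<integral>y. norm (f (fst (x, y)) * g (snd (x, y))) \<partial>span_lborel B)"
      using f by (simp add: abs_mult)
  qed (use g in auto)
qed

text \<open>The quadratic form is diagonal in an orthonormal basis containing \<theta>. The term
  with s comes from the smoothed delta function on the hyperplane orthogonal to \<theta>: as s
  grows, the weight concentrates there.\<close>

lemma gaussian_Fourier_hyperplane:
  fixes B :: "'a::euclidean_space set"
  assumes B: "orthonormal_set B" and th: "\<theta> \<in> span B" "norm \<theta> = 1" and y: "y \<in> span B"
    and k: "k > 0" and s: "s \<ge> 0"
  shows "integrable (span_lborel B) (\<lambda>\<xi>. exp (- (k\<^sup>2 * (norm \<xi>)\<^sup>2 + s * (\<xi> \<bullet> \<theta>)\<^sup>2) / 2))" (is ?I)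
    and "(\<integral>\<xi>. cos (y \<bullet> \<xi>) * exp (- (k\<^sup>2 * (norm \<xi>)\<^sup>2 + s * (\<xi> \<bullet> \<theta>)\<^sup>2) / 2) \<partial>span_lborel B)
      = sqrt (2 * pi) ^ card B / (k ^ (card B - 1) * sqrt (k\<^sup>2 + s))
        * exp (- (((norm y)\<^sup>2 - (y \<bullet> \<theta>)\<^sup>2) / k\<^sup>2 + (y \<bullet> \<theta>)\<^sup>2 / (k\<^sup>2 + s)) / 2)" (is ?J)
proof -
  obtain A where A: "orthonormal_set (insert \<theta> A)" "\<theta> \<notin> A" "span (insert \<theta> A) = span B" "card B = Suc (card A)"
    using orthonormal_set_split[OF B th] by metis
  have fin: "finite A" using A(1) by (auto dest: orthonormal_set_finite)
  have eq: "span_lborel B = span_lborel (insert \<theta> A)"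
    using span_lborel_cong_span[OF B A(1)] A(3) by simp
  define c where "c = (\<lambda>b. if b = \<theta> then k\<^sup>2 + s else k\<^sup>2)"
  have cpos: "c b > 0" for b using k s by (auto simp: c_def add_pos_nonneg)
  have cA: "c b = k\<^sup>2" if "b \<in> A" for b using that A(2) by (auto simp: c_def)
  have norm2: "(norm x)\<^sup>2 = (x \<bullet> \<theta>)\<^sup>2 + (\<Sum>b\<in>A. (x \<bullet> b)\<^sup>2)" if "x \<in> span B" for x
    using inner_orthonormal_sum[OF A(1), of x] that A fin by simp
  have quad: "(\<Sum>b\<in>insert \<theta> A. c b * (x \<bullet> b)\<^sup>2) = k\<^sup>2 * (norm x)\<^sup>2 + s * (x \<bullet> \<theta>)\<^sup>2" if "x \<in> span B" for x
    using fin A(2) norm2[OF that] by (simp add: cA sum_distrib_left algebra_simps) (simp add: c_def algebra_simps)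
  have dual: "(\<Sum>b\<in>insert \<theta> A. (y \<bullet> b)\<^sup>2 / c b) = ((norm y)\<^sup>2 - (y \<bullet> \<theta>)\<^sup>2) / k\<^sup>2 + (y \<bullet> \<theta>)\<^sup>2 / (k\<^sup>2 + s)"
    using fin A(2) norm2[OF y] by (simp add: cA sum_divide_distrib[symmetric]) (simp add: c_def)
  have prod: "(\<Prod>b\<in>insert \<theta> A. sqrt (2 * pi / c b)) = sqrt (2 * pi) ^ card B / (k ^ (card B - 1) * sqrt (k\<^sup>2 + s))"
  proof -
    have "(\<Prod>b\<in>A. sqrt (2 * pi / c b)) = (sqrt (2 * pi) / k) ^ card A"
      using k by (subst prod.cong[OF refl, of _ _ "\<lambda>_. sqrt (2 * pi) / k"]) (auto simp: cA real_sqrt_divide)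
    then show ?thesis
      using fin A(2,4) by (simp add: c_def real_sqrt_divide power_divide field_simps)
  qed
  have AEi: "AE x in span_lborel B. complex_of_real (exp (- (\<Sum>b\<in>insert \<theta> A. c b * (x \<bullet> b)\<^sup>2) / 2)) * cis (x \<bullet> v)
    = complex_of_real (exp (- (k\<^sup>2 * (norm x)\<^sup>2 + s * (x \<bullet> \<theta>)\<^sup>2) / 2)) * cis (x \<bullet> v)" for v
    using AE_span_lborel by eventually_elim (simp only: quad)
  have m1: "(\<lambda>x. complex_of_real (exp (- (\<Sum>b\<in>insert \<theta> A. c b * (x \<bullet> b)\<^sup>2) / 2)) * cis (x \<bullet> v)) \<in> borel_measurable (span_lborel B)" for v
    by simp
  have m2: "(\<lambda>x. complex_of_real (exp (- (k\<^sup>2 * (norm x)\<^sup>2 + s * (x \<bullet> \<theta>)\<^sup>2) / 2)) * cis (x \<bullet> v)) \<in> borel_measurable (span_lborel B)" for v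
    by simp
  have int: "integrable (span_lborel B) (\<lambda>x. complex_of_real (exp (- (k\<^sup>2 * (norm x)\<^sup>2 + s * (x \<bullet> \<theta>)\<^sup>2) / 2)) * cis (x \<bullet> v))" for v
    using gaussian_Fourier(1)[OF A(1), of c v] cpos integrable_cong_AE[OF m1 m2 AEi] by (simp add: eq)
  have "integrable (span_lborel B) (\<lambda>x. complex_of_real (exp (- (k\<^sup>2 * (norm x)\<^sup>2 + s * (x \<bullet> \<theta>)\<^sup>2) / 2)))"
    using int[of 0] by (simp del: of_real_exp)
  then show ?I by (simp only: complex_of_real_integrable_eq)
  have "(\<integral>x. complex_of_real (exp (- (k\<^sup>2 * (norm x)\<^sup>2 + s * (x \<bullet> \<theta>)\<^sup>2) / 2)) * cis (x \<bullet> y) \<partial>span_lborel B)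
    = complex_of_real (sqrt (2 * pi) ^ card B / (k ^ (card B - 1) * sqrt (k\<^sup>2 + s))
        * exp (- (((norm y)\<^sup>2 - (y \<bullet> \<theta>)\<^sup>2) / k\<^sup>2 + (y \<bullet> \<theta>)\<^sup>2 / (k\<^sup>2 + s)) / 2))"
    using gaussian_Fourier(2)[OF A(1), of c y] cpos integral_cong_AE[OF m1 m2 AEi, of y] unfolding eq prod dual by simp
  from arg_cong[OF this, of Re] show ?J
    using integral_Re[OF int[of y]] by (simp add: mult.commute inner_commute del: of_real_exp)
qed

lemma integrable_gaussian_norm:
  fixes B :: "'a::euclidean_space set"
  assumes "orthonormal_set B" "B \<noteq> {}" "k > 0"
  shows "integrable (span_lborel B) (\<lambda>\<xi>. exp (- (k\<^sup>2 * (norm \<xi>)\<^sup>2) / 2))"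
proof -
  obtain b where "b \<in> B" using assms by auto
  then show ?thesis
    using gaussian_Fourier_hyperplane(1)[OF assms(1), of b 0 k 0] assms
    by (auto simp: span_base span_zero orthonormal_set_def)
qed

text \<open>The factor \<open>E (p x)\<close> makes \<open>N\<close> integrable at infinity, so that \<open>PD\<close> can be stated without
  distributions. Only \<open>E (p x) = exp (- \<parallel>x\<parallel>\<^sup>2 / 2)\<close> and \<open>E (p x) = exp (- p x)\<close> are needed.\<close>

locale intersection_kernel =
  fixes B :: "'a::euclidean_space set" and N p :: "'a \<Rightarrow> real" and E :: "real \<Rightarrow> real" and CN c1 c2 CE :: real
  assumes B: "orthonormal_set B" and card_B: "2 \<le> card B"
    and N_meas [measurable]: "N \<in> borel_measurable borel"
    and N_nonneg: "N x \<ge> 0"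
    and N_hom: "c > 0 \<Longrightarrow> N (c *\<^sub>R x) = N x / c"
    and N_even: "N (- x) = N x"
    and N_le: "N x \<le> CN / norm x"
    and N_cont: "x \<noteq> 0 \<Longrightarrow> isCont N x"
    and p_cont: "continuous_on UNIV p"
    and p_hom: "c > 0 \<Longrightarrow> p (c *\<^sub>R x) = c * p x"
    and p_even: "p (- x) = p x"
    and c1: "c1 > 0"
    and p_ge: "c1 * norm x \<le> p x"
    and p_le: "p x \<le> c2 * norm x"
    and E_cont: "continuous_on UNIV E"
    and E_nonneg: "r \<ge> 0 \<Longrightarrow> E r \<ge> 0"
    and E_le: "r \<ge> 0 \<Longrightarrow> E r \<le> CE * exp (- r)"
    and E_mono: "r \<ge> 0 \<Longrightarrow> E (2 * r) \<le> E r"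
    and E_diff: "r \<ge> 0 \<Longrightarrow> E r - E (2 * r) \<le> CE * r * exp (- r)"
    and E_12: "E 2 < E 1"
    and PD: "\<xi> \<in> span B \<Longrightarrow> 0 \<le> (\<integral>x. N x * E (p x) * cos (x \<bullet> \<xi>) \<partial>span_lborel B)"
begin

lemma B_ne: "B \<noteq> {}"
  using card_B by auto

lemma p_meas [measurable]: "p \<in> borel_measurable borel"
  using p_cont by (rule borel_measurable_continuous_onI)

lemma E_meas [measurable]: "E \<in> borel_measurable borel"
  using E_cont by (rule borel_measurable_continuous_onI)

lemma p_nonneg: "p x \<ge> 0"
  using p_ge[of x] c1 by (meson mult_nonneg_nonneg norm_ge_zero order_trans less_imp_le)

lemma CE_nonneg: "CE \<ge> 0"
  using E_le[of 0] E_nonneg[of 0] by simp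

lemma unit_exists: obtains b where "b \<in> span B" "norm b = 1"
proof -
  obtain b where "b \<in> B" using B_ne by auto
  then show thesis using that[of b] B by (auto simp: span_base orthonormal_set_def)
qed

lemma CN_nonneg: "CN \<ge> 0"
  using unit_exists N_le N_nonneg by (metis div_by_1 order_trans)

lemma c2_nonneg: "c2 \<ge> 0"
  using unit_exists p_le p_nonneg by (metis mult.right_neutral order_trans)

lemma N_0: "N 0 = 0"
  using N_hom[of 2 0] by simp

lemma integrable_NE:
  assumes \<tau>: "\<tau> > 0"
  shows "integrable (span_lborel B) (\<lambda>x. N x * E (\<tau> * p x))"
proof -
  \<comment> \<open>Chosen so that the bounds \<open>N_le\<close> and \<open>E_le\<close> together
    give a constant multiple of \<open>exp (- q x) / q x\<close>, which is integrable from dimension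
    2 on. The factor \<open>\<tau> * c1\<close> in the constant undoes the one in the
    denominator.\<close>
  define q where "q = (\<lambda>x::'a. \<tau> * c1 * norm x)"
  have "integrable (span_lborel B) (\<lambda>x. exp (- q x) / q x)"
    by (rule integrable_exp_neg_homogeneous(2)[OF B, of _ "\<tau> * c1"]) (use \<tau> c1 card_B in \<open>auto simp: q_def\<close>)
  then have i: "integrable (span_lborel B) (\<lambda>x. (CN * CE * \<tau> * c1) * (exp (- q x) / q x))"
    by (rule integrable_mult_right)
  show ?thesis
  proof (rule Bochner_Integration.integrable_bound[OF i])
    show "AE x in span_lborel B. norm (N x * E (\<tau> * p x)) \<le> norm (CN * CE * \<tau> * c1 * (exp (- q x) / q x))"
    proof (rule AE_I2)
      fix x :: 'a
      show "norm (N x * E (\<tau> * p x)) \<le> norm (CN * CE * \<tau> * c1 * (exp (- q x) / q x))"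
      proof (cases "x = 0")
        case False
        have "E (\<tau> * p x) \<le> CE * exp (- (\<tau> * p x))" using \<tau> p_nonneg by (intro E_le) auto
        also have "\<dots> \<le> CE * exp (- q x)"
          using CE_nonneg p_ge[of x] \<tau> by (intro mult_left_mono) (auto simp: q_def mult.assoc)
        finally have "N x * E (\<tau> * p x) \<le> (CN / norm x) * (CE * exp (- q x))"
          using \<tau> p_nonneg CN_nonneg by (intro mult_mono N_le E_nonneg) auto
        also have "\<dots> = CN * CE * \<tau> * c1 * (exp (- q x) / q x)"
          using \<tau> c1 False by (simp add: q_def)
        finally show ?thesis
          using mult_nonneg_nonneg[OF N_nonneg[of x] E_nonneg[OF mult_nonneg_nonneg[OF less_imp_le[OF \<tau>] p_nonneg[of x]]]]
          unfolding real_norm_def by linarith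
      qed (simp add: N_0)
    qed
  qed simp
qed

text \<open>Averaging the weight \<open>P \<tau> \<xi>\<close> over the \<open>\<xi>\<close> orthogonal to \<open>x\<close> against a Gaussian diverges
  logarithmically as \<open>\<tau> \<rightarrow> 0\<close>; the difference of the Gaussians with parameters \<open>k = 1\<close> and \<open>k = 2\<close>
  converges to a multiple of \<open>\<parallel>x\<parallel> N x\<close>, a Frullani integral. \<open>Lam\<close> is the average with
  \<open>\<delta>(x \<bullet> \<xi>)\<close> smoothed at scale \<open>e\<close>.\<close>

definition P :: "real \<Rightarrow> 'a \<Rightarrow> real" where
  "P \<tau> \<xi> = (\<integral>x. N x * E (\<tau> * p x) * cos (x \<bullet> \<xi>) \<partial>span_lborel B)"

text \<open>By homogeneity P \<tau> \<xi> equals \<tau>^(1 - d) times P 1 (\<xi> / \<tau>) with d =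
  \<open>card B\<close>, and for \<tau> = 1 this is \<open>PD\<close>. Hence the locale only has to
  ask for positivity at one strength of the damping.\<close>

lemma P_nonneg:
  assumes "\<tau> > 0" "\<xi> \<in> span B"
  shows "P \<tau> \<xi> \<ge> 0"
proof -
  have "P \<tau> \<xi> = \<bar>inverse \<tau>\<bar> ^ card B * (\<integral>x. N (inverse \<tau> *\<^sub>R x) * E (\<tau> * p (inverse \<tau> *\<^sub>R x)) * cos ((inverse \<tau> *\<^sub>R x) \<bullet> \<xi>) \<partial>span_lborel B)"
    unfolding P_def using assms by (subst integral_span_lborel_scale[OF B, of "inverse \<tau>"]) auto
  also have "(\<integral>x. N (inverse \<tau> *\<^sub>R x) * E (\<tau> * p (inverse \<tau> *\<^sub>R x)) * cos ((inverse \<tau> *\<^sub>R x) \<bullet> \<xi>) \<partial>span_lborel B)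
    = (\<integral>x. \<tau> * (N x * E (p x) * cos (x \<bullet> (inverse \<tau> *\<^sub>R \<xi>))) \<partial>span_lborel B)"
  proof (rule Bochner_Integration.integral_cong[OF refl])
    fix x
    have *: "\<tau> * (inverse \<tau> * a) = a" for a using assms(1) by simp
    show "N (inverse \<tau> *\<^sub>R x) * E (\<tau> * p (inverse \<tau> *\<^sub>R x)) * cos ((inverse \<tau> *\<^sub>R x) \<bullet> \<xi>)
      = \<tau> * (N x * E (p x) * cos (x \<bullet> (inverse \<tau> *\<^sub>R \<xi>)))"
      using assms(1) by (simp add: N_hom p_hom * divide_inverse mult_ac)
  qed
  also have "\<dots> = \<tau> * (\<integral>x. N x * E (p x) * cos (x \<bullet> (inverse \<tau> *\<^sub>R \<xi>)) \<partial>span_lborel B)"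
    by simp
  finally show ?thesis
    using PD[of "inverse \<tau> *\<^sub>R \<xi>"] assms by (simp add: span_scale)
qed

lemma integrable_NE_cos:
  assumes \<tau>: "\<tau> > 0"
  shows "integrable (span_lborel B) (\<lambda>x. N x * E (\<tau> * p x) * cos (x \<bullet> \<xi>))"
  by (rule Bochner_Integration.integrable_bound[OF integrable_NE[OF \<tau>]])
    (auto simp: abs_mult intro!: mult_left_le)

lemma P_bound:
  assumes "\<tau> > 0"
  shows "\<bar>P \<tau> \<xi>\<bar> \<le> (\<integral>x. N x * E (\<tau> * p x) \<partial>span_lborel B)"
  unfolding P_def
proof (intro integral_abs_bound[THEN order_trans] integral_mono)
  fix x
  have "0 \<le> N x * E (\<tau> * p x)" using assms N_nonneg p_nonneg by (auto intro!: mult_nonneg_nonneg E_nonneg)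
  then show "\<bar>N x * E (\<tau> * p x) * cos (x \<bullet> \<xi>)\<bar> \<le> N x * E (\<tau> * p x)"
    by (simp add: abs_mult) (metis abs_cos_le_one abs_ge_zero abs_mult abs_of_nonneg mult_left_le)
qed (use integrable_NE[OF assms] integrable_NE_cos[OF assms] in auto)

lemma P_meas [measurable]: "P \<tau> \<in> borel_measurable borel"
proof -
  interpret sigma_finite_measure "span_lborel B" by (rule sigma_finite_span_lborel[OF B])
  show ?thesis unfolding P_def by measurable
qed

definition Lam :: "real \<Rightarrow> real \<Rightarrow> real \<Rightarrow> 'a \<Rightarrow> real" where
  "Lam \<tau> k e x = sqrt (2 * pi) ^ card B / sqrt (k\<^sup>2 * e\<^sup>2 + (norm x)\<^sup>2) *
     (\<integral>z. N z * E (k * \<tau> * p z) *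
        exp (- (((norm z)\<^sup>2 - (z \<bullet> (x /\<^sub>R norm x))\<^sup>2) + k\<^sup>2 * (z \<bullet> (x /\<^sub>R norm x))\<^sup>2 * e\<^sup>2 / (k\<^sup>2 * e\<^sup>2 + (norm x)\<^sup>2)) / 2) \<partial>span_lborel B)"

text \<open>After Fubini the integral over \<xi> is that of
  \<open>gaussian_Fourier_hyperplane\<close> with \<theta> the direction of x and
  \<open>s = (norm x)\<^sup>2 / e\<^sup>2\<close>. The substitution y = k z then trades the width k
  of the Gaussian for a stronger damping, which is why k reappears inside
  \<open>E (k * \<tau> * p z)\<close>.\<close>

lemma Lam_eq:
  assumes \<tau>: "\<tau> > 0" and k: "k > 0" and e: "e > 0" and x: "x \<in> span B" "x \<noteq> 0"
  shows "(\<integral>\<xi>. P \<tau> \<xi> * exp (- (k\<^sup>2 * (norm \<xi>)\<^sup>2) / 2) * exp (- (x \<bullet> \<xi>)\<^sup>2 / (2 * e\<^sup>2)) / e \<partial>span_lborel B) = Lam \<tau> k e x"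
proof -
  interpret pair_sigma_finite "span_lborel B" "span_lborel B"
    using B B by (rule pair_sigma_finite_span_lborel)
  define \<theta> where "\<theta> = x /\<^sub>R norm x"
  define s where "s = (norm x)\<^sup>2 / e\<^sup>2"
  have th: "\<theta> \<in> span B" "norm \<theta> = 1" using x by (auto simp: \<theta>_def span_scale)
  have s: "s \<ge> 0" by (simp add: s_def)
  define W where "W = (\<lambda>\<xi>. exp (- (k\<^sup>2 * (norm \<xi>)\<^sup>2 + s * (\<xi> \<bullet> \<theta>)\<^sup>2) / 2))"
  have [measurable]: "W \<in> borel_measurable borel" by (simp add: W_def)
  have xth: "x = norm x *\<^sub>R \<theta>" using x by (simp add: \<theta>_def)
  have "(x \<bullet> \<xi>) = norm x * (\<xi> \<bullet> \<theta>)" for \<xi>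
    by (subst xth) (simp add: inner_commute)
  then have W: "exp (- (k\<^sup>2 * (norm \<xi>)\<^sup>2) / 2) * exp (- (x \<bullet> \<xi>)\<^sup>2 / (2 * e\<^sup>2)) = W \<xi>" for \<xi>
    unfolding W_def mult_exp_exp by (simp add: s_def power_mult_distrib field_simps add_divide_distrib)
  have Wi: "integrable (span_lborel B) W"
    unfolding W_def by (rule gaussian_Fourier_hyperplane(1)[OF B th span_zero k s])
  have W0: "W \<xi> \<ge> 0" for \<xi> by (simp add: W_def)
  have NEi: "integrable (span_lborel B) (\<lambda>y. N y * E (\<tau> * p y))" by (rule integrable_NE[OF \<tau>])
  have NE0: "N y * E (\<tau> * p y) \<ge> 0" for y
    using \<tau> N_nonneg p_nonneg by (auto intro!: mult_nonneg_nonneg E_nonneg)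
  have prodi: "integrable (span_lborel B \<Otimes>\<^sub>M span_lborel B) (\<lambda>z. (N (fst z) * E (\<tau> * p (fst z))) * W (snd z))"
    by (rule integrable_pair_mult[OF B B NEi Wi])
  have prodi2: "integrable (span_lborel B \<Otimes>\<^sub>M span_lborel B) (\<lambda>(y, \<xi>). N y * E (\<tau> * p y) * cos (y \<bullet> \<xi>) * W \<xi>)"
    by (rule Bochner_Integration.integrable_bound[OF prodi])
      (auto simp: abs_mult case_prod_beta intro!: AE_I2 mult_right_mono mult_left_le)
  have "(\<integral>\<xi>. P \<tau> \<xi> * exp (- (k\<^sup>2 * (norm \<xi>)\<^sup>2) / 2) * exp (- (x \<bullet> \<xi>)\<^sup>2 / (2 * e\<^sup>2)) / e \<partial>span_lborel B)
    = (\<integral>\<xi>. P \<tau> \<xi> * W \<xi> \<partial>span_lborel B) / e"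
    by (simp only: mult.assoc W integral_divide_zero)
  also have "(\<integral>\<xi>. P \<tau> \<xi> * W \<xi> \<partial>span_lborel B) = (\<integral>\<xi>. \<integral>y. N y * E (\<tau> * p y) * cos (y \<bullet> \<xi>) * W \<xi> \<partial>span_lborel B \<partial>span_lborel B)"
    unfolding P_def by simp
  also have "\<dots> = (\<integral>y. \<integral>\<xi>. N y * E (\<tau> * p y) * cos (y \<bullet> \<xi>) * W \<xi> \<partial>span_lborel B \<partial>span_lborel B)"
    by (rule Fubini_integral[OF prodi2])
  also have "\<dots> = (\<integral>y. N y * E (\<tau> * p y) * (sqrt (2 * pi) ^ card B / (k ^ (card B - 1) * sqrt (k\<^sup>2 + s))
        * exp (- (((norm y)\<^sup>2 - (y \<bullet> \<theta>)\<^sup>2) / k\<^sup>2 + (y \<bullet> \<theta>)\<^sup>2 / (k\<^sup>2 + s)) / 2)) \<partial>span_lborel B)"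
  proof (rule integral_cong_AE)
    show "AE y in span_lborel B. (\<integral>\<xi>. N y * E (\<tau> * p y) * cos (y \<bullet> \<xi>) * W \<xi> \<partial>span_lborel B)
      = N y * E (\<tau> * p y) * (sqrt (2 * pi) ^ card B / (k ^ (card B - 1) * sqrt (k\<^sup>2 + s))
        * exp (- (((norm y)\<^sup>2 - (y \<bullet> \<theta>)\<^sup>2) / k\<^sup>2 + (y \<bullet> \<theta>)\<^sup>2 / (k\<^sup>2 + s)) / 2))"
      using AE_span_lborel
    proof eventually_elim
      case (elim y)
      have "(\<integral>\<xi>. N y * E (\<tau> * p y) * cos (y \<bullet> \<xi>) * W \<xi> \<partial>span_lborel B)
        = N y * E (\<tau> * p y) * (\<integral>\<xi>. cos (y \<bullet> \<xi>) * W \<xi> \<partial>span_lborel B)"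
        by (simp add: mult.assoc)
      then show ?case
        unfolding W_def gaussian_Fourier_hyperplane(2)[OF B th elim k s] .
    qed
  qed simp_all
  also have "\<dots> = sqrt (2 * pi) ^ card B / (k ^ (card B - 1) * sqrt (k\<^sup>2 + s)) *
      (\<integral>y. N y * E (\<tau> * p y) * exp (- (((norm y)\<^sup>2 - (y \<bullet> \<theta>)\<^sup>2) / k\<^sup>2 + (y \<bullet> \<theta>)\<^sup>2 / (k\<^sup>2 + s)) / 2) \<partial>span_lborel B)"
    by (subst integral_mult_right_zero[symmetric]) (simp add: mult_ac)
  also have "(\<integral>y. N y * E (\<tau> * p y) * exp (- (((norm y)\<^sup>2 - (y \<bullet> \<theta>)\<^sup>2) / k\<^sup>2 + (y \<bullet> \<theta>)\<^sup>2 / (k\<^sup>2 + s)) / 2) \<partial>span_lborel B)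
    = k ^ card B * (\<integral>z. N (k *\<^sub>R z) * E (\<tau> * p (k *\<^sub>R z)) * exp (- (((norm (k *\<^sub>R z))\<^sup>2 - ((k *\<^sub>R z) \<bullet> \<theta>)\<^sup>2) / k\<^sup>2 + ((k *\<^sub>R z) \<bullet> \<theta>)\<^sup>2 / (k\<^sup>2 + s)) / 2) \<partial>span_lborel B)"
    using k by (subst integral_span_lborel_scale[OF B, of k]) auto
  also have "(\<lambda>z. N (k *\<^sub>R z) * E (\<tau> * p (k *\<^sub>R z)) * exp (- (((norm (k *\<^sub>R z))\<^sup>2 - ((k *\<^sub>R z) \<bullet> \<theta>)\<^sup>2) / k\<^sup>2 + ((k *\<^sub>R z) \<bullet> \<theta>)\<^sup>2 / (k\<^sup>2 + s)) / 2))
    = (\<lambda>z. (N z * E (k * \<tau> * p z) *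
        exp (- (((norm z)\<^sup>2 - (z \<bullet> \<theta>)\<^sup>2) + k\<^sup>2 * (z \<bullet> \<theta>)\<^sup>2 * e\<^sup>2 / (k\<^sup>2 * e\<^sup>2 + (norm x)\<^sup>2)) / 2)) / k)"
  proof
    fix z
    have a: "((norm (k *\<^sub>R z))\<^sup>2 - ((k *\<^sub>R z) \<bullet> \<theta>)\<^sup>2) / k\<^sup>2 = (norm z)\<^sup>2 - (z \<bullet> \<theta>)\<^sup>2"
      using k by (simp add: power_mult_distrib diff_divide_distrib)
    have pos: "k\<^sup>2 * e\<^sup>2 + (norm x)\<^sup>2 > 0" using k e by (simp add: add_pos_nonneg)
    have b: "((k *\<^sub>R z) \<bullet> \<theta>)\<^sup>2 / (k\<^sup>2 + s) = k\<^sup>2 * (z \<bullet> \<theta>)\<^sup>2 * e\<^sup>2 / (k\<^sup>2 * e\<^sup>2 + (norm x)\<^sup>2)"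
    proof -
      have "k\<^sup>2 + s = (k\<^sup>2 * e\<^sup>2 + (norm x)\<^sup>2) / e\<^sup>2" using e by (simp add: s_def add_divide_distrib)
      then show ?thesis by (simp add: power_mult_distrib)
    qed
    show "N (k *\<^sub>R z) * E (\<tau> * p (k *\<^sub>R z)) * exp (- (((norm (k *\<^sub>R z))\<^sup>2 - ((k *\<^sub>R z) \<bullet> \<theta>)\<^sup>2) / k\<^sup>2 + ((k *\<^sub>R z) \<bullet> \<theta>)\<^sup>2 / (k\<^sup>2 + s)) / 2)
      = (N z * E (k * \<tau> * p z) *
        exp (- (((norm z)\<^sup>2 - (z \<bullet> \<theta>)\<^sup>2) + k\<^sup>2 * (z \<bullet> \<theta>)\<^sup>2 * e\<^sup>2 / (k\<^sup>2 * e\<^sup>2 + (norm x)\<^sup>2)) / 2)) / k"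
      unfolding a b using k by (simp add: N_hom p_hom mult_ac)
  qed
  finally have *: "(\<integral>\<xi>. P \<tau> \<xi> * exp (- (k\<^sup>2 * (norm \<xi>)\<^sup>2) / 2) * exp (- (x \<bullet> \<xi>)\<^sup>2 / (2 * e\<^sup>2)) / e \<partial>span_lborel B)
    = sqrt (2 * pi) ^ card B / (k ^ (card B - 1) * sqrt (k\<^sup>2 + s)) * (k ^ card B *
      (\<integral>z. (N z * E (k * \<tau> * p z) *
        exp (- (((norm z)\<^sup>2 - (z \<bullet> \<theta>)\<^sup>2) + k\<^sup>2 * (z \<bullet> \<theta>)\<^sup>2 * e\<^sup>2 / (k\<^sup>2 * e\<^sup>2 + (norm x)\<^sup>2)) / 2)) / k \<partial>span_lborel B)) / e" .
  \<comment> \<open>The factor 1 / e of the smoothed delta function is used up here: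
    \<open>sqrt (k\<^sup>2 + s)\<close> is of order 1 / e, and the product tends to
    \<open>norm x\<close>.\<close>
  have sq: "sqrt (k\<^sup>2 + s) * e = sqrt (k\<^sup>2 * e\<^sup>2 + (norm x)\<^sup>2)"
  proof -
    have "k\<^sup>2 * e\<^sup>2 + (norm x)\<^sup>2 = (k\<^sup>2 + s) * e\<^sup>2" using e by (simp add: s_def field_simps)
    then show ?thesis using e by (simp add: real_sqrt_mult)
  qed
  have kk: "k ^ card B = k * k ^ (card B - 1)"
    using card_B by (simp add: power_eq_if)
  show ?thesis
    unfolding * Lam_def \<theta>_def[symmetric] sq[symmetric] using k e
    by (simp add: kk field_simps)
qed

end

text \<open>The factor r is the point: it cancels the 1 / \<parallel>\<xi>\<parallel> in the bound
  of \<open>section_average\<close> and leaves a Gaussian majorant. The constant 3 / 2 is (2^2 - 1)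
  / 2, from 1 - exp (- u) \<le> u; this yields r^2, and the surplus r is paid for by half of the
  exponent, which leaves the width parameter 1 / sqrt 2.\<close>

lemma gaussian_difference_bounds:
  fixes r :: real
  assumes "r \<ge> 0"
  shows "0 \<le> exp (- (r\<^sup>2) / 2) - exp (- (2\<^sup>2 * r\<^sup>2) / 2)"
    and "exp (- (r\<^sup>2) / 2) - exp (- (2\<^sup>2 * r\<^sup>2) / 2) \<le> 3 / 2 * r * exp (- ((1 / sqrt 2)\<^sup>2 * r\<^sup>2) / 2)"
proof -
  show "0 \<le> exp (- (r\<^sup>2) / 2) - exp (- (2\<^sup>2 * r\<^sup>2) / 2)" by simp
  have "exp (- (r\<^sup>2) / 2) - exp (- (2\<^sup>2 * r\<^sup>2) / 2) = exp (- (r\<^sup>2) / 2) * (1 - exp (- (3 / 2 * r\<^sup>2)))"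
    by (simp add: right_diff_distrib mult_exp_exp)
  also have "\<dots> \<le> exp (- (r\<^sup>2) / 2) * (3 / 2 * r\<^sup>2)"
    using exp_ge_add_one_self[of "- (3 / 2 * r\<^sup>2)"] by (intro mult_left_mono) auto
  also have "\<dots> = exp (- (r\<^sup>2) / 4) * exp (- (r\<^sup>2) / 4) * (3 / 2 * r * r)"
    by (simp add: mult_exp_exp power2_eq_square)
  also have "\<dots> = 3 / 2 * r * exp (- (r\<^sup>2) / 4) * (exp (- (r\<^sup>2) / 4) * r)" by simp
  also have "\<dots> \<le> 3 / 2 * r * exp (- (r\<^sup>2) / 4) * 1"
  proof (rule mult_left_mono)
    have "0 \<le> (r / 2 - 1)\<^sup>2" by simp
    then have "r \<le> 1 + r\<^sup>2 / 4" by (simp add: power2_eq_square field_simps)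
    also have "\<dots> \<le> exp (r\<^sup>2 / 4)" by (rule exp_ge_add_one_self)
    finally show "exp (- (r\<^sup>2) / 4) * r \<le> 1" by (simp add: exp_minus field_simps)
  qed (use assms in auto)
  also have "- (r\<^sup>2) / 4 = - ((1 / sqrt 2)\<^sup>2 * r\<^sup>2) / 2" by (simp add: power_divide)
  finally show "exp (- (r\<^sup>2) / 2) - exp (- (2\<^sup>2 * r\<^sup>2) / 2) \<le> 3 / 2 * r * exp (- ((1 / sqrt 2)\<^sup>2 * r\<^sup>2) / 2)" by simp
qed

section \<open>Limits of the smoothed kernel averages\<close>

context intersection_kernel
begin

text \<open>Up to the prefactor, the limit of \<open>Lam\<close> for e \<rightarrow> 0. The Gaussian
  restrains only the component of z orthogonal to x; along the line through x nothing but the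
  damping keeps the integral finite.\<close>

definition T :: "real \<Rightarrow> real \<Rightarrow> 'a \<Rightarrow> real" where
  "T \<tau> k x = (\<integral>z. N z * E (k * \<tau> * p z) * exp (- ((norm z)\<^sup>2 - (z \<bullet> (x /\<^sub>R norm x))\<^sup>2) / 2) \<partial>span_lborel B)"

lemma NE_nonneg: "t \<ge> 0 \<Longrightarrow> 0 \<le> N z * E (t * p z)"
  using N_nonneg p_nonneg by (auto intro!: mult_nonneg_nonneg E_nonneg)

lemma Lam_bound:
  assumes \<tau>: "\<tau> > 0" and k: "k > 0" and x: "x \<noteq> 0"
  shows "\<bar>Lam \<tau> k e x\<bar> \<le> sqrt (2 * pi) ^ card B / norm x * (\<integral>z. N z * E (k * \<tau> * p z) \<partial>span_lborel B)"
proof -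
  let ?w = "\<lambda>z. exp (- (((norm z)\<^sup>2 - (z \<bullet> (x /\<^sub>R norm x))\<^sup>2) + k\<^sup>2 * (z \<bullet> (x /\<^sub>R norm x))\<^sup>2 * e\<^sup>2 / (k\<^sup>2 * e\<^sup>2 + (norm x)\<^sup>2)) / 2)"
  have w: "?w z \<le> 1" for z
  proof -
    have "0 \<le> (norm z)\<^sup>2 - (z \<bullet> (x /\<^sub>R norm x))\<^sup>2"
      using inner_unit_square_le[of "x /\<^sub>R norm x" z] x by simp
    moreover have "0 \<le> k\<^sup>2 * (z \<bullet> (x /\<^sub>R norm x))\<^sup>2 * e\<^sup>2 / (k\<^sup>2 * e\<^sup>2 + (norm x)\<^sup>2)" by simp
    ultimately have "0 \<le> (norm z)\<^sup>2 - (z \<bullet> (x /\<^sub>R norm x))\<^sup>2 + k\<^sup>2 * (z \<bullet> (x /\<^sub>R norm x))\<^sup>2 * e\<^sup>2 / (k\<^sup>2 * e\<^sup>2 + (norm x)\<^sup>2)"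
      by (rule add_nonneg_nonneg)
    from divide_nonneg_pos[OF this, of 2] show ?thesis by (simp only: exp_le_one_iff divide_minus_left neg_le_0_iff_le zero_less_numeral)
  qed
  have i: "integrable (span_lborel B) (\<lambda>z. N z * E (k * \<tau> * p z))"
    using \<tau> k by (intro integrable_NE) simp
  have le: "\<bar>N z * E (k * \<tau> * p z) * ?w z\<bar> \<le> N z * E (k * \<tau> * p z)" for z
    using NE_nonneg[of "k * \<tau>" z] w[of z] \<tau> k by (simp add: abs_mult[of _ "?w z"] mult_left_le)
  have "\<bar>\<integral>z. N z * E (k * \<tau> * p z) * ?w z \<partial>span_lborel B\<bar> \<le> (\<integral>z. N z * E (k * \<tau> * p z) \<partial>span_lborel B)"
    using i le by (intro integral_abs_bound[THEN order_trans] integral_mono integrable_abs Bochner_Integration.integrable_bound[OF i])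
      (auto intro: order_trans[OF _ abs_ge_self])
  moreover have "\<bar>sqrt (2 * pi) ^ card B / sqrt (k\<^sup>2 * e\<^sup>2 + (norm x)\<^sup>2)\<bar> \<le> sqrt (2 * pi) ^ card B / norm x"
  proof -
    have "norm x \<le> sqrt (k\<^sup>2 * e\<^sup>2 + (norm x)\<^sup>2)" by (rule real_le_rsqrt) simp
    then have "sqrt (2 * pi) ^ card B / sqrt (k\<^sup>2 * e\<^sup>2 + (norm x)\<^sup>2) \<le> sqrt (2 * pi) ^ card B / norm x"
      using x by (intro divide_left_mono mult_pos_pos) (auto intro: add_nonneg_pos)
    then show ?thesis by simp
  qed
  ultimately show ?thesis
    unfolding Lam_def abs_mult by (intro mult_mono) auto
qed

lemma Lam_tendsto:
  assumes \<tau>: "\<tau> > 0" and k: "k > 0" and x: "x \<noteq> 0" and e: "e \<longlonglongrightarrow> 0"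
  shows "(\<lambda>n. Lam \<tau> k (e n) x) \<longlonglongrightarrow> sqrt (2 * pi) ^ card B / norm x * T \<tau> k x"
proof -
  let ?w = "\<lambda>e z. exp (- (((norm z)\<^sup>2 - (z \<bullet> (x /\<^sub>R norm x))\<^sup>2) + k\<^sup>2 * (z \<bullet> (x /\<^sub>R norm x))\<^sup>2 * e\<^sup>2 / (k\<^sup>2 * e\<^sup>2 + (norm x)\<^sup>2)) / 2)"
  have w: "?w e z \<le> 1" for e z
  proof -
    have "0 \<le> (norm z)\<^sup>2 - (z \<bullet> (x /\<^sub>R norm x))\<^sup>2"
      using inner_unit_square_le[of "x /\<^sub>R norm x" z] x by simp
    moreover have "0 \<le> k\<^sup>2 * (z \<bullet> (x /\<^sub>R norm x))\<^sup>2 * e\<^sup>2 / (k\<^sup>2 * e\<^sup>2 + (norm x)\<^sup>2)" by simp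
    ultimately have "0 \<le> (norm z)\<^sup>2 - (z \<bullet> (x /\<^sub>R norm x))\<^sup>2 + k\<^sup>2 * (z \<bullet> (x /\<^sub>R norm x))\<^sup>2 * e\<^sup>2 / (k\<^sup>2 * e\<^sup>2 + (norm x)\<^sup>2)"
      by (rule add_nonneg_nonneg)
    from divide_nonneg_pos[OF this, of 2] show ?thesis by (simp only: exp_le_one_iff divide_minus_left neg_le_0_iff_le zero_less_numeral)
  qed
  have i: "integrable (span_lborel B) (\<lambda>z. N z * E (k * \<tau> * p z))"
    using \<tau> k by (intro integrable_NE) simp
  have "(\<lambda>n. \<integral>z. N z * E (k * \<tau> * p z) * ?w (e n) z \<partial>span_lborel B) \<longlonglongrightarrow> T \<tau> k x"
    unfolding T_def
  proof (rule integral_dominated_convergence[OF _ _ i])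
    show "AE z in span_lborel B. norm (N z * E (k * \<tau> * p z) * ?w (e n) z) \<le> N z * E (k * \<tau> * p z)" for n
      using NE_nonneg[of "k * \<tau>"] w[of _ "e n"] \<tau> k by (simp add: abs_mult[of _ "?w _ _"] mult_left_le)
    show "AE z in span_lborel B. (\<lambda>n. N z * E (k * \<tau> * p z) * ?w (e n) z)
      \<longlonglongrightarrow> N z * E (k * \<tau> * p z) * exp (- ((norm z)\<^sup>2 - (z \<bullet> (x /\<^sub>R norm x))\<^sup>2) / 2)"
    proof (rule AE_I2)
      fix z
      have "(\<lambda>n. ?w (e n) z) \<longlonglongrightarrow> exp (- (((norm z)\<^sup>2 - (z \<bullet> (x /\<^sub>R norm x))\<^sup>2) + k\<^sup>2 * (z \<bullet> (x /\<^sub>R norm x))\<^sup>2 * 0\<^sup>2 / (k\<^sup>2 * 0\<^sup>2 + (norm x)\<^sup>2)) / 2)"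
        using x by (intro tendsto_intros e) auto
      then show "(\<lambda>n. N z * E (k * \<tau> * p z) * ?w (e n) z)
        \<longlonglongrightarrow> N z * E (k * \<tau> * p z) * exp (- ((norm z)\<^sup>2 - (z \<bullet> (x /\<^sub>R norm x))\<^sup>2) / 2)"
      proof -
        assume lim: "(\<lambda>n. ?w (e n) z) \<longlonglongrightarrow> exp (- (((norm z)\<^sup>2 - (z \<bullet> (x /\<^sub>R norm x))\<^sup>2) + k\<^sup>2 * (z \<bullet> (x /\<^sub>R norm x))\<^sup>2 * 0\<^sup>2 / (k\<^sup>2 * 0\<^sup>2 + (norm x)\<^sup>2)) / 2)"
        have "exp (- (((norm z)\<^sup>2 - (z \<bullet> (x /\<^sub>R norm x))\<^sup>2) + k\<^sup>2 * (z \<bullet> (x /\<^sub>R norm x))\<^sup>2 * 0\<^sup>2 / (k\<^sup>2 * 0\<^sup>2 + (norm x)\<^sup>2)) / 2)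
          = exp (- ((norm z)\<^sup>2 - (z \<bullet> (x /\<^sub>R norm x))\<^sup>2) / 2)" by simp
        then show ?thesis using tendsto_mult[OF tendsto_const lim, of "N z * E (k * \<tau> * p z)"] by metis
      qed
    qed
  qed simp_all
  moreover have "(\<lambda>n. sqrt (2 * pi) ^ card B / sqrt (k\<^sup>2 * (e n)\<^sup>2 + (norm x)\<^sup>2)) \<longlonglongrightarrow> sqrt (2 * pi) ^ card B / sqrt (k\<^sup>2 * 0\<^sup>2 + (norm x)\<^sup>2)"
    using x by (intro tendsto_intros e) auto
  ultimately show ?thesis
    unfolding Lam_def using tendsto_mult by fastforce
qed

text \<open>Substitution z = y / \<tau>. Homogeneity removes \<tau> from N and E and lets it
  reappear as the width of a Gaussian orthogonal to x; the Jacobian and the factor \<tau> from N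
  combine to \<open>\<tau> ^ (card B - 1)\<close>. This is the shape required by
  \<open>gaussian_concentration\<close> for the line through x.\<close>

lemma T_diff:
  assumes \<tau>: "\<tau> > 0" and x: "x \<in> span B" "x \<noteq> 0"
  defines "\<theta> \<equiv> x /\<^sub>R norm x"
  shows "T \<tau> 1 x - T \<tau> 2 x = (\<integral>y. (N y * (E (p y) - E (2 * p y))) * exp (- ((norm y)\<^sup>2 - (y \<bullet> \<theta>)\<^sup>2) / (2 * \<tau>\<^sup>2)) \<partial>span_lborel B) / \<tau> ^ (card B - 1)"
proof -
  let ?w = "\<lambda>z. exp (- ((norm z)\<^sup>2 - (z \<bullet> \<theta>)\<^sup>2) / 2)"
  have th: "norm \<theta> = 1" using x by (simp add: \<theta>_def)
  have w: "?w z \<le> 1" for z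
    using inner_unit_square_le[OF th, of z] by simp
  have i: "integrable (span_lborel B) (\<lambda>z. N z * E (k * \<tau> * p z) * ?w z)" if "k > 0" for k
  proof (rule Bochner_Integration.integrable_bound)
    show "integrable (span_lborel B) (\<lambda>z. N z * E (k * \<tau> * p z))"
      using \<tau> that by (intro integrable_NE) simp
    show "AE z in span_lborel B. norm (N z * E (k * \<tau> * p z) * ?w z) \<le> norm (N z * E (k * \<tau> * p z))"
      using w by (auto simp: abs_mult intro!: mult_left_le)
  qed simp
  have "T \<tau> 1 x - T \<tau> 2 x = (\<integral>z. N z * E (1 * \<tau> * p z) * ?w z - N z * E (2 * \<tau> * p z) * ?w z \<partial>span_lborel B)"
    unfolding T_def \<theta>_def[symmetric] using i[of 1] i[of 2] by (intro Bochner_Integration.integral_diff[symmetric]) auto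
  also have "\<dots> = \<bar>inverse \<tau>\<bar> ^ card B * (\<integral>y. N (inverse \<tau> *\<^sub>R y) * E (1 * \<tau> * p (inverse \<tau> *\<^sub>R y)) * ?w (inverse \<tau> *\<^sub>R y) - N (inverse \<tau> *\<^sub>R y) * E (2 * \<tau> * p (inverse \<tau> *\<^sub>R y)) * ?w (inverse \<tau> *\<^sub>R y) \<partial>span_lborel B)"
    using \<tau> by (subst integral_span_lborel_scale[OF B, of "inverse \<tau>"]) auto
  also have "(\<integral>y. N (inverse \<tau> *\<^sub>R y) * E (1 * \<tau> * p (inverse \<tau> *\<^sub>R y)) * ?w (inverse \<tau> *\<^sub>R y) - N (inverse \<tau> *\<^sub>R y) * E (2 * \<tau> * p (inverse \<tau> *\<^sub>R y)) * ?w (inverse \<tau> *\<^sub>R y) \<partial>span_lborel B)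
    = (\<integral>y. \<tau> * ((N y * (E (p y) - E (2 * p y))) * exp (- ((norm y)\<^sup>2 - (y \<bullet> \<theta>)\<^sup>2) / (2 * \<tau>\<^sup>2))) \<partial>span_lborel B)"
  proof (rule Bochner_Integration.integral_cong[OF refl])
    fix y
    have w: "?w (inverse \<tau> *\<^sub>R y) = exp (- ((norm y)\<^sup>2 - (y \<bullet> \<theta>)\<^sup>2) / (2 * \<tau>\<^sup>2))"
      using \<tau> by (simp add: power_mult_distrib power_inverse field_simps)
    have n: "N (inverse \<tau> *\<^sub>R y) = \<tau> * N y" using \<tau> by (simp add: N_hom divide_inverse mult.commute)
    have q: "1 * \<tau> * p (inverse \<tau> *\<^sub>R y) = p y" "2 * \<tau> * p (inverse \<tau> *\<^sub>R y) = 2 * p y"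
      using \<tau> by (simp_all add: p_hom)
    show "N (inverse \<tau> *\<^sub>R y) * E (1 * \<tau> * p (inverse \<tau> *\<^sub>R y)) * ?w (inverse \<tau> *\<^sub>R y) - N (inverse \<tau> *\<^sub>R y) * E (2 * \<tau> * p (inverse \<tau> *\<^sub>R y)) * ?w (inverse \<tau> *\<^sub>R y)
      = \<tau> * ((N y * (E (p y) - E (2 * p y))) * exp (- ((norm y)\<^sup>2 - (y \<bullet> \<theta>)\<^sup>2) / (2 * \<tau>\<^sup>2)))"
      unfolding w n q by (simp add: algebra_simps)
  qed
  also have "\<dots> = \<tau> * (\<integral>y. (N y * (E (p y) - E (2 * p y))) * exp (- ((norm y)\<^sup>2 - (y \<bullet> \<theta>)\<^sup>2) / (2 * \<tau>\<^sup>2)) \<partial>span_lborel B)"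
    by simp
  finally show ?thesis
  proof -
    assume *: "T \<tau> 1 x - T \<tau> 2 x = \<bar>inverse \<tau>\<bar> ^ card B * (\<tau> * (\<integral>y. (N y * (E (p y) - E (2 * p y))) * exp (- ((norm y)\<^sup>2 - (y \<bullet> \<theta>)\<^sup>2) / (2 * \<tau>\<^sup>2)) \<partial>span_lborel B))"
    obtain m where m: "card B = Suc m" using card_B by (cases "card B") auto
    have "\<bar>inverse \<tau>\<bar> ^ card B * (\<tau> * c) = c / \<tau> ^ (card B - 1)" for c
      using \<tau> by (simp add: m power_inverse divide_inverse)
    then show ?thesis unfolding * by simp
  qed
qed

text \<open>Frullani's integral, with value 2 * E 0 * ln 2. The argument only uses that it is
  positive.\<close>

definition K0 :: real where
  "K0 = (\<integral>s. (E \<bar>s\<bar> - E (2 * \<bar>s\<bar>)) / \<bar>s\<bar> \<partial>lborel)"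

lemma integrable_exp_neg_abs: "c > 0 \<Longrightarrow> integrable lborel (\<lambda>s::real. exp (- (c * \<bar>s\<bar>)))"
proof -
  assume c: "c > 0"
  obtain b where b: "b \<in> span B" "norm b = 1" by (rule unit_exists)
  have o: "orthonormal_set {b}" using b by (simp add: orthonormal_set_def)
  have "integrable (span_lborel {b}) (\<lambda>x. exp (- (c * norm x)))"
    by (rule integrable_exp_neg_homogeneous(1)[OF o, of _ c]) (use c in auto)
  then show ?thesis using b unfolding span_lborel_singleton
    by (subst (asm) integrable_distr_eq) auto
qed

lemma E_quot_bound: "\<bar>(E \<bar>s\<bar> - E (2 * \<bar>s\<bar>)) / \<bar>s\<bar>\<bar> \<le> CE * exp (- (1 * \<bar>s\<bar>))"
proof (cases "s = 0")
  case False
  have "E \<bar>s\<bar> - E (2 * \<bar>s\<bar>) \<le> CE * \<bar>s\<bar> * exp (- \<bar>s\<bar>)" "0 \<le> E \<bar>s\<bar> - E (2 * \<bar>s\<bar>)"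
    using E_diff[of "\<bar>s\<bar>"] E_mono[of "\<bar>s\<bar>"] by auto
  then show ?thesis using False by (simp add: field_simps)
qed (use CE_nonneg in simp)

lemma integrable_E_quot: "integrable lborel (\<lambda>s. (E \<bar>s\<bar> - E (2 * \<bar>s\<bar>)) / \<bar>s\<bar>)"
  by (rule Bochner_Integration.integrable_bound[OF integrable_mult_right[OF integrable_exp_neg_abs[of 1], of CE]])
    (use E_quot_bound in \<open>auto intro!: AE_I2 order_trans[OF _ abs_ge_self]\<close>)

text \<open>The integrand is nonnegative by \<open>E_mono\<close>, and by \<open>E_12\<close> and
  continuity it is positive in a neighbourhood of s = 1.\<close>

lemma K0_pos: "K0 > 0"
proof -
  have nn: "0 \<le> (E \<bar>s\<bar> - E (2 * \<bar>s\<bar>)) / \<bar>s\<bar>" for s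
    using E_mono[of "\<bar>s\<bar>"] by simp
  have "K0 \<ge> 0" unfolding K0_def by (rule Bochner_Integration.integral_nonneg) (rule nn)
  moreover have "K0 \<noteq> 0"
  proof
    assume "K0 = 0"
    then have ae: "AE s in lborel. (E \<bar>s\<bar> - E (2 * \<bar>s\<bar>)) / \<bar>s\<bar> = 0"
      unfolding K0_def using integral_nonneg_eq_0_iff_AE[OF integrable_E_quot] nn by simp
    have "continuous_on UNIV (\<lambda>s. E \<bar>s\<bar> - E (2 * \<bar>s\<bar>))"
      by (intro continuous_intros continuous_on_compose2[OF E_cont]) auto
    then have "open {s. E \<bar>s\<bar> - E (2 * \<bar>s\<bar>) > 0}"
      by (rule open_Collect_less[OF continuous_on_const])
    moreover have "(1::real) \<in> {s. E \<bar>s\<bar> - E (2 * \<bar>s\<bar>) > 0}" using E_12 by simp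
    ultimately have "open ({s. E \<bar>s\<bar> - E (2 * \<bar>s\<bar>) > 0} \<inter> {0<..})" "1 \<in> {s. E \<bar>s\<bar> - E (2 * \<bar>s\<bar>) > 0} \<inter> {0<..}"
      by (auto intro: open_Int)
    then obtain d where d: "d > 0" "ball 1 d \<subseteq> {s. E \<bar>s\<bar> - E (2 * \<bar>s\<bar>) > 0} \<inter> {0<..}"
      by (meson open_contains_ball)
    have "AE s in lborel. s \<notin> ball (1::real) d"
      by (rule eventually_mono[OF ae]) (use d in fastforce)
    then have "emeasure lborel (ball (1::real) d) = 0"
      by (subst (asm) AE_iff_measurable[of "ball (1::real) d"]) auto
    then show False using d(1) by (simp add: ball_eq_greaterThanLessThan)
  qed
  ultimately show ?thesis by simp
qed

text \<open>On the line N is \<open>N \<theta> / \<bar>s\<bar>\<close> and p is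
  \<open>\<bar>s\<bar> * p \<theta>\<close>. Since ds / |s| is invariant under scaling, substituting
  \<open>p \<theta> * s\<close> for s makes p disappear; only N remembers the direction.\<close>

lemma line_integral:
  assumes th: "norm \<theta> = 1"
  shows "(\<integral>a. N a * (E (p a) - E (2 * p a)) \<partial>span_lborel {\<theta>}) = N \<theta> * K0"
proof -
  have pth: "p \<theta> > 0" using p_ge[of \<theta>] c1 th by simp
  have eq: "N (s *\<^sub>R \<theta>) * (E (p (s *\<^sub>R \<theta>)) - E (2 * p (s *\<^sub>R \<theta>)))
    = N \<theta> * (p \<theta> * ((E \<bar>0 + p \<theta> * s\<bar> - E (2 * \<bar>0 + p \<theta> * s\<bar>)) / \<bar>0 + p \<theta> * s\<bar>))" for s
  proof (cases "s = 0")
    case False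
    have "N (s *\<^sub>R \<theta>) = N \<theta> / \<bar>s\<bar> \<and> p (s *\<^sub>R \<theta>) = \<bar>s\<bar> * p \<theta>"
    proof (cases "s > 0")
      case True
      then show ?thesis by (simp add: N_hom p_hom)
    next
      case False
      then have "- s > 0" using \<open>s \<noteq> 0\<close> by simp
      then have "N (- ((- s) *\<^sub>R \<theta>)) = N \<theta> / (- s) \<and> p (- ((- s) *\<^sub>R \<theta>)) = (- s) * p \<theta>"
        unfolding N_even p_even by (simp only: N_hom p_hom)
      then show ?thesis using False by simp
    qed
    then show ?thesis using pth False by (simp add: abs_mult mult_ac)
  qed (simp add: N_0)
  have "(\<integral>a. N a * (E (p a) - E (2 * p a)) \<partial>span_lborel {\<theta>}) = (\<integral>s. N (s *\<^sub>R \<theta>) * (E (p (s *\<^sub>R \<theta>)) - E (2 * p (s *\<^sub>R \<theta>))) \<partial>lborel)"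
    unfolding span_lborel_singleton by (subst integral_distr) auto
  also have "\<dots> = N \<theta> * (p \<theta> * (\<integral>s. (E \<bar>0 + p \<theta> * s\<bar> - E (2 * \<bar>0 + p \<theta> * s\<bar>)) / \<bar>0 + p \<theta> * s\<bar> \<partial>lborel))"
    unfolding eq by (simp only: integral_mult_right_zero)
  also have "p \<theta> * (\<integral>s. (E \<bar>0 + p \<theta> * s\<bar> - E (2 * \<bar>0 + p \<theta> * s\<bar>)) / \<bar>0 + p \<theta> * s\<bar> \<partial>lborel) = K0"
    using lborel_integral_real_affine[of "p \<theta>" "\<lambda>s. (E \<bar>s\<bar> - E (2 * \<bar>s\<bar>)) / \<bar>s\<bar>" 0] pth
    by (simp add: K0_def)
  finally show ?thesis .
qed

text \<open>The factor r in \<open>E_diff\<close> cancels the singularity of N at the origin.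
  Without the difference of two dampings, 1 / \<parallel>z\<parallel> would not be integrable on a
  line.\<close>

lemma NE_diff_bound: "\<bar>N z * (E (p z) - E (2 * p z))\<bar> \<le> CN * CE * c2 * exp (- (c1 * norm z))"
proof (cases "z = 0")
  case False
  have "0 \<le> E (p z) - E (2 * p z)" "E (p z) - E (2 * p z) \<le> CE * p z * exp (- p z)"
    using E_diff[OF p_nonneg[of z]] E_mono[OF p_nonneg[of z]] by auto
  moreover have "CE * p z * exp (- p z) \<le> CE * (c2 * norm z) * exp (- (c1 * norm z))"
    using CE_nonneg c2_nonneg p_le[of z] p_ge[of z] p_nonneg[of z] by (intro mult_mono) auto
  ultimately have "N z * (E (p z) - E (2 * p z)) \<le> (CN / norm z) * (CE * (c2 * norm z) * exp (- (c1 * norm z)))"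
    using N_le[of z] CN_nonneg by (intro mult_mono) auto
  also have "\<dots> = CN * CE * c2 * exp (- (c1 * norm z))" using False by simp
  finally show ?thesis using N_nonneg[of z] \<open>0 \<le> E (p z) - E (2 * p z)\<close> by (simp add: abs_mult)
qed (use CN_nonneg CE_nonneg c2_nonneg in \<open>simp add: N_0\<close>)

text \<open>By \<open>T_diff\<close> the Gaussians concentrate on the line through x, where
  \<open>line_integral\<close> gives the value; \<open>norm x * N x\<close> is N in the direction of
  x. The first claim is uniform in \<tau> and x and serves as the majorant when \<tau> \<rightarrow>
  0.\<close>

lemma T_limit:
  assumes x: "x \<in> span B" "x \<noteq> 0"
  shows "\<tau> > 0 \<Longrightarrow> \<bar>T \<tau> 1 x - T \<tau> 2 x\<bar> \<le> sqrt (2 * pi) ^ (card B - 1) * (\<integral>s. CN * CE * c2 * exp (- (c1 * \<bar>s\<bar>)) \<partial>lborel)"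
    and "(\<And>n. t n > 0) \<Longrightarrow> t \<longlonglongrightarrow> 0 \<Longrightarrow>
      (\<lambda>n. T (t n) 1 x - T (t n) 2 x) \<longlonglongrightarrow> sqrt (2 * pi) ^ (card B - 1) * (norm x * N x * K0)"
proof -
  define \<theta> where "\<theta> = x /\<^sub>R norm x"
  have th: "\<theta> \<in> span B" "norm \<theta> = 1" using x by (auto simp: \<theta>_def span_scale)
  obtain A where A: "orthonormal_set (insert \<theta> A)" "\<theta> \<notin> A" "span (insert \<theta> A) = span B" "card B = Suc (card A)"
    using orthonormal_set_split[OF B th] by metis
  have fin: "finite A" using A(1) by (auto dest: orthonormal_set_finite)
  have eq: "span_lborel B = span_lborel ({\<theta>} \<union> A)"
    using span_lborel_cong_span[OF B A(1)] A(3) by simp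
  define f where "f = (\<lambda>z. N z * (E (p z) - E (2 * p z)))"
  define g where "g = (\<lambda>z::'a. CN * CE * c2 * exp (- (c1 * norm z)))"
  have o: "orthonormal_set ({\<theta>} \<union> A)" "{\<theta>} \<inter> A = {}" using A by auto
  have [measurable]: "f \<in> borel_measurable borel" by (simp add: f_def)
  have gi: "integrable (span_lborel {\<theta>}) g" "(\<integral>a. g a \<partial>span_lborel {\<theta>}) = (\<integral>s. CN * CE * c2 * exp (- (c1 * \<bar>s\<bar>)) \<partial>lborel)"
    unfolding span_lborel_singleton g_def using th(2) integrable_mult_right[OF integrable_exp_neg_abs[OF c1], of "CN * CE * c2"]
    by (auto simp: integrable_distr_eq integral_distr)
  have "\<bar>f (a + b)\<bar> \<le> g a" if ab: "a \<in> span {\<theta>}" "b \<in> span A" for a b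
  proof -
    have "a \<bullet> b = 0" using inner_span_orthogonal[OF o ab] .
    then have "norm a \<le> norm (a + b)" by (rule norm_le_norm_add_orthogonal)
    then have "CN * CE * c2 * exp (- (c1 * norm (a + b))) \<le> g a"
      unfolding g_def using c1 CN_nonneg CE_nonneg c2_nonneg by (intro mult_left_mono) auto
    then show "\<bar>f (a + b)\<bar> \<le> g a" using NE_diff_bound[of "a + b"] unfolding f_def by linarith
  qed
  then have fg: "AE a in span_lborel {\<theta>}. \<forall>b\<in>span A. \<bar>f (a + b)\<bar> \<le> g a"
    by (intro eventually_mono[OF AE_span_lborel]) auto
  have cont: "AE a in span_lborel {\<theta>}. isCont f a"
  proof -
    have "AE a in span_lborel {\<theta>}. a \<noteq> 0"
      by (rule AE_span_lborel_neq_0) (use th in \<open>auto simp: orthonormal_set_def\<close>)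
    then show ?thesis
    proof eventually_elim
      case (elim a)
      have Ec: "isCont E r" for r using E_cont by (simp add: continuous_on_eq_continuous_at)
      have pc: "isCont p a" using p_cont by (simp add: continuous_on_eq_continuous_at)
      show ?case unfolding f_def
        by (intro continuous_intros N_cont elim isCont_o2[OF pc Ec] isCont_o2[OF _ Ec, of _ "\<lambda>z. 2 * p z"] pc)
    qed
  qed
  have sum: "(norm y)\<^sup>2 - (y \<bullet> \<theta>)\<^sup>2 = (\<Sum>c\<in>A. (y \<bullet> c)\<^sup>2)" if "y \<in> span B" for y
    using inner_orthonormal_sum[OF A(1), of y] that A fin by simp
  have TT: "T \<tau> 1 x - T \<tau> 2 x = (\<integral>y. f y * exp (- (\<Sum>c\<in>A. (y \<bullet> c)\<^sup>2) / (2 * \<tau>\<^sup>2)) \<partial>span_lborel ({\<theta>} \<union> A)) / \<tau> ^ card A" if "\<tau> > 0" for \<tau>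
  proof -
    have "T \<tau> 1 x - T \<tau> 2 x = (\<integral>y. f y * exp (- ((norm y)\<^sup>2 - (y \<bullet> \<theta>)\<^sup>2) / (2 * \<tau>\<^sup>2)) \<partial>span_lborel B) / \<tau> ^ card A"
      unfolding T_diff[OF that x] f_def \<theta>_def using A(4) by simp
    also have "(\<integral>y. f y * exp (- ((norm y)\<^sup>2 - (y \<bullet> \<theta>)\<^sup>2) / (2 * \<tau>\<^sup>2)) \<partial>span_lborel B)
      = (\<integral>y. f y * exp (- (\<Sum>c\<in>A. (y \<bullet> c)\<^sup>2) / (2 * \<tau>\<^sup>2)) \<partial>span_lborel B)"
    proof (rule integral_cong_AE)
      show "AE y in span_lborel B. f y * exp (- ((norm y)\<^sup>2 - (y \<bullet> \<theta>)\<^sup>2) / (2 * \<tau>\<^sup>2)) = f y * exp (- (\<Sum>c\<in>A. (y \<bullet> c)\<^sup>2) / (2 * \<tau>\<^sup>2))"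
        using AE_span_lborel by eventually_elim (simp only: sum)
    qed simp_all
    finally show ?thesis by (simp add: eq)
  qed
  show "\<bar>T \<tau> 1 x - T \<tau> 2 x\<bar> \<le> sqrt (2 * pi) ^ (card B - 1) * (\<integral>s. CN * CE * c2 * exp (- (c1 * \<bar>s\<bar>)) \<partial>lborel)" if "\<tau> > 0"
    unfolding TT[OF that] using gaussian_concentration_bound[OF o _ gi(1) fg that] gi(2) A(4) by simp
  have "N \<theta> = norm x * N x"
    using N_hom[of "inverse (norm x)" x] x by (simp add: \<theta>_def divide_inverse mult.commute)
  then show "(\<lambda>n. T (t n) 1 x - T (t n) 2 x) \<longlonglongrightarrow> sqrt (2 * pi) ^ (card B - 1) * (norm x * N x * K0)"
    if "\<And>n. t n > 0" "t \<longlonglongrightarrow> 0"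
    using gaussian_concentration[OF o _ gi(1) fg cont that] line_integral[OF th(2)] A(4) TT[OF that(1)]
    by (simp add: f_def)
qed


text \<open>Since x \<bullet> \<xi> is \<parallel>\<xi>\<parallel> times x \<bullet> \<theta>, the
  smoothed delta function is a Gaussian of width \<open>e / norm \<xi>\<close> across the hyperplane
  orthogonal to \<xi>, up to the factor 1 / \<parallel>\<xi>\<parallel>. The limit is a positive
  multiple of the section integral of G, but only its existence and sign are recorded, as nothing
  else is used.\<close>

lemma section_average:
  fixes G :: "'a \<Rightarrow> real"
  assumes G [measurable]: "G \<in> borel_measurable borel" and G_bd: "\<And>x. \<bar>G x\<bar> \<le> CG * indicator (cball 0 R) x" and R: "R \<ge> 0"
    and \<xi>: "\<xi> \<in> span B" "\<xi> \<noteq> 0"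
  shows "e > 0 \<Longrightarrow> \<bar>\<integral>x. G x * exp (- (x \<bullet> \<xi>)\<^sup>2 / (2 * e\<^sup>2)) / e \<partial>span_lborel B\<bar> \<le> sqrt (2 * pi) * (CG * (2 * R) ^ (card B - 1)) / norm \<xi>"
    and "(\<And>n. e' n > 0) \<Longrightarrow> e' \<longlonglongrightarrow> 0 \<Longrightarrow>
      (\<And>A. orthonormal_set A \<Longrightarrow> card A = card B - 1 \<Longrightarrow> span A \<subseteq> span B \<Longrightarrow> 0 \<le> (\<integral>x. G x \<partial>span_lborel A) \<and> (AE x in span_lborel A. isCont G x)) \<Longrightarrow>
      \<exists>l\<ge>0. (\<lambda>n. \<integral>x. G x * exp (- (x \<bullet> \<xi>)\<^sup>2 / (2 * (e' n)\<^sup>2)) / e' n \<partial>span_lborel B) \<longlonglongrightarrow> l"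
proof -
  define \<theta> where "\<theta> = \<xi> /\<^sub>R norm \<xi>"
  have th: "\<theta> \<in> span B" "norm \<theta> = 1" using \<xi> by (auto simp: \<theta>_def span_scale)
  obtain A where A: "orthonormal_set (insert \<theta> A)" "\<theta> \<notin> A" "span (insert \<theta> A) = span B" "card B = Suc (card A)"
    using orthonormal_set_split[OF B th] by metis
  have fin: "finite A" using A(1) by (auto dest: orthonormal_set_finite)
  have oA: "orthonormal_set A" using A(1) by (rule orthonormal_set_subset) auto
  have spA: "span A \<subseteq> span B" unfolding A(3)[symmetric] by (intro span_mono) auto
  have eq: "span_lborel B = span_lborel (A \<union> {\<theta>})"
    using span_lborel_cong_span[OF B A(1)] A(3) by simp
  have o: "orthonormal_set (A \<union> {\<theta>})" "A \<inter> {\<theta>} = {}" using A by auto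
  have CG: "CG \<ge> 0" using G_bd[of 0] R by simp
  define g where "g = (\<lambda>a::'a. CG * indicator (cball 0 R) a)"
  have fin_cball: "emeasure (span_lborel A) (cball 0 R) < \<infinity>"
    using emeasure_span_lborel_cball[OF oA R] by (auto intro: le_less_trans)
  have gi: "integrable (span_lborel A) g"
    unfolding g_def using fin_cball by (intro integrable_mult_right integrable_real_indicator) auto
  have gint: "(\<integral>a. g a \<partial>span_lborel A) \<le> CG * (2 * R) ^ card A"
  proof -
    have "measure (span_lborel A) (cball 0 R) \<le> (2 * R) ^ card A"
      unfolding measure_def using emeasure_span_lborel_cball[OF oA R] R by (intro enn2real_leI) auto
    then show ?thesis unfolding g_def using CG fin_cball by (simp add: mult_left_mono)
  qed
  have "\<bar>G (a + b)\<bar> \<le> g a" if ab: "a \<in> span A" "b \<in> span {\<theta>}" for a b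
  proof -
    have "a \<bullet> b = 0" using inner_span_orthogonal[OF o ab] .
    then have "norm a \<le> norm (a + b)" by (rule norm_le_norm_add_orthogonal)
    then have "CG * indicator (cball 0 R) (a + b) \<le> g a"
      unfolding g_def using CG by (intro mult_left_mono) (auto simp: indicator_def)
    then show "\<bar>G (a + b)\<bar> \<le> g a" using G_bd[of "a + b"] by linarith
  qed
  then have fg: "AE a in span_lborel A. \<forall>b\<in>span {\<theta>}. \<bar>G (a + b)\<bar> \<le> g a"
    by (intro eventually_mono[OF AE_span_lborel]) auto
  have xth: "\<xi> = norm \<xi> *\<^sub>R \<theta>" using \<xi> by (simp add: \<theta>_def)
  have inner: "x \<bullet> \<xi> = norm \<xi> * (x \<bullet> \<theta>)" for x by (subst xth) simp
  have conv: "(\<integral>x. G x * exp (- (x \<bullet> \<xi>)\<^sup>2 / (2 * e\<^sup>2)) / e \<partial>span_lborel B)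
    = (\<integral>x. G x * exp (- (\<Sum>c\<in>{\<theta>}. (x \<bullet> c)\<^sup>2) / (2 * (e / norm \<xi>)\<^sup>2)) \<partial>span_lborel (A \<union> {\<theta>})) / (e / norm \<xi>) ^ card {\<theta>} / norm \<xi>"
    if "e > 0" for e
  proof -
    have "exp (- (x \<bullet> \<xi>)\<^sup>2 / (2 * e\<^sup>2)) = exp (- (\<Sum>c\<in>{\<theta>}. (x \<bullet> c)\<^sup>2) / (2 * (e / norm \<xi>)\<^sup>2))" for x
      unfolding inner using \<xi> by (simp add: power_mult_distrib power_divide)
    then show ?thesis using \<xi> that by (simp add: eq)
  qed
  show "\<bar>\<integral>x. G x * exp (- (x \<bullet> \<xi>)\<^sup>2 / (2 * e\<^sup>2)) / e \<partial>span_lborel B\<bar> \<le> sqrt (2 * pi) * (CG * (2 * R) ^ (card B - 1)) / norm \<xi>" if "e > 0"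
  proof -
    have "\<bar>(\<integral>x. G x * exp (- (\<Sum>c\<in>{\<theta>}. (x \<bullet> c)\<^sup>2) / (2 * (e / norm \<xi>)\<^sup>2)) \<partial>span_lborel (A \<union> {\<theta>})) / (e / norm \<xi>) ^ card {\<theta>}\<bar>
      \<le> sqrt (2 * pi) ^ card {\<theta>} * (\<integral>a. g a \<partial>span_lborel A)"
      using \<xi> that by (intro gaussian_concentration_bound[OF o G gi fg]) simp
    also have "\<dots> \<le> sqrt (2 * pi) * (CG * (2 * R) ^ (card B - 1))"
      using gint A(4) by (simp add: mult_left_mono)
    finally have "\<bar>(\<integral>x. G x * exp (- (\<Sum>c\<in>{\<theta>}. (x \<bullet> c)\<^sup>2) / (2 * (e / norm \<xi>)\<^sup>2)) \<partial>span_lborel (A \<union> {\<theta>})) / (e / norm \<xi>) ^ card {\<theta>}\<bar> \<le> sqrt (2 * pi) * (CG * (2 * R) ^ (card B - 1))" .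
    from divide_right_mono[OF this, of "norm \<xi>"] show ?thesis
      unfolding conv[OF that] by (simp only: abs_divide abs_norm_cancel norm_ge_zero)
  qed
  show "\<exists>l\<ge>0. (\<lambda>n. \<integral>x. G x * exp (- (x \<bullet> \<xi>)\<^sup>2 / (2 * (e' n)\<^sup>2)) / e' n \<partial>span_lborel B) \<longlonglongrightarrow> l"
    if e': "\<And>n. e' n > 0" "e' \<longlonglongrightarrow> 0"
      and hyp: "\<And>A. orthonormal_set A \<Longrightarrow> card A = card B - 1 \<Longrightarrow> span A \<subseteq> span B \<Longrightarrow> 0 \<le> (\<integral>x. G x \<partial>span_lborel A) \<and> (AE x in span_lborel A. isCont G x)"
  proof -
    have h: "0 \<le> (\<integral>x. G x \<partial>span_lborel A)" "AE x in span_lborel A. isCont G x"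
      using hyp[OF oA _ spA] A(4) by auto
    have "(\<lambda>n. e' n / norm \<xi>) \<longlonglongrightarrow> 0 / norm \<xi>" using \<xi> by (intro tendsto_intros e') auto
    then have "(\<lambda>n. (\<integral>x. G x * exp (- (\<Sum>c\<in>{\<theta>}. (x \<bullet> c)\<^sup>2) / (2 * (e' n / norm \<xi>)\<^sup>2)) \<partial>span_lborel (A \<union> {\<theta>})) / (e' n / norm \<xi>) ^ card {\<theta>})
      \<longlonglongrightarrow> sqrt (2 * pi) ^ card {\<theta>} * (\<integral>a. G a \<partial>span_lborel A)"
      using \<xi> e' by (intro gaussian_concentration[OF o G gi fg h(2)]) auto
    then have "(\<lambda>n. \<integral>x. G x * exp (- (x \<bullet> \<xi>)\<^sup>2 / (2 * (e' n)\<^sup>2)) / e' n \<partial>span_lborel B)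
      \<longlonglongrightarrow> sqrt (2 * pi) ^ card {\<theta>} * (\<integral>a. G a \<partial>span_lborel A) / norm \<xi>"
      unfolding conv[OF e'(1)] using \<xi> by (intro tendsto_intros) auto
    moreover have "0 \<le> sqrt (2 * pi) ^ card {\<theta>} * (\<integral>a. G a \<partial>span_lborel A) / norm \<xi>" using h(1) by simp
    ultimately show ?thesis by blast
  qed
qed

end

section \<open>From hyperplane sections to the integral against the kernel\<close>

context intersection_kernel
begin

text \<open>One double integral over x and \<xi>, of G (x) times P \<tau> \<xi>, the difference of
  the two Gaussians and the smoothed delta function of x \<bullet> \<xi>, is evaluated twice.
  Integrating over x first gives section averages of G against the nonnegative weight
  \<open>P \<tau> \<xi> * D \<xi>\<close>; integrating over \<xi> first gives \<open>Lam\<close>,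
  hence \<open>T\<close> in the limit.\<close>

lemma kernel_difference_nonneg:
  fixes G :: "'a \<Rightarrow> real"
  assumes G [measurable]: "G \<in> borel_measurable borel" and G_bd: "\<And>x. \<bar>G x\<bar> \<le> CG * indicator (cball 0 R) x" and R: "R \<ge> 0"
    and hyp: "\<forall>A. orthonormal_set A \<and> card A = card B - 1 \<and> span A \<subseteq> span B \<longrightarrow> 0 \<le> (\<integral>x. G x \<partial>span_lborel A) \<and> (AE x in span_lborel A. isCont G x)"
    and \<tau>: "\<tau> > 0"
  shows "integrable (span_lborel B) (\<lambda>x. \<bar>G x\<bar> / norm x)"
    and "0 \<le> (\<integral>x. G x * ((T \<tau> 1 x - T \<tau> 2 x) / norm x) \<partial>span_lborel B)"
proof -
  let ?M = "span_lborel B"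
  interpret pair_sigma_finite ?M ?M
    using B B by (rule pair_sigma_finite_span_lborel)
  interpret sf: sigma_finite_measure ?M by (rule sigma_finite_span_lborel[OF B])
  have CG: "CG \<ge> 0" using G_bd[of 0] R by simp
  show Gi': "integrable ?M (\<lambda>x. \<bar>G x\<bar> / norm x)"
  proof (rule Bochner_Integration.integrable_bound)
    have "integrable ?M (\<lambda>x. exp (- norm x) / norm x)"
      using card_B by (intro integrable_exp_neg_homogeneous(2)[OF B, of _ 1]) auto
    then show "integrable ?M (\<lambda>x. (CG * exp R) * (exp (- norm x) / norm x))" by (rule integrable_mult_right)
    show "AE x in ?M. norm (\<bar>G x\<bar> / norm x) \<le> norm ((CG * exp R) * (exp (- norm x) / norm x))"
    proof (rule AE_I2)
      fix x :: 'a
      have "indicator (cball 0 R) x \<le> exp R * exp (- norm x)"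
        by (auto simp: indicator_def mult_exp_exp)
      then have "\<bar>G x\<bar> \<le> CG * (exp R * exp (- norm x))"
        using G_bd[of x] CG by (meson mult_left_mono order_trans)
      then have "\<bar>G x\<bar> / norm x \<le> CG * (exp R * exp (- norm x)) / norm x" by (rule divide_right_mono) simp
      then show "norm (\<bar>G x\<bar> / norm x) \<le> norm ((CG * exp R) * (exp (- norm x) / norm x))"
        using CG by (simp add: mult.assoc)
    qed
  qed simp
  have Gi: "integrable ?M G" by (rule integrable_bounded_support[OF B G R G_bd])
  define CP where "CP = (\<integral>x. N x * E (\<tau> * p x) \<partial>?M)"
  have P_le: "\<bar>P \<tau> \<xi>\<bar> \<le> CP" for \<xi> unfolding CP_def by (rule P_bound[OF \<tau>])
  have CP0: "CP \<ge> 0" using P_le[of 0] by simp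
  define gk where "gk = (\<lambda>k \<xi>::'a. exp (- (k\<^sup>2 * (norm \<xi>)\<^sup>2) / 2) :: real)"
  have gk_int: "integrable ?M (gk k)" if "k > 0" for k
    unfolding gk_def using integrable_gaussian_norm[OF B B_ne that] .
  have gk_pos: "gk k \<xi> > 0" for k \<xi> by (simp add: gk_def)
  have [measurable]: "gk k \<in> borel_measurable borel" for k by (simp add: gk_def)
  define D where "D = (\<lambda>\<xi>. gk 1 \<xi> - gk 2 \<xi>)"
  have D_int: "integrable ?M D" unfolding D_def using gk_int by simp
  have [measurable]: "D \<in> borel_measurable borel" by (simp add: D_def)
  have D0: "D \<xi> \<ge> 0" and D_le: "D \<xi> \<le> 3 / 2 * norm \<xi> * gk (1 / sqrt 2) \<xi>" for \<xi>
    using gaussian_difference_bounds[of "norm \<xi>"] by (auto simp: D_def gk_def)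
  define e where "e = (\<lambda>n. inverse (real (Suc n)))"
  have e0: "e n > 0" for n by (simp add: e_def)
  have elim: "e \<longlonglongrightarrow> 0" unfolding e_def by (rule LIMSEQ_inverse_real_of_nat)
  define K where "K = (\<lambda>n (x::'a) \<xi>. exp (- (x \<bullet> \<xi>)\<^sup>2 / (2 * (e n)\<^sup>2)) / e n)"
  have [measurable]: "(\<lambda>z. K n (fst z) (snd z)) \<in> borel_measurable (?M \<Otimes>\<^sub>M ?M)" for n
    unfolding K_def by measurable
  have [measurable]: "K n x \<in> borel_measurable borel" "(\<lambda>x. K n x \<xi>) \<in> borel_measurable borel" for n x \<xi>
    unfolding K_def by measurable
  have K0: "K n x \<xi> \<ge> 0" and K1: "K n x \<xi> \<le> 1 / e n" for n x \<xi>
    using e0[of n] by (auto simp: K_def divide_right_mono)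
  define Bn where "Bn = (\<lambda>n \<xi>. \<integral>x. G x * K n x \<xi> \<partial>?M)"
  have [measurable]: "Bn n \<in> borel_measurable borel" for n
    unfolding Bn_def K_def by measurable
  have Bn_eq: "Bn n \<xi> = (\<integral>x. G x * exp (- (x \<bullet> \<xi>)\<^sup>2 / (2 * (e n)\<^sup>2)) / e n \<partial>?M)" for n \<xi>
    by (simp add: Bn_def K_def)
  define Kc where "Kc = sqrt (2 * pi) * (CG * (2 * R) ^ (card B - 1))"
  have Kc0: "Kc \<ge> 0" using CG R by (simp add: Kc_def)
  define C where "C = CP * (3 / 2 * Kc)"
  have bound: "\<bar>P \<tau> \<xi> * D \<xi> * Bn n \<xi>\<bar> \<le> C * gk (1 / sqrt 2) \<xi>" if "\<xi> \<in> span B" "\<xi> \<noteq> 0" for n \<xi>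
  proof -
    have "\<bar>Bn n \<xi>\<bar> \<le> Kc / norm \<xi>"
      unfolding Bn_eq Kc_def by (rule section_average(1)[OF G G_bd R that e0])
    then have "\<bar>P \<tau> \<xi> * D \<xi> * Bn n \<xi>\<bar> \<le> CP * (3 / 2 * norm \<xi> * gk (1 / sqrt 2) \<xi>) * (Kc / norm \<xi>)"
      unfolding abs_mult using P_le[of \<xi>] D_le[of \<xi>] D0[of \<xi>] CP0 Kc0 less_imp_le[OF gk_pos]
      by (intro mult_mono) auto
    also have "\<dots> = C * gk (1 / sqrt 2) \<xi>" using that by (simp add: C_def)
    finally show ?thesis .
  qed
  have AEs: "AE \<xi> in ?M. \<xi> \<in> span B \<and> \<xi> \<noteq> 0"
    using AE_span_lborel[of B] AE_span_lborel_neq_0[OF B B_ne] by eventually_elim auto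
  have dom: "integrable ?M (\<lambda>\<xi>. C * gk (1 / sqrt 2) \<xi>)"
    by (intro integrable_mult_right gk_int) simp
  define I where "I = (\<lambda>n. \<integral>\<xi>. P \<tau> \<xi> * D \<xi> * Bn n \<xi> \<partial>?M)"
  have I_int: "integrable ?M (\<lambda>\<xi>. P \<tau> \<xi> * D \<xi> * Bn n \<xi>)" for n
  proof (rule Bochner_Integration.integrable_bound[OF dom])
    show "AE \<xi> in ?M. norm (P \<tau> \<xi> * D \<xi> * Bn n \<xi>) \<le> norm (C * gk (1 / sqrt 2) \<xi>)"
      using AEs
    proof eventually_elim
      case (elim \<xi>)
      then show ?case using bound[of \<xi> n] unfolding real_norm_def by linarith
    qed
  qed simp
  \<comment> \<open>Only a lower bound for the limit of \<open>I\<close> is wanted. The negative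
    parts tend to 0 pointwise whatever the values l are, so the dependence of l on \<xi>, in
    particular its measurability, never comes up.\<close>
  have min_lim: "(\<lambda>n. \<integral>\<xi>. min 0 (P \<tau> \<xi> * D \<xi> * Bn n \<xi>) \<partial>?M) \<longlonglongrightarrow> (\<integral>\<xi>. 0 \<partial>?M)"
  proof (rule integral_dominated_convergence[OF _ _ dom])
    show "AE \<xi> in ?M. norm (min 0 (P \<tau> \<xi> * D \<xi> * Bn n \<xi>)) \<le> C * gk (1 / sqrt 2) \<xi>" for n
      using AEs
    proof eventually_elim
      case (elim \<xi>)
      then show ?case using bound[of \<xi> n] unfolding real_norm_def by linarith
    qed
    show "AE \<xi> in ?M. (\<lambda>n. min 0 (P \<tau> \<xi> * D \<xi> * Bn n \<xi>)) \<longlonglongrightarrow> 0"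
      using AEs
    proof eventually_elim
      case (elim \<xi>)
      then obtain l where l: "l \<ge> 0" "(\<lambda>n. Bn n \<xi>) \<longlonglongrightarrow> l"
        using section_average(2)[OF G G_bd R, of \<xi> e] e0 \<open>e \<longlonglongrightarrow> 0\<close> hyp unfolding Bn_eq by blast
      have "(\<lambda>n. min 0 (P \<tau> \<xi> * D \<xi> * Bn n \<xi>)) \<longlonglongrightarrow> min 0 (P \<tau> \<xi> * D \<xi> * l)"
        by (intro tendsto_intros l)
      moreover have "P \<tau> \<xi> * D \<xi> * l \<ge> 0"
        using P_nonneg[OF \<tau>, of \<xi>] D0[of \<xi>] l elim by simp
      ultimately show ?case by simp
    qed
  qed simp_all
  have I_ge: "(\<integral>\<xi>. min 0 (P \<tau> \<xi> * D \<xi> * Bn n \<xi>) \<partial>?M) \<le> I n" for n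
    unfolding I_def using I_int[of n] by (intro integral_mono integrable_min) auto
  have I_eq: "I n = (\<integral>x. G x * (Lam \<tau> 1 (e n) x - Lam \<tau> 2 (e n) x) \<partial>?M)" for n
  proof -
    have prodi: "integrable (?M \<Otimes>\<^sub>M ?M) (\<lambda>z. G (fst z) * (CP * (1 / e n) * D (snd z)))"
      by (rule integrable_pair_mult[OF B B Gi]) (intro integrable_mult_right D_int)
    have prodi2: "integrable (?M \<Otimes>\<^sub>M ?M) (\<lambda>(x, \<xi>). G x * (P \<tau> \<xi> * D \<xi> * K n x \<xi>))"
    proof (rule Bochner_Integration.integrable_bound[OF prodi])
      have m: "(\<lambda>z. G (fst z) * (P \<tau> (snd z) * D (snd z) * K n (fst z) (snd z))) \<in> borel_measurable (?M \<Otimes>\<^sub>M ?M)"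
        by measurable
      then show "(\<lambda>(x, \<xi>). G x * (P \<tau> \<xi> * D \<xi> * K n x \<xi>)) \<in> borel_measurable (?M \<Otimes>\<^sub>M ?M)"
        by (simp add: case_prod_beta')
      show "AE z in ?M \<Otimes>\<^sub>M ?M. norm (case z of (x, \<xi>) \<Rightarrow> G x * (P \<tau> \<xi> * D \<xi> * K n x \<xi>)) \<le> norm (G (fst z) * (CP * (1 / e n) * D (snd z)))"
      proof (rule AE_I2)
        fix z :: "'a \<times> 'a"
        obtain x \<xi> where z: "z = (x, \<xi>)" by (cases z)
        have "\<bar>P \<tau> \<xi>\<bar> * D \<xi> * K n x \<xi> \<le> CP * D \<xi> * (1 / e n)"
          using P_le[of \<xi>] D0[of \<xi>] K0[of n x \<xi>] K1[of n x \<xi>] CP0 by (intro mult_mono) auto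
        then have "\<bar>G x\<bar> * (\<bar>P \<tau> \<xi>\<bar> * D \<xi> * K n x \<xi>) \<le> \<bar>G x\<bar> * (CP * D \<xi> * (1 / e n))"
          by (rule mult_left_mono) simp
        then show "norm (case z of (x, \<xi>) \<Rightarrow> G x * (P \<tau> \<xi> * D \<xi> * K n x \<xi>)) \<le> norm (G (fst z) * (CP * (1 / e n) * D (snd z)))"
          using D0[of \<xi>] K0[of n x \<xi>] CP0 less_imp_le[OF e0[of n]] by (simp add: z abs_mult mult_ac)
      qed
    qed
    have "I n = (\<integral>\<xi>. \<integral>x. G x * (P \<tau> \<xi> * D \<xi> * K n x \<xi>) \<partial>?M \<partial>?M)"
    proof -
      have "P \<tau> \<xi> * D \<xi> * Bn n \<xi> = (\<integral>x. G x * (P \<tau> \<xi> * D \<xi> * K n x \<xi>) \<partial>?M)" for \<xi>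
        unfolding Bn_def by (subst integral_mult_right_zero[symmetric]) (simp add: mult_ac)
      then show ?thesis unfolding I_def by simp
    qed
    also have "\<dots> = (\<integral>x. \<integral>\<xi>. G x * (P \<tau> \<xi> * D \<xi> * K n x \<xi>) \<partial>?M \<partial>?M)"
      by (rule Fubini_integral[OF prodi2])
    also have "\<dots> = (\<integral>x. G x * (Lam \<tau> 1 (e n) x - Lam \<tau> 2 (e n) x) \<partial>?M)"
    proof (rule integral_cong_AE)
      show "AE x in ?M. (\<integral>\<xi>. G x * (P \<tau> \<xi> * D \<xi> * K n x \<xi>) \<partial>?M) = G x * (Lam \<tau> 1 (e n) x - Lam \<tau> 2 (e n) x)"
        using AEs
      proof eventually_elim
        case (elim x)
        have i: "integrable ?M (\<lambda>\<xi>. P \<tau> \<xi> * gk k \<xi> * K n x \<xi>)" if "k > 0" for k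
        proof (rule Bochner_Integration.integrable_bound[OF integrable_mult_right[OF gk_int[OF that], of "CP * (1 / e n)"]])
          show "AE \<xi> in ?M. norm (P \<tau> \<xi> * gk k \<xi> * K n x \<xi>) \<le> norm (CP * (1 / e n) * gk k \<xi>)"
          proof (rule AE_I2)
            fix \<xi>
            have "\<bar>P \<tau> \<xi>\<bar> * gk k \<xi> * K n x \<xi> \<le> CP * gk k \<xi> * (1 / e n)"
              using P_le[of \<xi>] gk_pos[of k \<xi>] K0[of n x \<xi>] K1[of n x \<xi>] CP0 by (intro mult_mono) auto
            then show "norm (P \<tau> \<xi> * gk k \<xi> * K n x \<xi>) \<le> norm (CP * (1 / e n) * gk k \<xi>)"
              using gk_pos[of k \<xi>] K0[of n x \<xi>] CP0 less_imp_le[OF e0[of n]] by (simp add: abs_mult mult_ac)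
          qed
        qed simp
        have L: "(\<integral>\<xi>. P \<tau> \<xi> * gk k \<xi> * K n x \<xi> \<partial>?M) = Lam \<tau> k (e n) x" if "k > 0" for k
          using Lam_eq[OF \<tau> that e0[of n], of x] elim by (simp add: gk_def K_def)
        have "(\<integral>\<xi>. G x * (P \<tau> \<xi> * D \<xi> * K n x \<xi>) \<partial>?M) = G x * (\<integral>\<xi>. P \<tau> \<xi> * gk 1 \<xi> * K n x \<xi> - P \<tau> \<xi> * gk 2 \<xi> * K n x \<xi> \<partial>?M)"
          by (subst integral_mult_right_zero[symmetric]) (simp add: D_def algebra_simps)
        also have "\<dots> = G x * (Lam \<tau> 1 (e n) x - Lam \<tau> 2 (e n) x)"
          using i[of 1] i[of 2] L[of 1] L[of 2] by simp
        finally show ?case .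
      qed
    qed (auto simp: Lam_def K_def)
    finally show ?thesis .
  qed
  have "(\<lambda>n. \<integral>x. G x * (Lam \<tau> 1 (e n) x - Lam \<tau> 2 (e n) x) \<partial>?M)
    \<longlonglongrightarrow> (\<integral>x. sqrt (2 * pi) ^ card B * (G x * ((T \<tau> 1 x - T \<tau> 2 x) / norm x)) \<partial>?M)"
  proof (rule integral_dominated_convergence)
    define C2 where "C2 = sqrt (2 * pi) ^ card B * ((\<integral>z. N z * E (1 * \<tau> * p z) \<partial>?M) + (\<integral>z. N z * E (2 * \<tau> * p z) \<partial>?M))"
    show "integrable ?M (\<lambda>x. C2 * (\<bar>G x\<bar> / norm x))" using Gi' by (rule integrable_mult_right)
    show "AE x in ?M. norm (G x * (Lam \<tau> 1 (e n) x - Lam \<tau> 2 (e n) x)) \<le> C2 * (\<bar>G x\<bar> / norm x)" for n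
      using AEs
    proof eventually_elim
      case (elim x)
      have "\<bar>Lam \<tau> 1 (e n) x - Lam \<tau> 2 (e n) x\<bar> \<le> \<bar>Lam \<tau> 1 (e n) x\<bar> + \<bar>Lam \<tau> 2 (e n) x\<bar>" by simp
      also have "\<dots> \<le> C2 / norm x"
        using Lam_bound[OF \<tau>, of 1 x "e n"] Lam_bound[OF \<tau>, of 2 x "e n"] elim
        by (simp add: C2_def add_divide_distrib distrib_left)
      finally have "\<bar>G x\<bar> * \<bar>Lam \<tau> 1 (e n) x - Lam \<tau> 2 (e n) x\<bar> \<le> \<bar>G x\<bar> * (C2 / norm x)" by (rule mult_left_mono) simp
      then show ?case by (simp add: abs_mult mult.commute)
    qed
    show "AE x in ?M. (\<lambda>n. G x * (Lam \<tau> 1 (e n) x - Lam \<tau> 2 (e n) x)) \<longlonglongrightarrow> sqrt (2 * pi) ^ card B * (G x * ((T \<tau> 1 x - T \<tau> 2 x) / norm x))"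
      using AEs
    proof eventually_elim
      case (elim x)
      then have "(\<lambda>n. G x * (Lam \<tau> 1 (e n) x - Lam \<tau> 2 (e n) x)) \<longlonglongrightarrow> G x * (sqrt (2 * pi) ^ card B / norm x * T \<tau> 1 x - sqrt (2 * pi) ^ card B / norm x * T \<tau> 2 x)"
        by (intro tendsto_intros Lam_tendsto \<tau> \<open>e \<longlonglongrightarrow> 0\<close>) auto
      moreover have "G x * (sqrt (2 * pi) ^ card B / norm x * T \<tau> 1 x - sqrt (2 * pi) ^ card B / norm x * T \<tau> 2 x) = sqrt (2 * pi) ^ card B * (G x * ((T \<tau> 1 x - T \<tau> 2 x) / norm x))"
        by (simp add: diff_divide_distrib algebra_simps)
      ultimately show ?case by metis
    qed
  qed (auto simp: Lam_def T_def)
  then have lim: "I \<longlonglongrightarrow> sqrt (2 * pi) ^ card B * (\<integral>x. G x * ((T \<tau> 1 x - T \<tau> 2 x) / norm x) \<partial>?M)"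
    unfolding I_eq by (simp only: integral_mult_right_zero)
  have "(0::real) \<le> sqrt (2 * pi) ^ card B * (\<integral>x. G x * ((T \<tau> 1 x - T \<tau> 2 x) / norm x) \<partial>?M)"
    using LIMSEQ_le[OF min_lim lim] I_ge by simp
  moreover have "sqrt (2 * pi) ^ card B > 0" by simp
  ultimately show "0 \<le> (\<integral>x. G x * ((T \<tau> 1 x - T \<tau> 2 x) / norm x) \<partial>?M)"
    by (metis zero_le_mult_iff not_less)
qed

text \<open>The damping is removed: as \<tau> \<rightarrow> 0 the quotient
  \<open>(T \<tau> 1 x - T \<tau> 2 x) / norm x\<close> tends to a positive multiple of
  \<open>N x\<close>, and \<open>T_limit\<close> supplies a multiple of
  \<open>\<bar>G x\<bar> / norm x\<close> as majorant.\<close>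

theorem integral_kernel_nonneg:
  fixes G :: "'a \<Rightarrow> real"
  assumes G [measurable]: "G \<in> borel_measurable borel" and G_bd: "\<And>x. \<bar>G x\<bar> \<le> CG * indicator (cball 0 R) x" and R: "R \<ge> 0"
    and hyp: "\<forall>A. orthonormal_set A \<and> card A = card B - 1 \<and> span A \<subseteq> span B \<longrightarrow> 0 \<le> (\<integral>x. G x \<partial>span_lborel A) \<and> (AE x in span_lborel A. isCont G x)"
  shows "0 \<le> (\<integral>x. G x * N x \<partial>span_lborel B)"
proof -
  let ?M = "span_lborel B"
  interpret sf: sigma_finite_measure ?M by (rule sigma_finite_span_lborel[OF B])
  note kd = kernel_difference_nonneg[OF G G_bd R hyp]
  define t where "t = (\<lambda>n. inverse (real (Suc n)))"
  have t0: "t n > 0" for n by (simp add: t_def)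
  have tlim: "t \<longlonglongrightarrow> 0" unfolding t_def by (rule LIMSEQ_inverse_real_of_nat)
  have AEs: "AE \<xi> in ?M. \<xi> \<in> span B \<and> \<xi> \<noteq> 0"
    using AE_span_lborel[of B] AE_span_lborel_neq_0[OF B B_ne] by eventually_elim auto
  have Gi': "integrable ?M (\<lambda>x. \<bar>G x\<bar> / norm x)" using kd(1)[of 1] by simp
  have "(\<lambda>n. \<integral>x. G x * ((T (t n) 1 x - T (t n) 2 x) / norm x) \<partial>?M)
    \<longlonglongrightarrow> (\<integral>x. (sqrt (2 * pi) ^ (card B - 1) * K0) * (G x * N x) \<partial>?M)"
  proof (rule integral_dominated_convergence)
    define C where "C = sqrt (2 * pi) ^ (card B - 1) * (\<integral>s. CN * CE * c2 * exp (- (c1 * \<bar>s\<bar>)) \<partial>lborel)"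
    show "integrable ?M (\<lambda>x. C * (\<bar>G x\<bar> / norm x))" using Gi' by (rule integrable_mult_right)
    show "AE x in ?M. norm (G x * ((T (t n) 1 x - T (t n) 2 x) / norm x)) \<le> C * (\<bar>G x\<bar> / norm x)" for n
      using AEs
    proof eventually_elim
      case (elim x)
      then have "\<bar>T (t n) 1 x - T (t n) 2 x\<bar> \<le> C"
        unfolding C_def using T_limit(1)[of x "t n"] t0[of n] by blast
      then have "(\<bar>G x\<bar> / norm x) * \<bar>T (t n) 1 x - T (t n) 2 x\<bar> \<le> (\<bar>G x\<bar> / norm x) * C"
        by (rule mult_left_mono) simp
      then show ?case by (simp add: abs_mult mult.commute)
    qed
    show "AE x in ?M. (\<lambda>n. G x * ((T (t n) 1 x - T (t n) 2 x) / norm x)) \<longlonglongrightarrow> (sqrt (2 * pi) ^ (card B - 1) * K0) * (G x * N x)"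
      using AEs
    proof eventually_elim
      case (elim x)
      then have "(\<lambda>n. T (t n) 1 x - T (t n) 2 x) \<longlonglongrightarrow> sqrt (2 * pi) ^ (card B - 1) * (norm x * N x * K0)"
        using T_limit(2)[of x t] t0 tlim by blast
      then have "(\<lambda>n. G x * ((T (t n) 1 x - T (t n) 2 x) / norm x)) \<longlonglongrightarrow> G x * (sqrt (2 * pi) ^ (card B - 1) * (norm x * N x * K0) / norm x)"
        using elim by (intro tendsto_intros) auto
      moreover have "G x * (sqrt (2 * pi) ^ (card B - 1) * (norm x * N x * K0) / norm x) = (sqrt (2 * pi) ^ (card B - 1) * K0) * (G x * N x)"
        using elim by simp
      ultimately show ?case by metis
    qed
  qed (auto simp: T_def)
  then have "(0::real) \<le> (\<integral>x. (sqrt (2 * pi) ^ (card B - 1) * K0) * (G x * N x) \<partial>?M)"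
    by (rule LIMSEQ_le_const) (use kd(2)[OF t0] in auto)
  then have "0 \<le> (sqrt (2 * pi) ^ (card B - 1) * K0) * (\<integral>x. G x * N x \<partial>?M)" by (simp only: integral_mult_right_zero)
  moreover have "sqrt (2 * pi) ^ (card B - 1) * K0 > 0" using K0_pos by simp
  ultimately show ?thesis by (metis zero_le_mult_iff not_less)
qed

end

subsection \<open>Log-concavity of marginals\<close>

text \<open>The multiplicative form admits functions with zeros, such as indicators of convex sets:
  \<open>0 powr t = 0\<close> makes the inequality trivial wherever one of the two values
  vanishes.\<close>

definition log_concave :: "('a::real_vector \<Rightarrow> real) \<Rightarrow> bool" where
  "log_concave f \<longleftrightarrow> (\<forall>x. 0 \<le> f x) \<and>
     (\<forall>x y t. 0 < t \<longrightarrow> t < 1 \<longrightarrow> f x powr (1 - t) * f y powr t \<le> f ((1 - t) *\<^sub>R x + t *\<^sub>R y))"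

lemma powr_mean_gt:
  fixes a b c t :: real
  assumes "0 \<le> c" "c < a" "c < b" "0 < t" "t < 1"
  shows "c < a powr (1 - t) * b powr t"
proof -
  define m where "m = min a b"
  have m: "c < m" "0 < m" using assms by (auto simp: m_def)
  have "m = m powr (1 - t) * m powr t" using m by (simp flip: powr_add)
  also have "\<dots> \<le> a powr (1 - t) * b powr t"
    using assms m by (intro mult_mono powr_mono2) (auto simp: m_def)
  finally show ?thesis using m by simp
qed

lemma log_concave_convex_superlevel:
  assumes f: "log_concave f" and c: "0 \<le> c"
  shows "convex {x. c < f x}"
  unfolding convex_alt
proof (intro ballI allI impI)
  fix x y and t :: real
  assume xy: "x \<in> {x. c < f x}" "y \<in> {x. c < f x}" and t: "0 \<le> t \<and> t \<le> 1"
  show "(1 - t) *\<^sub>R x + t *\<^sub>R y \<in> {x. c < f x}"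
  proof (cases "t = 0 \<or> t = 1")
    case False
    then have t': "0 < t" "t < 1" using t by auto
    have "c < f x powr (1 - t) * f y powr t"
      using xy c t' by (intro powr_mean_gt) auto
    also have "\<dots> \<le> f ((1 - t) *\<^sub>R x + t *\<^sub>R y)" using f t' by (auto simp: log_concave_def)
    finally show ?thesis by simp
  qed (use xy in auto)
qed

text \<open>Brunn-Minkowski on the line. A and B fit into the closed intervals between their infima
  and suprema, and C contains the open interval between the combined end points, so the lengths add
  up as claimed.\<close>

lemma convex_combination_emeasure:
  fixes A B C :: "real set"
  assumes A: "convex A" "A \<noteq> {}" "bounded A" and B: "convex B" "B \<noteq> {}" "bounded B"
    and C: "C \<in> sets lborel" and t: "0 < t" "t < 1"
    and sub: "\<And>a b. a \<in> A \<Longrightarrow> b \<in> B \<Longrightarrow> (1 - t) * a + t * b \<in> C"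
  shows "ennreal (1 - t) * emeasure lborel A + ennreal t * emeasure lborel B \<le> emeasure lborel C"
proof -
  have bd: "bdd_below A" "bdd_above A" "bdd_below B" "bdd_above B"
    using A B by (auto intro: bounded_imp_bdd_below bounded_imp_bdd_above)
  define a1 a2 b1 b2 where "a1 = Inf A" "a2 = Sup A" "b1 = Inf B" "b2 = Sup B"
  note d = this
  have le: "a1 \<le> a2" "b1 \<le> b2" unfolding d using A B bd by (auto intro!: cInf_le_cSup)
  have "A \<subseteq> {a1..a2}" "B \<subseteq> {b1..b2}" unfolding d using bd by (auto intro: cInf_lower cSup_upper)
  then have "emeasure lborel A \<le> emeasure lborel {a1..a2}" "emeasure lborel B \<le> emeasure lborel {b1..b2}"
    by (auto intro!: emeasure_mono)
  then have AB: "emeasure lborel A \<le> ennreal (a2 - a1)" "emeasure lborel B \<le> ennreal (b2 - b1)" using le by auto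
  have "{(1 - t) * a1 + t * b1 <..< (1 - t) * a2 + t * b2} \<subseteq> C"
  proof
    fix c assume c: "c \<in> {(1 - t) * a1 + t * b1 <..< (1 - t) * a2 + t * b2}"
    define e where "e = c - ((1 - t) * a1 + t * b1)"
    have e: "e > 0" using c by (simp add: e_def)
    obtain x1 where x1: "x1 \<in> A" "x1 < a1 + e" using cInf_less_iff[of A "a1 + e"] A bd e by (auto simp: d)
    obtain y1 where y1: "y1 \<in> B" "y1 < b1 + e" using cInf_less_iff[of B "b1 + e"] B bd e by (auto simp: d)
    define f where "f = ((1 - t) * a2 + t * b2) - c"
    have f: "f > 0" using c by (simp add: f_def)
    obtain x2 where x2: "x2 \<in> A" "a2 - f < x2" using less_cSup_iff[of A "a2 - f"] A bd f by (auto simp: d)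
    obtain y2 where y2: "y2 \<in> B" "b2 - f < y2" using less_cSup_iff[of B "b2 - f"] B bd f by (auto simp: d)
    define l where "l = (1 - t) * x1 + t * y1"
    define u where "u = (1 - t) * x2 + t * y2"
    have "l < (1 - t) * (a1 + e) + t * (b1 + e)"
      unfolding l_def using x1 y1 t by (intro add_strict_mono mult_strict_left_mono) auto
    also have "\<dots> = c" by (simp add: e_def algebra_simps)
    finally have lc: "l < c" .
    have "c = (1 - t) * (a2 - f) + t * (b2 - f)" by (simp add: f_def algebra_simps)
    also have "\<dots> < u"
      unfolding u_def using x2 y2 t by (intro add_strict_mono mult_strict_left_mono) auto
    finally have cu: "c < u" .
    \<comment> \<open>The point c lies between l and u, which combine points of A and B near the
      lower and the upper ends. Moving from x1 to x2 and from y1 to y2 with the same parameter s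
      stays inside A and B and reaches c.\<close>
    define s where "s = (c - l) / (u - l)"
    have s: "0 \<le> s" "s \<le> 1" using lc cu by (auto simp: s_def)
    have cs: "c = (1 - s) * l + s * u"
    proof -
      have "s * (u - l) = c - l" using lc cu by (simp add: s_def)
      then show ?thesis by (simp add: algebra_simps)
    qed
    have "(1 - s) *\<^sub>R x1 + s *\<^sub>R x2 \<in> A" "(1 - s) *\<^sub>R y1 + s *\<^sub>R y2 \<in> B"
      using A(1) B(1) x1 x2 y1 y2 s by (auto simp: convex_alt)
    then have "(1 - t) * ((1 - s) * x1 + s * x2) + t * ((1 - s) * y1 + s * y2) \<in> C"
      using sub by simp
    also have "(1 - t) * ((1 - s) * x1 + s * x2) + t * ((1 - s) * y1 + s * y2) = c"
      unfolding cs l_def u_def by (simp add: algebra_simps)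
    finally show "c \<in> C" .
  qed
  then have "emeasure lborel {(1 - t) * a1 + t * b1 <..< (1 - t) * a2 + t * b2} \<le> emeasure lborel C"
    using C by (intro emeasure_mono) auto
  moreover have "(1 - t) * a1 + t * b1 \<le> (1 - t) * a2 + t * b2"
    using le t by (intro add_mono mult_left_mono) auto
  ultimately have "ennreal ((1 - t) * (a2 - a1) + t * (b2 - b1)) \<le> emeasure lborel C"
    by (simp add: algebra_simps)
  moreover have "ennreal (1 - t) * emeasure lborel A + ennreal t * emeasure lborel B \<le> ennreal (1 - t) * ennreal (a2 - a1) + ennreal t * ennreal (b2 - b1)"
    using AB by (intro add_mono mult_left_mono) auto
  moreover have "\<dots> = ennreal ((1 - t) * (a2 - a1) + t * (b2 - b1))"
    using le t by (simp add: ennreal_mult ennreal_plus)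
  ultimately show ?thesis by simp
qed

text \<open>The layer-cake formula with levels measured in units of m. If f \<le> m the right-hand
  side is the integral of f / m; the minimum with 1 accounts for a function exceeding m, such as h
  in the next lemma, and can then simply be dropped in an upper estimate.\<close>

lemma nn_integral_superlevel:
  fixes f :: "real \<Rightarrow> real"
  assumes [measurable]: "f \<in> borel_measurable borel" and f: "\<And>x. 0 \<le> f x" and m: "m > 0"
  shows "(\<integral>\<^sup>+ s. indicator {0<..<1} s * emeasure lborel {x. s * m < f x} \<partial>lborel) = (\<integral>\<^sup>+ x. ennreal (min 1 (f x / m)) \<partial>lborel)"
proof -
  have ind: "(indicator {x. s * m < f x} x :: ennreal) = indicator {z. snd z * m < f (fst z)} (x, s)" for s x
    by (auto simp: indicator_def)
  have [measurable]: "{z. snd z * m < f (fst z)} \<in> sets ((lborel :: real measure) \<Otimes>\<^sub>M (lborel :: real measure))"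
  proof -
    have "{z \<in> space ((lborel :: real measure) \<Otimes>\<^sub>M (lborel :: real measure)). snd z * m < f (fst z)} \<in> sets (lborel \<Otimes>\<^sub>M lborel)"
      by measurable
    then show ?thesis by (simp add: space_pair_measure)
  qed
  have "(\<integral>\<^sup>+ s. indicator {0<..<1} s * emeasure lborel {x. s * m < f x} \<partial>lborel)
    = (\<integral>\<^sup>+ s. \<integral>\<^sup>+ x. indicator {0<..<1} s * indicator {x. s * m < f x} x \<partial>lborel \<partial>lborel)"
    by (subst nn_integral_cmult) (auto simp del: nn_integral_indicator intro!: nn_integral_cong simp: nn_integral_indicator[symmetric])
  also have "\<dots> = (\<integral>\<^sup>+ x. \<integral>\<^sup>+ s. indicator {0<..<1} s * indicator {x. s * m < f x} x \<partial>lborel \<partial>lborel)"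
    unfolding ind by (rule lborel_pair.Fubini') measurable
  also have "\<dots> = (\<integral>\<^sup>+ x. ennreal (min 1 (f x / m)) \<partial>lborel)"
  proof (rule nn_integral_cong)
    fix x
    have "(\<integral>\<^sup>+ s. indicator {0<..<1} s * indicator {x. s * m < f x} x \<partial>lborel) = (\<integral>\<^sup>+ s. indicator {0<..<min 1 (f x / m)} s \<partial>lborel)"
      using m by (intro nn_integral_cong) (auto simp: indicator_def field_simps)
    also have "\<dots> = ennreal (min 1 (f x / m))" using f[of x] m by simp
    finally show "(\<integral>\<^sup>+ s. indicator {0<..<1} s * indicator {x. s * m < f x} x \<partial>lborel) = ennreal (min 1 (f x / m))" .
  qed
  finally show ?thesis .
qed

text \<open>One-dimensional Prekopa--Leindler inequality; since the superlevel sets are assumed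
  convex, the Brunn--Minkowski step on the line only concerns intervals.\<close>

lemma prekopa_leindler_real:
  fixes f g h :: "real \<Rightarrow> real"
  assumes [measurable]: "f \<in> borel_measurable borel" "g \<in> borel_measurable borel" "h \<in> borel_measurable borel"
    and f0: "\<And>x. 0 \<le> f x" and g0: "\<And>x. 0 \<le> g x" and h0: "\<And>x. 0 \<le> h x"
    and fC: "\<And>x. f x \<le> C" and gC: "\<And>x. g x \<le> C"
    and int: "integrable lborel f" "integrable lborel g" "integrable lborel h"
    and conv: "\<And>c. 0 \<le> c \<Longrightarrow> convex {x. c < f x}" "\<And>c. 0 \<le> c \<Longrightarrow> convex {x. c < g x}"
    and supp: "\<And>x. f x \<noteq> 0 \<Longrightarrow> \<bar>x\<bar> \<le> R" "\<And>x. g x \<noteq> 0 \<Longrightarrow> \<bar>x\<bar> \<le> R"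
    and t: "0 < t" "t < 1"
    and fgh: "\<And>x y. f x powr (1 - t) * g y powr t \<le> h ((1 - t) * x + t * y)"
  shows "(\<integral>x. f x \<partial>lborel) powr (1 - t) * (\<integral>x. g x \<partial>lborel) powr t \<le> (\<integral>x. h x \<partial>lborel)"
proof (cases "(\<integral>x. f x \<partial>lborel) = 0 \<or> (\<integral>x. g x \<partial>lborel) = 0")
  case True
  then show ?thesis using h0 by (auto intro!: Bochner_Integration.integral_nonneg)
next
  case False
  \<comment> \<open>Measuring levels relative to the suprema makes both superlevel sets nonempty for
    each s in (0, 1), as the Brunn-Minkowski step requires. The mean of the suprema with exponents 1
    - t and t is the matching unit for h.\<close>
  define mf mg where "mf = Sup (range f)" "mg = Sup (range g)"
  note d = this
  have bdd: "bdd_above (range f)" "bdd_above (range g)" using fC gC by (auto simp: bdd_above_def)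
  have fm: "f x \<le> mf" "g x \<le> mg" for x unfolding d using bdd by (auto intro!: cSup_upper)
  have mpos: "mf > 0" "mg > 0"
  proof -
    have *: "\<exists>x. \<phi> x \<noteq> 0" if "(\<integral>x. \<phi> x \<partial>lborel) \<noteq> 0" for \<phi> :: "real \<Rightarrow> real"
    proof (rule ccontr)
      assume "\<nexists>x. \<phi> x \<noteq> 0"
      then have "\<phi> = (\<lambda>_. 0)" by auto
      then show False using that by simp
    qed
    have "\<exists>x. f x \<noteq> 0" "\<exists>x. g x \<noteq> 0" using False *[of f] *[of g] by auto
    then show "mf > 0" "mg > 0" using fm f0 g0 by (metis order_le_less less_le_trans)+
  qed
  define mh where "mh = mf powr (1 - t) * mg powr t"
  have mh: "mh > 0" using mpos by (simp add: mh_def)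
  have key: "ennreal (1 - t) * emeasure lborel {x. s * mf < f x} + ennreal t * emeasure lborel {x. s * mg < g x} \<le> emeasure lborel {x. s * mh < h x}"
    if s: "0 < s" "s < 1" for s
  proof (rule convex_combination_emeasure[OF _ _ _ _ _ _ _ t])
    have s0: "s * mf < mf" "s * mg < mg" "0 \<le> s * mf" "0 \<le> s * mg" using s mpos by auto
    show "convex {x. s * mf < f x}" "convex {x. s * mg < g x}" using conv s0 by auto
    show "{x. s * mf < f x} \<noteq> {}" using s0 less_cSup_iff[OF _ bdd(1), of "s * mf"] unfolding d by auto
    show "{x. s * mg < g x} \<noteq> {}" using s0 less_cSup_iff[OF _ bdd(2), of "s * mg"] unfolding d by auto
    have "\<bar>x\<bar> \<le> R" if "s * mf < f x" for x using supp(1)[of x] s0 that by fastforce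
    moreover have "\<bar>x\<bar> \<le> R" if "s * mg < g x" for x using supp(2)[of x] s0 that by fastforce
    ultimately have "{x. s * mf < f x} \<subseteq> {-R..R}" "{x. s * mg < g x} \<subseteq> {-R..R}"
      by (auto simp: abs_le_iff minus_le_iff)
    then show "bounded {x. s * mf < f x}" "bounded {x. s * mg < g x}"
      by (meson bounded_closed_interval bounded_subset)+
    show "{x. s * mh < h x} \<in> sets lborel" by measurable
    fix a b assume ab: "a \<in> {x. s * mf < f x}" "b \<in> {x. s * mg < g x}"
    have "s = s powr (1 - t) * s powr t" using s by (simp flip: powr_add)
    then have "s * mh = (s * mf) powr (1 - t) * (s * mg) powr t"
      using s mpos by (simp add: mh_def powr_mult mult_ac)
    also have "\<dots> < f a powr (1 - t) * g b powr t"
    proof -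
      have "0 < f a" "0 < g b" using ab s0 by auto
      then show ?thesis using ab s mpos t by (intro mult_strict_mono powr_less_mono2) auto
    qed
    also have "\<dots> \<le> h ((1 - t) * a + t * b)" by (rule fgh)
    finally show "(1 - t) * a + t * b \<in> {x. s * mh < h x}" by simp
  qed
  have meas: "(\<lambda>s. emeasure lborel {x. s * m < \<phi> x}) \<in> borel_measurable lborel"
    if [measurable]: "\<phi> \<in> borel_measurable borel" for m and \<phi> :: "real \<Rightarrow> real"
  proof -
    have "(\<lambda>s. emeasure lborel (Pair s -` {z. fst z * m < \<phi> (snd z)})) \<in> borel_measurable lborel"
    proof (rule lborel.measurable_emeasure_Pair)
      have "{z \<in> space ((lborel :: real measure) \<Otimes>\<^sub>M (lborel :: real measure)). fst z * m < \<phi> (snd z)} \<in> sets (lborel \<Otimes>\<^sub>M lborel)"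
        by measurable
      then show "{z. fst z * m < \<phi> (snd z)} \<in> sets ((lborel :: real measure) \<Otimes>\<^sub>M (lborel :: real measure))"
        by (simp add: space_pair_measure)
    qed
    then show ?thesis by (simp add: vimage_def)
  qed
  have eqm: "(\<integral>\<^sup>+ x. ennreal (min 1 (\<phi> x / m)) \<partial>lborel) = ennreal ((\<integral>x. \<phi> x \<partial>lborel) / m)"
    if "\<And>x. \<phi> x \<le> m" "\<And>x. 0 \<le> \<phi> x" "m > 0" "integrable lborel \<phi>" for \<phi> :: "real \<Rightarrow> real" and m
  proof -
    have "min 1 (\<phi> x / m) = \<phi> x / m" for x using that(1)[of x] that(3) by (simp add: min_absorb2)
    then show ?thesis
      using that by (simp add: nn_integral_eq_integral)
  qed
  have "ennreal (1 - t) * ennreal ((\<integral>x. f x \<partial>lborel) / mf) + ennreal t * ennreal ((\<integral>x. g x \<partial>lborel) / mg)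
    = ennreal (1 - t) * (\<integral>\<^sup>+ s. indicator {0<..<1} s * emeasure lborel {x. s * mf < f x} \<partial>lborel) + ennreal t * (\<integral>\<^sup>+ s. indicator {0<..<1} s * emeasure lborel {x. s * mg < g x} \<partial>lborel)"
    using nn_integral_superlevel[OF _ f0 mpos(1)] nn_integral_superlevel[OF _ g0 mpos(2)]
      eqm[OF fm(1) f0 mpos(1) int(1)] eqm[OF fm(2) g0 mpos(2) int(2)] by simp
  also have "\<dots> = (\<integral>\<^sup>+ s. ennreal (1 - t) * (indicator {0<..<1} s * emeasure lborel {x. s * mf < f x}) + ennreal t * (indicator {0<..<1} s * emeasure lborel {x. s * mg < g x}) \<partial>lborel)"
    using meas[of f mf] meas[of g mg] by (subst nn_integral_add) (auto simp: nn_integral_cmult)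
  also have "\<dots> \<le> (\<integral>\<^sup>+ s. indicator {0<..<1} s * emeasure lborel {x. s * mh < h x} \<partial>lborel)"
    by (intro nn_integral_mono) (auto simp: indicator_def key)
  also have "\<dots> = (\<integral>\<^sup>+ x. ennreal (min 1 (h x / mh)) \<partial>lborel)"
    using mh h0 by (simp add: nn_integral_superlevel)
  also have "\<dots> \<le> (\<integral>\<^sup>+ x. ennreal (h x / mh) \<partial>lborel)"
    by (intro nn_integral_mono ennreal_leI) auto
  also have "\<dots> = ennreal ((\<integral>x. h x \<partial>lborel) / mh)"
    using int h0 mh by (subst nn_integral_eq_integral) auto
  finally have main': "ennreal (1 - t) * ennreal ((\<integral>x. f x \<partial>lborel) / mf) + ennreal t * ennreal ((\<integral>x. g x \<partial>lborel) / mg) \<le> ennreal ((\<integral>x. h x \<partial>lborel) / mh)" .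
  have comb: "ennreal ((1 - t) * a + t * b) = ennreal (1 - t) * ennreal a + ennreal t * ennreal b" if "0 \<le> a" "0 \<le> b" for a b
    using t that by (simp add: ennreal_mult ennreal_plus)
  have main: "ennreal ((1 - t) * ((\<integral>x. f x \<partial>lborel) / mf) + t * ((\<integral>x. g x \<partial>lborel) / mg)) \<le> ennreal ((\<integral>x. h x \<partial>lborel) / mh)"
    using main' comb[of "(\<integral>x. f x \<partial>lborel) / mf" "(\<integral>x. g x \<partial>lborel) / mg"] mpos f0 g0 by (simp add: Bochner_Integration.integral_nonneg)
  have hI: "0 \<le> (\<integral>x. h x \<partial>lborel)" "0 \<le> (\<integral>x. f x \<partial>lborel)" "0 \<le> (\<integral>x. g x \<partial>lborel)"
    using h0 f0 g0 by (auto intro!: Bochner_Integration.integral_nonneg)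
  \<comment> \<open>The level sets give an additive inequality for the normalised integrals; the
    weighted arithmetic-geometric mean inequality turns it into the multiplicative one.\<close>
  have "((\<integral>x. f x \<partial>lborel) / mf) powr (1 - t) * ((\<integral>x. g x \<partial>lborel) / mg) powr t
     \<le> (1 - t) * ((\<integral>x. f x \<partial>lborel) / mf) + t * ((\<integral>x. g x \<partial>lborel) / mg)"
    using Youngs_inequality_0[of "1 - t" t "(\<integral>x. f x \<partial>lborel) / mf" "(\<integral>x. g x \<partial>lborel) / mg"] t hI mpos False by auto
  also have "\<dots> \<le> (\<integral>x. h x \<partial>lborel) / mh"
    using main hI mh by (subst (asm) ennreal_le_iff) auto
  finally show ?thesis
    using mpos hI mh by (simp add: powr_divide mh_def field_simps)
qed

text \<open>Prekopa-Leindler on the lines in direction e through x, y and their convex combination.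
  The marginal is kept as a function on the whole space, constant along e, so that no quotient space
  is needed. On each line f lives on an interval of length 2 |R|, whence the bound.\<close>

lemma log_concave_marginal:
  fixes f :: "'a::euclidean_space \<Rightarrow> real"
  assumes [measurable]: "f \<in> borel_measurable borel" and f: "log_concave f" and fC: "\<And>x. f x \<le> C"
    and e: "norm e = 1" and supp: "\<And>x. f x \<noteq> 0 \<Longrightarrow> \<bar>x \<bullet> e\<bar> \<le> R"
  shows "log_concave (\<lambda>w. \<integral>s. f (w + s *\<^sub>R e) \<partial>lborel)"
    and "(\<integral>s. f (w + s *\<^sub>R e) \<partial>lborel) \<le> C * (2 * \<bar>R\<bar>)"
    and "integrable lborel (\<lambda>s. f (w + s *\<^sub>R e))"
proof -
  have f0: "0 \<le> f x" for x using f by (auto simp: log_concave_def)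
  have C0: "C \<ge> 0" using f0[of 0] fC[of 0] by simp
  have sup: "- (w \<bullet> e) - \<bar>R\<bar> \<le> s \<and> s \<le> - (w \<bullet> e) + \<bar>R\<bar>" if "f (w + s *\<^sub>R e) \<noteq> 0" for w s
    using supp[OF that] e by (simp add: inner_add_left dot_square_norm abs_le_iff)
  have le: "f (w + s *\<^sub>R e) \<le> C * indicator {- (w \<bullet> e) - \<bar>R\<bar> .. - (w \<bullet> e) + \<bar>R\<bar>} s" for w s
    using sup[of w s] fC[of "w + s *\<^sub>R e"] by (cases "f (w + s *\<^sub>R e) = 0") (auto simp: indicator_def C0)
  have ii: "integrable lborel (\<lambda>s. C * indicator {- (w \<bullet> e) - \<bar>R\<bar> .. - (w \<bullet> e) + \<bar>R\<bar>} s :: real)" for w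
    by (intro integrable_mult_right integrable_real_indicator) auto
  show i: "integrable lborel (\<lambda>s. f (w + s *\<^sub>R e))" for w
    by (rule Bochner_Integration.integrable_bound[OF ii]) (use le f0 C0 in \<open>auto intro!: AE_I2\<close>)
  have "(\<integral>s. f (w + s *\<^sub>R e) \<partial>lborel) \<le> (\<integral>s. C * indicator {- (w \<bullet> e) - \<bar>R\<bar> .. - (w \<bullet> e) + \<bar>R\<bar>} s \<partial>lborel)"
    by (intro integral_mono i ii le)
  then show "(\<integral>s. f (w + s *\<^sub>R e) \<partial>lborel) \<le> C * (2 * \<bar>R\<bar>)" by simp
  show "log_concave (\<lambda>w. \<integral>s. f (w + s *\<^sub>R e) \<partial>lborel)"
    unfolding log_concave_def
  proof (intro conjI allI impI)
    show "0 \<le> (\<integral>s. f (w + s *\<^sub>R e) \<partial>lborel)" for w by (intro Bochner_Integration.integral_nonneg f0)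
    fix x y and t :: real assume t: "0 < t" "t < 1"
    have conv: "convex {s. c < f (w + s *\<^sub>R e)}" if "0 \<le> c" for c w
    proof -
      have "{s. c < f (w + s *\<^sub>R e)} = (\<lambda>s. s *\<^sub>R e) -` ((+) (- w) ` {x. c < f x})"
        by (auto simp: image_iff algebra_simps intro!: exI[of _ "w + _ *\<^sub>R e"])
      moreover have "convex ((+) (- w) ` {x. c < f x})"
        by (rule convex_translation[OF log_concave_convex_superlevel[OF f that]])
      moreover have "linear (\<lambda>s. s *\<^sub>R e)" by (simp add: linear_iff scaleR_add_left)
      ultimately show ?thesis by (simp add: convex_linear_vimage)
    qed
    \<comment> \<open>The slice through x is supported in an interval centred at - (x \<bullet> e),
      and similarly for y; the radius passed to Prekopa-Leindler covers both shifted
      intervals.\<close>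
    show "(\<integral>s. f (x + s *\<^sub>R e) \<partial>lborel) powr (1 - t) * (\<integral>s. f (y + s *\<^sub>R e) \<partial>lborel) powr t
      \<le> (\<integral>s. f ((1 - t) *\<^sub>R x + t *\<^sub>R y + s *\<^sub>R e) \<partial>lborel)"
    proof (rule prekopa_leindler_real[where C=C and R="\<bar>R\<bar> + \<bar>x \<bullet> e\<bar> + \<bar>y \<bullet> e\<bar>"])
      show "\<bar>s\<bar> \<le> \<bar>R\<bar> + \<bar>x \<bullet> e\<bar> + \<bar>y \<bullet> e\<bar>" if "f (x + s *\<^sub>R e) \<noteq> 0" for s
        using sup[OF that] by linarith
      show "\<bar>s\<bar> \<le> \<bar>R\<bar> + \<bar>x \<bullet> e\<bar> + \<bar>y \<bullet> e\<bar>" if "f (y + s *\<^sub>R e) \<noteq> 0" for s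
        using sup[OF that] by linarith
      fix s s'
      have "f (x + s *\<^sub>R e) powr (1 - t) * f (y + s' *\<^sub>R e) powr t \<le> f ((1 - t) *\<^sub>R (x + s *\<^sub>R e) + t *\<^sub>R (y + s' *\<^sub>R e))"
        using f t unfolding log_concave_def by blast
      also have "(1 - t) *\<^sub>R (x + s *\<^sub>R e) + t *\<^sub>R (y + s' *\<^sub>R e) = (1 - t) *\<^sub>R x + t *\<^sub>R y + ((1 - t) * s + t * s') *\<^sub>R e"
        by (simp add: algebra_simps)
      finally show "f (x + s *\<^sub>R e) powr (1 - t) * f (y + s' *\<^sub>R e) powr t \<le> f ((1 - t) *\<^sub>R x + t *\<^sub>R y + ((1 - t) * s + t * s') *\<^sub>R e)" .
    qed (use conv f0 fC i t in auto)
  qed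
qed

text \<open>One basis vector is integrated out at a time. The support is controlled in each
  direction of A separately because a marginal is constant along the directions already removed and
  so need not have bounded support.\<close>

lemma log_concave_span_marginal:
  fixes f :: "'a::euclidean_space \<Rightarrow> real"
  assumes A: "orthonormal_set A" and f_meas: "f \<in> borel_measurable borel" and f: "log_concave f" and fC: "\<And>x. f x \<le> C"
    and supp: "\<And>x b. f x \<noteq> 0 \<Longrightarrow> b \<in> A \<Longrightarrow> \<bar>x \<bullet> b\<bar> \<le> R"
  shows "log_concave (\<lambda>w. \<integral>h. f (w + h) \<partial>span_lborel A)"
proof -
  have "finite A" using A by auto
  then show ?thesis using assms
  proof (induction A arbitrary: f C rule: finite_induct)
    case empty
    have "(\<integral>h. f (w + h) \<partial>span_lborel {}) = f w" for w
    proof -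
      have "(\<integral>h. f (w + h) \<partial>span_lborel {}) = enn2real (\<integral>\<^sup>+ h. ennreal (f (w + h)) \<partial>span_lborel {})"
        using empty by (intro integral_eq_nn_integral) (auto simp: log_concave_def)
      also have "\<dots> = f w" using empty by (subst nn_integral_span_lborel_empty) (auto simp: log_concave_def)
      finally show ?thesis .
    qed
    then show ?case using empty by simp
  next
    case (insert b A)
    note o = orthonormal_set_insertD[OF insert.prems(1) insert.hyps(2)]
    note [measurable] = insert.prems(2)
    have f0: "0 \<le> f x" for x using insert.prems(3) by (auto simp: log_concave_def)
    have C0: "C \<ge> 0" using f0[of 0] insert.prems(4)[of 0] by simp
    define f' where "f' = (\<lambda>w. \<integral>s. f (w + s *\<^sub>R b) \<partial>lborel)"
    note m = log_concave_marginal[OF insert.prems(2,3,4) o(2), of R]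
    have sb: "\<bar>x \<bullet> b\<bar> \<le> R" if "f x \<noteq> 0" for x using insert.prems(5)[OF that] by simp
    have [measurable]: "f' \<in> borel_measurable borel" unfolding f'_def by measurable
    have IH: "log_concave (\<lambda>w. \<integral>h. f' (w + h) \<partial>span_lborel A)"
    proof (rule insert.IH[OF o(1), of _ "C * (2 * \<bar>R\<bar>)"])
      show "log_concave f'" "f' x \<le> C * (2 * \<bar>R\<bar>)" for x
        unfolding f'_def using m(1,2)[OF sb] by auto
      fix x c assume xc: "f' x \<noteq> 0" "c \<in> A"
      then obtain s where s: "f (x + s *\<^sub>R b) \<noteq> 0" unfolding f'_def
        by (metis (mono_tags, lifting) Bochner_Integration.integral_cong integral_zero)
      have "b \<bullet> c = 0" using o(3)[of c] xc by (simp add: span_base inner_commute)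
      then show "\<bar>x \<bullet> c\<bar> \<le> R" using insert.prems(5)[OF s, of c] xc by (simp add: inner_add_left)
    qed simp
    have "(\<integral>h. f (w + h) \<partial>span_lborel (insert b A)) = (\<integral>h. f' (w + h) \<partial>span_lborel A)" for w
    proof -
      interpret A: sigma_finite_measure "span_lborel A" by (rule sigma_finite_span_lborel[OF o(1)])
      interpret pair_sigma_finite "span_lborel A" "lborel :: real measure" ..
      have "(\<integral>h. f (w + h) \<partial>span_lborel (insert b A)) = enn2real (\<integral>\<^sup>+ h. ennreal (f (w + h)) \<partial>span_lborel (insert b A))"
        using f0 by (intro integral_eq_nn_integral) auto
      also have "(\<integral>\<^sup>+ h. ennreal (f (w + h)) \<partial>span_lborel (insert b A)) = (\<integral>\<^sup>+ s. \<integral>\<^sup>+ h. ennreal (f (w + (h + s *\<^sub>R b))) \<partial>span_lborel A \<partial>lborel)"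
        using insert.hyps by (subst nn_integral_span_lborel_insert) auto
      also have "\<dots> = (\<integral>\<^sup>+ h. \<integral>\<^sup>+ s. ennreal (f (w + (h + s *\<^sub>R b))) \<partial>lborel \<partial>span_lborel A)"
        by (rule Fubini') simp
      also have "\<dots> = (\<integral>\<^sup>+ h. ennreal (f' (w + h)) \<partial>span_lborel A)"
        unfolding f'_def using m(3)[OF sb] f0 by (intro nn_integral_cong) (simp add: nn_integral_eq_integral add.assoc[symmetric])
      also have "enn2real \<dots> = (\<integral>h. f' (w + h) \<partial>span_lborel A)"
        using f0 by (intro integral_eq_nn_integral[symmetric]) (auto simp: f'_def intro!: Bochner_Integration.integral_nonneg)
      finally show ?thesis .
    qed
    then show ?case using IH by simp
  qed
qed

subsection \<open>Positive definiteness of the kernel of a convex body\<close>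

text \<open>A form of Brunn's theorem. The indicator of a convex set is log-concave, hence so is the
  volume of the parallel sections; by symmetry it is even, and an even log-concave function
  decreases along rays because s w lies between w and - w.\<close>

lemma section_function_antimono:
  fixes K :: "'a::euclidean_space set"
  assumes A: "orthonormal_set A" and K: "compact K" "convex K" "\<And>x. x \<in> K \<Longrightarrow> - x \<in> K"
  defines "F \<equiv> \<lambda>w. \<integral>h. (indicator K (w + h) :: real) \<partial>span_lborel A"
  shows "F (- w) = F w" and "0 \<le> s \<Longrightarrow> s \<le> 1 \<Longrightarrow> F w \<le> F (s *\<^sub>R w)" and "F w \<ge> 0"
proof -
  have [measurable]: "K \<in> sets borel" using K(1) by (simp add: borel_compact)
  obtain r where r: "\<And>x. x \<in> K \<Longrightarrow> norm x \<le> r"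
    using K(1) compact_imp_bounded bounded_iff by metis
  have Ksym: "- x \<in> K \<longleftrightarrow> x \<in> K" for x using K(3)[of x] K(3)[of "- x"] by auto
  have lc: "log_concave (indicator K :: 'a \<Rightarrow> real)"
    unfolding log_concave_def
  proof (intro conjI allI impI)
    fix x y and t :: real assume "0 < t" "t < 1"
    then have "x \<in> K \<Longrightarrow> y \<in> K \<Longrightarrow> (1 - t) *\<^sub>R x + t *\<^sub>R y \<in> K"
      using K(2) by (auto simp: convex_alt)
    then show "indicator K x powr (1 - t) * indicator K y powr t \<le> (indicator K ((1 - t) *\<^sub>R x + t *\<^sub>R y) :: real)"
      by (auto simp: indicator_def)
  qed simp
  have lcF: "log_concave F"
    unfolding F_def
  proof (rule log_concave_span_marginal[OF A _ lc, of 1 r])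
    fix x b assume xb: "(indicator K x :: real) \<noteq> 0" "b \<in> A"
    then have "x \<in> K" by (auto simp: indicator_def split: if_splits)
    moreover have "norm b = 1" using A xb by (simp add: orthonormal_set_def)
    ultimately show "\<bar>x \<bullet> b\<bar> \<le> r" using Cauchy_Schwarz_ineq2[of x b] r[of x] by simp
  qed (auto simp: indicator_def)
  show F0: "F w \<ge> 0" for w using lcF by (simp add: log_concave_def)
  show ev: "F (- w) = F w" for w
  proof -
    have "F (- w) = (\<integral>h. indicator K (- w + (- 1) *\<^sub>R h) \<partial>span_lborel A)"
      unfolding F_def by (subst integral_span_lborel_scale[OF A, of "- 1"]) auto
    also have "(\<lambda>h. indicator K (- w + (- 1) *\<^sub>R h)) = (\<lambda>h. indicator K (w + h) :: real)"
    proof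
      fix h show "indicator K (- w + (- 1) *\<^sub>R h) = (indicator K (w + h) :: real)"
        using Ksym[of "w + h"] by (simp add: indicator_def)
    qed
    finally show ?thesis by (simp add: F_def)
  qed
  show "F w \<le> F (s *\<^sub>R w)" if s: "0 \<le> s" "s \<le> 1"
  proof (cases "s = 1")
    case False
    \<comment> \<open>The solution of (1 - t) w + t (- w) = s w.\<close>
    define t where "t = (1 - s) / 2"
    have t: "0 < t" "t < 1" using s False by (auto simp: t_def)
    have "F w = F w powr (1 - t) * F (- w) powr t"
      unfolding ev using F0[of w] by (cases "F w = 0") (auto simp flip: powr_add)
    also have "\<dots> \<le> F ((1 - t) *\<^sub>R w + t *\<^sub>R (- w))" using lcF t unfolding log_concave_def by blast
    also have "(1 - t) *\<^sub>R w + t *\<^sub>R (- w) = (1 - 2 * t) *\<^sub>R w" by (simp add: algebra_simps flip: scaleR_add_left)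
    also have "1 - 2 * t = s" by (simp add: t_def field_simps)
    finally show ?thesis .
  qed simp
qed

section \<open>Cosine transforms of power-exponential weights\<close>

lemma complex_Gamma_integral:
  fixes z :: complex
  assumes z: "Re z > 0"
  shows "set_integrable lborel {0<..} (\<lambda>t. of_real t ^ k * exp (- (z * of_real t)))"
    and "(LBINT t:{0<..}. of_real t ^ k * exp (- (z * of_real t))) = fact k / z ^ Suc k"
proof -
  have z0: "z \<noteq> 0" using z by auto
  define f where "f = (\<lambda>k (t::real). (of_real t) ^ k * exp (- (z * of_real t)))"
  have fi: "set_integrable lborel {0<..} (f k)" for k
  proof -
    have "integrable lborel (\<lambda>t. ((Re z * t) ^ k * exp (- (Re z * t)) * indicator {0<..} (Re z * t)) :: real)"
    proof -
      from lborel_integrable_real_affine[OF integrable_power_exp[of k], of "Re z" 0] show ?thesis using z by simp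
    qed
    then have i: "integrable lborel (\<lambda>t. (1 / Re z ^ k) * ((Re z * t) ^ k * exp (- (Re z * t)) * indicator {0<..} (Re z * t)))"
      by (rule integrable_mult_right)
    show ?thesis
      unfolding set_integrable_def
    proof (rule Bochner_Integration.integrable_bound[OF i])
      show "(\<lambda>t. indicator {0<..} t *\<^sub>R f k t) \<in> borel_measurable lborel" by (simp add: f_def)
      show "AE t in lborel. norm (indicator {0<..} t *\<^sub>R f k t) \<le> norm ((1 / Re z ^ k) * ((Re z * t) ^ k * exp (- (Re z * t)) * indicator {0<..} (Re z * t)))"
        using z by (intro AE_I2) (auto simp: f_def indicator_def norm_mult norm_power power_mult_distrib zero_less_mult_iff)
    qed
  qed
  have lim0: "((\<lambda>t. f k t) \<longlongrightarrow> 0) at_top" for k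
  proof (rule Lim_null_comparison)
    show "\<forall>\<^sub>F t in at_top. norm (f k t) \<le> t ^ k * exp (- (Re z * t))"
      using eventually_ge_at_top[of 0] by eventually_elim (simp add: f_def norm_mult norm_power)
    show "((\<lambda>t. t ^ k * exp (- (Re z * t))) \<longlongrightarrow> 0) at_top" using z by real_asymp
  qed
  \<comment> \<open>Integration by parts, stated as a derivative: its boundary terms vanish except
    for k = 0, which gives the recursion between exponents k and k - 1. For k = 0 the truncated k -
    1 is harmless because its coefficient is 0.\<close>
  have der: "((\<lambda>t. - (f k t) / z) has_vector_derivative (f k t - of_nat k / z * f (k - 1) t)) (at t)" for k t
  proof -
    have "((\<lambda>w. - (w ^ k * exp (- (z * w))) / z) has_field_derivative (w ^ k * exp (- (z * w)) - of_nat k / z * (w ^ (k - 1) * exp (- (z * w))))) (at w)" for w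
      using z0 by (auto intro!: derivative_eq_intros simp: field_simps)
    from has_vector_derivative_real_field[OF this[of "of_real t"]] show ?thesis by (simp add: f_def)
  qed
  have step: "(LBINT t:{0<..}. f k t - of_nat k / z * f (k - 1) t) = (if k = 0 then 1 / z else 0)" for k
  proof -
    have si: "set_integrable lborel {0<..} (\<lambda>t. f k t - of_nat k / z * f (k - 1) t)"
      using fi[of k] fi[of "k - 1"] by (intro set_integral_diff set_integrable_mult_right) auto
    have "(LBINT t=0..\<infinity>. f k t - of_nat k / z * f (k - 1) t) = 0 - (if k = 0 then - 1 / z else 0)"
    proof (rule interval_integral_FTC_integrable[where F="\<lambda>t. - (f k t) / z"])
      show "((\<lambda>t. - (f k t) / z) has_vector_derivative f k t - of_nat k / z * f (k - 1) t) (at t)" for t by (rule der)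
      show "isCont (\<lambda>t. f k t - of_nat k / z * f (k - 1) t) t" for t
        unfolding f_def by (intro continuous_intros)
      show "set_integrable lborel (einterval 0 \<infinity>) (\<lambda>t. f k t - of_nat k / z * f (k - 1) t)"
        using si by (simp add: einterval_def greaterThan_def zero_ereal_def)
      have "((\<lambda>t. - (f k t) / z) \<longlongrightarrow> - (f k 0) / z) (at_right 0)"
        unfolding f_def by (intro tendsto_intros) (use z0 in auto)
      moreover have "- (f k 0) / z = (if k = 0 then - 1 / z else 0)" by (simp add: f_def)
      ultimately show "(((\<lambda>t. - (f k t) / z) \<circ> real_of_ereal) \<longlongrightarrow> (if k = 0 then - 1 / z else 0)) (at_right 0)"
        by (simp add: ereal_tendsto_simps zero_ereal_def)
      have "((\<lambda>t. - (f k t) / z) \<longlongrightarrow> - 0 / z) at_top"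
        by (intro tendsto_intros lim0) (use z0 in auto)
      then show "(((\<lambda>t. - (f k t) / z) \<circ> real_of_ereal) \<longlongrightarrow> 0) (at_left \<infinity>)"
        by (simp add: ereal_tendsto_simps)
    qed simp
    then show ?thesis by (simp add: interval_lebesgue_integral_0_infty)
  qed
  have rec: "(LBINT t:{0<..}. f k t) = (if k = 0 then 1 / z else of_nat k / z * (LBINT t:{0<..}. f (k - 1) t))" for k
  proof -
    have "(LBINT t:{0<..}. f k t - of_nat k / z * f (k - 1) t) = (LBINT t:{0<..}. f k t) - (LBINT t:{0<..}. of_nat k / z * f (k - 1) t)"
      using fi[of k] fi[of "k - 1"] by (intro set_integral_diff(2) set_integrable_mult_right) auto
    then show ?thesis using step[of k] by (auto simp: field_simps)
  qed
  have "(LBINT t:{0<..}. f k t) = fact k / z ^ Suc k"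
  proof (induction k)
    case 0
    then show ?case using rec[of 0] by simp
  next
    case (Suc k)
    then show ?case using rec[of "Suc k"] by (simp add: field_simps)
  qed
  then show "(LBINT t:{0<..}. of_real t ^ k * exp (- (z * of_real t))) = fact k / z ^ Suc k"
    by (simp add: f_def)
  show "set_integrable lborel {0<..} (\<lambda>t. of_real t ^ k * exp (- (z * of_real t)))"
    using fi[of k] by (simp add: f_def)
qed

text \<open>The real part of \<open>complex_Gamma_integral\<close> at z = 1 - i v, where 1 / z = (1
  + i v) / (1 + v^2).\<close>

lemma cos_moment:
  fixes v :: real
  shows "(\<integral>t. indicator {0<..} t * (t ^ k * exp (- t)) * cos (t * v) \<partial>lborel) = fact k * Re ((1 + \<i> * v) ^ Suc k) / (1 + v\<^sup>2) ^ Suc k"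
proof -
  define z where "z = 1 - \<i> * v"
  have z: "Re z > 0" by (simp add: z_def)
  note c = complex_Gamma_integral[OF z, of k]
  have e: "Re (of_real t ^ k * exp (- (z * of_real t))) = t ^ k * exp (- t) * cos (t * v)" for t :: real
  proof -
    have "exp (- (z * of_real t)) = of_real (exp (- t)) * cis (t * v)"
      by (simp add: z_def cis_conv_exp exp_of_real[symmetric] mult_exp_exp algebra_simps)
    then show ?thesis by (simp flip: of_real_power)
  qed
  have "(\<integral>t. indicator {0<..} t * (t ^ k * exp (- t)) * cos (t * v) \<partial>lborel) = (\<integral>t. Re (indicator {0<..} t *\<^sub>R (of_real t ^ k * exp (- (z * of_real t)))) \<partial>lborel)"
    by (simp only: scaleR_complex.sel e mult.assoc)
  also have "\<dots> = Re (LBINT t:{0<..}. of_real t ^ k * exp (- (z * of_real t)))"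
    using c(1) unfolding set_lebesgue_integral_def set_integrable_def by (rule integral_Re)
  also have "\<dots> = Re (fact k / z ^ Suc k)" unfolding c(2) ..
  also have "fact k / z ^ Suc k = of_real (fact k / (1 + v\<^sup>2) ^ Suc k) * (1 + \<i> * v) ^ Suc k"
  proof -
    have "z * (1 + \<i> * v) = of_real (1 + v\<^sup>2)" by (simp add: z_def algebra_simps power2_eq_square)
    moreover have "(of_real (1 + v\<^sup>2) :: complex) \<noteq> 0" by (metis add_pos_nonneg of_real_eq_0_iff less_irrefl zero_le_power2 zero_less_one)
    ultimately have *: "1 / z = (1 + \<i> * v) / of_real (1 + v\<^sup>2)"
      using z by (auto simp: divide_simps mult.commute)
    have "fact k / z ^ Suc k = fact k * (1 / z) ^ Suc k" by (simp only: power_one_over[symmetric] divide_inverse mult_1_left power_inverse)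
    also have "\<dots> = of_real (fact k / (1 + v\<^sup>2) ^ Suc k) * (1 + \<i> * v) ^ Suc k"
      unfolding * by (simp only: power_divide of_real_divide of_real_power of_real_fact times_divide_eq_left times_divide_eq_right)
    finally show ?thesis .
  qed
  finally show ?thesis by (simp add: Re_complex_of_real)
qed


text \<open>G is the sine transform of t^(m-1) (1 + t) exp (- t), that is the imaginary part of
  (m-1)! / z^m + m! / z^(m+1) at z = 1 - i v; this is where the two rational functions come from.
  That G has the sign of its argument is what restricts the dimension: for m = 3 the numerator would
  be 30 v - 20 v^3 - 2 v^5, which changes sign on v > 0.\<close>

lemma cos_moment_antiderivative:
  fixes m :: nat
  assumes m: "m = 1 \<or> m = 2"
  defines "g \<equiv> \<lambda>v::real. \<integral>t. indicator {0<..} t * (t ^ m * exp (- t) + t ^ Suc m * exp (- t)) * cos (t * v) \<partial>lborel"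
  obtains G :: "real \<Rightarrow> real" where "\<And>v. (G has_real_derivative g v) (at v)" "\<And>v. v \<ge> 0 \<Longrightarrow> G v \<ge> 0" "\<And>v. v \<le> 0 \<Longrightarrow> G v \<le> 0" "G 0 = 0"
proof -
  have i: "integrable lborel (\<lambda>t. indicator {0<..} t * (t ^ k * exp (- t)) * cos (t * v))" for k and v :: real
  proof (rule Bochner_Integration.integrable_bound)
    show "integrable lborel (\<lambda>t. t ^ k * exp (- t) * indicator {0<..} t :: real)" by (rule integrable_power_exp)
  qed (auto intro!: AE_I2 simp: indicator_def abs_mult mult_left_le)
  have g: "g v = fact m * Re ((1 + \<i> * v) ^ Suc m) / (1 + v\<^sup>2) ^ Suc m + fact (Suc m) * Re ((1 + \<i> * v) ^ Suc (Suc m)) / (1 + v\<^sup>2) ^ Suc (Suc m)" for v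
  proof -
    have "g v = (\<integral>t. indicator {0<..} t * (t ^ m * exp (- t)) * cos (t * v) + indicator {0<..} t * (t ^ Suc m * exp (- t)) * cos (t * v) \<partial>lborel)"
      unfolding g_def by (simp add: algebra_simps)
    also have "\<dots> = (\<integral>t. indicator {0<..} t * (t ^ m * exp (- t)) * cos (t * v) \<partial>lborel) + (\<integral>t. indicator {0<..} t * (t ^ Suc m * exp (- t)) * cos (t * v) \<partial>lborel)"
      by (rule Bochner_Integration.integral_add[OF i i])
    finally show ?thesis unfolding cos_moment .
  qed
  have q: "1 + v\<^sup>2 > 0" for v :: real by (simp add: add_pos_nonneg)
  have R2: "Re ((1 + \<i> * v) ^ 2) = 1 - v\<^sup>2" for v
    by (simp add: power2_eq_square)
  have R3: "Re ((1 + \<i> * v) ^ 3) = 1 - 3 * v\<^sup>2" for v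
    by (simp add: power3_eq_cube power2_eq_square algebra_simps)
  have R4: "Re ((1 + \<i> * v) ^ 4) = 1 - 6 * v\<^sup>2 + v ^ 4" for v
    by (simp add: power4_eq_xxxx power2_eq_square algebra_simps)
  from m show thesis
  proof
    assume m: "m = 1"
    show thesis
    proof (rule that[of "\<lambda>v. (3 * v + v ^ 3) / (1 + v\<^sup>2)\<^sup>2"])
      fix v :: real
      have "g v = (1 - v\<^sup>2) / (1 + v\<^sup>2)\<^sup>2 + 2 * (1 - 3 * v\<^sup>2) / (1 + v\<^sup>2) ^ 3"
        unfolding g m using R2[of v] R3[of v] by (simp add: eval_nat_numeral del: power_Suc)
      also have "\<dots> = ((1 - v\<^sup>2) * (1 + v\<^sup>2) + 2 * (1 - 3 * v\<^sup>2)) / (1 + v\<^sup>2) ^ 3"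
      proof -
        have "(1 + v\<^sup>2) ^ 3 = (1 + v\<^sup>2) * (1 + v\<^sup>2)\<^sup>2" by algebra
        then show ?thesis using q[of v] by (simp add: add_divide_distrib)
      qed
      finally have gv: "g v = ((1 - v\<^sup>2) * (1 + v\<^sup>2) + 2 * (1 - 3 * v\<^sup>2)) / (1 + v\<^sup>2) ^ 3" .
      have "((\<lambda>v. (3 * v + v ^ 3) / (1 + v\<^sup>2)\<^sup>2) has_real_derivative
          ((3 + 3 * v\<^sup>2) * (1 + v\<^sup>2)\<^sup>2 - (3 * v + v ^ 3) * (2 * (1 + v\<^sup>2) * (2 * v))) / ((1 + v\<^sup>2)\<^sup>2 * (1 + v\<^sup>2)\<^sup>2)) (at v)"
        using q[of v] by (auto intro!: derivative_eq_intros)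
      moreover have "((3 + 3 * v\<^sup>2) * (1 + v\<^sup>2)\<^sup>2 - (3 * v + v ^ 3) * (2 * (1 + v\<^sup>2) * (2 * v))) / ((1 + v\<^sup>2)\<^sup>2 * (1 + v\<^sup>2)\<^sup>2) = g v"
      proof -
        have "(3 + 3 * v\<^sup>2) * (1 + v\<^sup>2)\<^sup>2 - (3 * v + v ^ 3) * (2 * (1 + v\<^sup>2) * (2 * v)) = (1 + v\<^sup>2) * ((1 - v\<^sup>2) * (1 + v\<^sup>2) + 2 * (1 - 3 * v\<^sup>2))"
          by algebra
        moreover have "(1 + v\<^sup>2)\<^sup>2 * (1 + v\<^sup>2)\<^sup>2 = (1 + v\<^sup>2) * (1 + v\<^sup>2) ^ 3" by algebra
        ultimately show ?thesis unfolding gv using q[of v] by simp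
      qed
      ultimately show "((\<lambda>v. (3 * v + v ^ 3) / (1 + v\<^sup>2)\<^sup>2) has_real_derivative g v) (at v)" by simp
      have "3 * v + v ^ 3 = v * (3 + v\<^sup>2)" by algebra
      moreover have "3 + v\<^sup>2 > 0" by (simp add: add_pos_nonneg)
      ultimately show "v \<ge> 0 \<Longrightarrow> (3 * v + v ^ 3) / (1 + v\<^sup>2)\<^sup>2 \<ge> 0" "v \<le> 0 \<Longrightarrow> (3 * v + v ^ 3) / (1 + v\<^sup>2)\<^sup>2 \<le> 0"
        by (simp_all add: divide_nonpos_nonneg mult_nonpos_nonneg)
    qed simp
  next
    assume m: "m = 2"
    show thesis
    proof (rule that[of "\<lambda>v. (8 * v) / (1 + v\<^sup>2) ^ 3"])
      fix v :: real
      have "g v = 2 * (1 - 3 * v\<^sup>2) / (1 + v\<^sup>2) ^ 3 + 6 * (1 - 6 * v\<^sup>2 + v ^ 4) / (1 + v\<^sup>2) ^ 4"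
        unfolding g m using R3[of v] R4[of v] by (simp add: eval_nat_numeral del: power_Suc)
      also have "\<dots> = (2 * (1 - 3 * v\<^sup>2) * (1 + v\<^sup>2) + 6 * (1 - 6 * v\<^sup>2 + v ^ 4)) / (1 + v\<^sup>2) ^ 4"
      proof -
        have "(1 + v\<^sup>2) ^ 4 = (1 + v\<^sup>2) * (1 + v\<^sup>2) ^ 3" by algebra
        then show ?thesis using q[of v] by (simp add: add_divide_distrib)
      qed
      also have "2 * (1 - 3 * v\<^sup>2) * (1 + v\<^sup>2) + 6 * (1 - 6 * v\<^sup>2 + v ^ 4) = 8 - 40 * v\<^sup>2" by algebra
      finally have gv: "g v = (8 - 40 * v\<^sup>2) / (1 + v\<^sup>2) ^ 4" .
      have "((\<lambda>v. (8 * v) / (1 + v\<^sup>2) ^ 3) has_real_derivative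
          (8 * (1 + v\<^sup>2) ^ 3 - (8 * v) * (3 * (1 + v\<^sup>2)\<^sup>2 * (2 * v))) / ((1 + v\<^sup>2) ^ 3 * (1 + v\<^sup>2) ^ 3)) (at v)"
        using q[of v] by (auto intro!: derivative_eq_intros)
      moreover have "(8 * (1 + v\<^sup>2) ^ 3 - (8 * v) * (3 * (1 + v\<^sup>2)\<^sup>2 * (2 * v))) / ((1 + v\<^sup>2) ^ 3 * (1 + v\<^sup>2) ^ 3) = g v"
      proof -
        have "8 * (1 + v\<^sup>2) ^ 3 - (8 * v) * (3 * (1 + v\<^sup>2)\<^sup>2 * (2 * v)) = (1 + v\<^sup>2)\<^sup>2 * (8 - 40 * v\<^sup>2)" by algebra
        moreover have "(1 + v\<^sup>2) ^ 3 * (1 + v\<^sup>2) ^ 3 = (1 + v\<^sup>2)\<^sup>2 * (1 + v\<^sup>2) ^ 4" by algebra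
        moreover have "(1 + v\<^sup>2)\<^sup>2 \<noteq> 0" using q[of v] by simp
        ultimately show ?thesis unfolding gv by (simp only: mult_divide_mult_cancel_left_if if_False)
      qed
      ultimately show "((\<lambda>v. (8 * v) / (1 + v\<^sup>2) ^ 3) has_real_derivative g v) (at v)" by simp
      show "v \<ge> 0 \<Longrightarrow> (8 * v) / (1 + v\<^sup>2) ^ 3 \<ge> 0" "v \<le> 0 \<Longrightarrow> (8 * v) / (1 + v\<^sup>2) ^ 3 \<le> 0"
        using q[of v] by (simp_all add: divide_nonpos_nonneg)
    qed simp
  qed
qed

text \<open>Integration by parts against a monotone A that need not be differentiable: the second
  mean value theorem on each half of [- R, R] leaves A 0 * (G c - G c') with c' \<le> 0 \<le> c. The
  contributions of the outer end points drop out because A vanishes there.\<close>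

lemma integral_antimono_even_nonneg:
  fixes A g G :: "real \<Rightarrow> real"
  assumes even: "\<And>u. A (- u) = A u" and mono: "\<And>u v. 0 \<le> u \<Longrightarrow> u \<le> v \<Longrightarrow> A v \<le> A u" and A0: "\<And>u. A u \<ge> 0"
    and R: "R > 0" and supp: "\<And>u. R \<le> \<bar>u\<bar> \<Longrightarrow> A u = 0"
    and G: "\<And>v. (G has_real_derivative g v) (at v)" "\<And>v. v \<ge> 0 \<Longrightarrow> G v \<ge> 0" "\<And>v. v \<le> 0 \<Longrightarrow> G v \<le> 0" "G 0 = 0"
    and int: "integrable lborel (\<lambda>u. A u * g u)"
  shows "0 \<le> (\<integral>u. A u * g u \<partial>lborel)"
proof -
  have gi: "(g has_integral (G b - G a)) {a..b}" if "a \<le> b" for a b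
    using that G(1) by (intro fundamental_theorem_of_calculus)
      (auto simp: has_real_derivative_iff_has_vector_derivative[symmetric] intro: has_field_derivative_at_within)
  have "((\<lambda>u. A u * g u) has_integral (\<integral>u. A u * g u \<partial>lborel)) UNIV"
    using int by (rule has_integral_integral_lborel)
  moreover have "(\<lambda>u. A u * g u) = (\<lambda>u. if u \<in> {-R..R} then A u * g u else 0)"
    using supp by (auto simp: fun_eq_iff)
  ultimately have I: "((\<lambda>u. A u * g u) has_integral (\<integral>u. A u * g u \<partial>lborel)) {-R..R}"
    by (metis has_integral_restrict_UNIV)
  \<comment> \<open>The mean value theorem is stated for increasing functions, so on the right half
    it is applied to - A.\<close>
  obtain c where c: "c \<in> {0..R}" "((\<lambda>u. - A u * g u) has_integral (- A 0 * integral {0..c} g + - A R * integral {c..R} g)) {0..R}"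
  proof (rule second_mean_value_theorem_full[of g 0 R "\<lambda>u. - A u"])
    show "g integrable_on {0..R}" using gi[of 0 R] R by (auto simp: integrable_on_def)
  qed (use R mono in auto)
  obtain c' where c': "c' \<in> {-R..0}" "((\<lambda>u. A u * g u) has_integral (A (- R) * integral {-R..c'} g + A 0 * integral {c'..0} g)) {-R..0}"
  proof (rule second_mean_value_theorem_full[of g "-R" 0 A])
    show "g integrable_on {-R..0}" using gi[of "-R" 0] R by (auto simp: integrable_on_def)
    show "A x \<le> A y" if "- R \<le> x" "x \<le> y" "y \<le> 0" for x y
      using mono[of "- y" "- x"] that by (simp add: even)
  qed (use R in auto)
  have 1: "integral {0..c} g = G c" using gi[of 0 c] c G(4) by (auto dest: integral_unique)
  have 2: "integral {c'..0} g = - G c'" using gi[of c' 0] c' G(4) by (auto dest: integral_unique)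
  have AR: "A R = 0" "A (- R) = 0" using supp R by auto
  have "((\<lambda>u. A u * g u) has_integral (A 0 * G c)) {0..R}"
    using has_integral_neg[OF c(2)] 1 AR by simp
  moreover have "((\<lambda>u. A u * g u) has_integral (A 0 * (- G c'))) {-R..0}"
    using c'(2) 2 AR by simp
  ultimately have "((\<lambda>u. A u * g u) has_integral (A 0 * (- G c') + A 0 * G c)) {-R..R}"
    using R by (intro has_integral_combine[of "-R" 0 R]) auto
  then have "(\<integral>u. A u * g u \<partial>lborel) = A 0 * (- G c') + A 0 * G c"
    using I has_integral_unique by blast
  then show ?thesis using A0[of 0] G(2)[of c] G(3)[of c'] c(1) c'(1) by (simp add: mult_left_mono)
qed

text \<open>By \<open>exp_over_layer\<close> the damped kernel is a superposition of indicators of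
  the dilates t K. Scaling each dilate back to K turns cos (x \<bullet> \<xi>) into cos (t (x
  \<bullet> \<xi>)), so the transform becomes the integral over K of a function g of x \<bullet>
  \<xi>. Slicing K orthogonally to \<xi> leaves a line integral of the section function, which is
  even and decreasing on the positive half-line.\<close>

lemma convex_kernel_positive_definite:
  fixes K B :: "'a::euclidean_space set" and p :: "'a \<Rightarrow> real"
  assumes B: "orthonormal_set B" and card: "card B = 3 \<or> card B = 4"
    and K: "compact K" "convex K" "\<And>x. x \<in> K \<Longrightarrow> - x \<in> K"
    and p [measurable]: "p \<in> borel_measurable borel"
    and hom: "\<And>c x. c > 0 \<Longrightarrow> p (c *\<^sub>R x) = c * p x"
    and c: "c > 0" and pc: "\<And>x. c * norm x \<le> p x" and pK: "\<And>x. x \<in> K \<longleftrightarrow> p x \<le> 1"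
    and \<xi>: "\<xi> \<in> span B"
  shows "0 \<le> (\<integral>x. inverse (p x) * exp (- p x) * cos (x \<bullet> \<xi>) \<partial>span_lborel B)"
proof (cases "\<xi> = 0")
  case True
  have "p x \<ge> 0" for x using pc[of x] c by (meson mult_nonneg_nonneg norm_ge_zero order_trans less_imp_le)
  then show ?thesis using True by (intro Bochner_Integration.integral_nonneg) auto
next
  case \<xi>0: False
  let ?M = "span_lborel B"
  interpret sf: sigma_finite_measure ?M by (rule sigma_finite_span_lborel[OF B])
  interpret pair_sigma_finite ?M "lborel :: real measure" ..
  \<comment> \<open>The layer weight (1 + t) / t^2 times the Jacobian t^d is t^(d-2) + t^(d-1), up
    to exp (- t). So dimension 3 leads to m = 1 and dimension 4 to m = 2.\<close>
  define m where "m = card B - 2"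
  have m: "m = 1 \<or> m = 2" "card B = Suc (Suc m)" using card by (auto simp: m_def)
  have Bne: "B \<noteq> {}" using card by auto
  have p0: "p x > 0" if "x \<noteq> 0" for x
    using pc[of x] c that by (smt (verit) mult_pos_pos zero_less_norm_iff)
  have [measurable]: "K \<in> sets borel" using K(1) by (simp add: borel_compact)
  have Kp: "K = {x. p x \<le> 1}" using pK by auto
  have finK: "emeasure ?M K < \<infinity>" unfolding Kp by (rule emeasure_homogeneous_finite[OF B c pc])
  define k where "k = (\<lambda>t::real. (1 + t) / t\<^sup>2 * exp (- t))"
  define \<kappa> where "\<kappa> = (\<lambda>t::real. t ^ m * exp (- t) + t ^ Suc m * exp (- t))"
  have kk: "k t * t ^ card B = \<kappa> t" if "t > 0" for t
    using that by (simp add: k_def \<kappa>_def m(2) field_simps power2_eq_square)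
  have [measurable]: "k \<in> borel_measurable borel" "\<kappa> \<in> borel_measurable borel" by (simp_all add: k_def \<kappa>_def)
    have ki: "integrable lborel (\<lambda>t. indicator {0<..} t * \<kappa> t)"
    proof -
      have "integrable lborel (\<lambda>t. t ^ m * exp (- t) * indicator {0<..} t + t ^ Suc m * exp (- t) * indicator {0<..} t :: real)"
        by (intro Bochner_Integration.integrable_add integrable_power_exp)
      then show ?thesis by (simp add: \<kappa>_def algebra_simps)
    qed
  define \<Psi> where "\<Psi> = (\<lambda>x t. indicator {0<..} t * k t * indicator {z. p (fst z) \<le> snd z} (x, t) :: real)"
  have [measurable]: "{z. p (fst z) \<le> snd z} \<in> sets (?M \<Otimes>\<^sub>M (lborel :: real measure))"
  proof -
    have "{z \<in> space (?M \<Otimes>\<^sub>M (lborel :: real measure)). p (fst z) \<le> snd z} \<in> sets (?M \<Otimes>\<^sub>M lborel)"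
      by measurable
    then show ?thesis by (simp add: space_pair_measure)
  qed
  have \<Psi>_meas [measurable]: "(\<lambda>z. \<Psi> (fst z) (snd z)) \<in> borel_measurable (?M \<Otimes>\<^sub>M lborel)"
    unfolding \<Psi>_def by simp
  have \<Psi>_meas2: "\<Psi> x \<in> borel_measurable borel" for x
  proof -
    have "\<Psi> x = (\<lambda>t. indicator {0<..} t * k t * indicator {p x..} t)" by (auto simp: \<Psi>_def indicator_def fun_eq_iff)
    then show ?thesis by simp
  qed
  have \<Psi>0: "\<Psi> x t \<ge> 0" for x t by (auto simp: \<Psi>_def k_def indicator_def)
  have \<Psi>_nn: "(\<integral>\<^sup>+ t. ennreal (\<Psi> x t) \<partial>lborel) = ennreal (exp (- p x) / p x)" if "x \<noteq> 0" for x
    unfolding exp_over_layer[OF p0[OF that], symmetric]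
    using p0[OF that] by (intro nn_integral_cong) (auto simp: \<Psi>_def k_def indicator_def)
  have \<Psi>_int: "(\<integral>t. \<Psi> x t \<partial>lborel) = inverse (p x) * exp (- p x)" if "x \<noteq> 0" for x
  proof -
    have "(\<integral>t. \<Psi> x t \<partial>lborel) = enn2real (\<integral>\<^sup>+ t. ennreal (\<Psi> x t) \<partial>lborel)"
      using \<Psi>0 \<Psi>_meas2 by (intro integral_eq_nn_integral) auto
    then show ?thesis using p0[OF that] by (simp add: \<Psi>_nn[OF that] divide_inverse)
  qed
  have i0: "integrable ?M (\<lambda>x. exp (- p x) / p x)"
    by (rule integrable_exp_neg_homogeneous(2)[OF B p hom c pc]) (use card in auto)
  have \<Psi>i: "integrable (?M \<Otimes>\<^sub>M lborel) (\<lambda>z. \<Psi> (fst z) (snd z))"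
  proof (rule integrableI_nonneg)
    have "(\<integral>\<^sup>+ z. ennreal (\<Psi> (fst z) (snd z)) \<partial>(?M \<Otimes>\<^sub>M lborel)) = (\<integral>\<^sup>+ x. \<integral>\<^sup>+ t. ennreal (\<Psi> x t) \<partial>lborel \<partial>?M)"
      by (subst lborel.nn_integral_fst[symmetric]) auto
    also have "\<dots> = (\<integral>\<^sup>+ x. ennreal (exp (- p x) / p x) \<partial>?M)"
      by (intro nn_integral_cong_AE) (use AE_span_lborel_neq_0[OF B Bne] \<Psi>_nn in \<open>auto elim!: eventually_mono\<close>)
    also have "\<dots> < \<infinity>"
    proof -
      have "(\<integral>\<^sup>+ x. ennreal (exp (- p x) / p x) \<partial>?M) \<le> (\<integral>\<^sup>+ x. ennreal (norm (exp (- p x) / p x)) \<partial>?M)"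
        by (intro nn_integral_mono ennreal_leI) (simp only: real_norm_def abs_ge_self)
      also have "\<dots> < \<infinity>" using i0 by (simp only: integrable_iff_bounded)
      finally show ?thesis .
    qed
    finally show "(\<integral>\<^sup>+ z. ennreal (\<Psi> (fst z) (snd z)) \<partial>(?M \<Otimes>\<^sub>M lborel)) < \<infinity>" .
  qed (use \<Psi>0 in auto)
  have \<Psi>ci: "integrable (?M \<Otimes>\<^sub>M lborel) (\<lambda>(x, t). \<Psi> x t * cos (x \<bullet> \<xi>))"
  proof (rule Bochner_Integration.integrable_bound[OF \<Psi>i])
    have "(\<lambda>z. \<Psi> (fst z) (snd z) * cos (fst z \<bullet> \<xi>)) \<in> borel_measurable (?M \<Otimes>\<^sub>M lborel)" by measurable
    then show "(\<lambda>(x, t). \<Psi> x t * cos (x \<bullet> \<xi>)) \<in> borel_measurable (?M \<Otimes>\<^sub>M lborel)" by (simp add: case_prod_beta')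
  qed (auto intro!: AE_I2 simp: abs_mult mult_left_le)
  have "(\<integral>x. inverse (p x) * exp (- p x) * cos (x \<bullet> \<xi>) \<partial>?M) = (\<integral>x. \<integral>t. \<Psi> x t * cos (x \<bullet> \<xi>) \<partial>lborel \<partial>?M)"
  proof (rule integral_cong_AE)
    show "AE x in ?M. inverse (p x) * exp (- p x) * cos (x \<bullet> \<xi>) = (\<integral>t. \<Psi> x t * cos (x \<bullet> \<xi>) \<partial>lborel)"
      using AE_span_lborel_neq_0[OF B Bne] by eventually_elim (simp add: \<Psi>_int)
    show "(\<lambda>x. \<integral>t. \<Psi> x t * cos (x \<bullet> \<xi>) \<partial>lborel) \<in> borel_measurable ?M"
      using borel_measurable_integrable[OF \<Psi>ci] by (rule lborel.borel_measurable_lebesgue_integral)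
  qed simp
  also have "\<dots> = (\<integral>t. \<integral>x. \<Psi> x t * cos (x \<bullet> \<xi>) \<partial>?M \<partial>lborel)"
    by (rule Fubini_integral[OF \<Psi>ci, symmetric])
  also have "\<dots> = (\<integral>t. \<integral>x. indicator K x * (indicator {0<..} t * \<kappa> t * cos (t * (x \<bullet> \<xi>))) \<partial>?M \<partial>lborel)"
  proof (rule Bochner_Integration.integral_cong[OF refl])
    fix t :: real
    show "(\<integral>x. \<Psi> x t * cos (x \<bullet> \<xi>) \<partial>?M) = (\<integral>x. indicator K x * (indicator {0<..} t * \<kappa> t * cos (t * (x \<bullet> \<xi>))) \<partial>?M)"
    proof (cases "t > 0")
      case True
      have "(\<integral>x. \<Psi> x t * cos (x \<bullet> \<xi>) \<partial>?M) = (\<integral>x. indicator {x. p x \<le> t} x * (k t * cos (x \<bullet> \<xi>)) \<partial>?M)"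
        using True by (intro Bochner_Integration.integral_cong) (auto simp: \<Psi>_def indicator_def)
      also have "\<dots> = t ^ card B * (\<integral>x. indicator {x. p x \<le> t} (t *\<^sub>R x) * (k t * cos ((t *\<^sub>R x) \<bullet> \<xi>)) \<partial>?M)"
        using True by (subst integral_span_lborel_scale[OF B, of t]) auto
      also have "\<dots> = (\<integral>x. t ^ card B * (indicator {x. p x \<le> t} (t *\<^sub>R x) * (k t * cos ((t *\<^sub>R x) \<bullet> \<xi>))) \<partial>?M)"
        by (rule integral_mult_right_zero[symmetric])
      also have "\<dots> = (\<integral>x. indicator K x * (indicator {0<..} t * \<kappa> t * cos (t * (x \<bullet> \<xi>))) \<partial>?M)"
        using True hom[OF True] kk[OF True, symmetric]
        by (intro Bochner_Integration.integral_cong) (auto simp: Kp indicator_def mult_le_cancel_left1)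
      finally show ?thesis .
    qed (simp add: \<Psi>_def)
  qed
  also have "\<dots> = (\<integral>x. \<integral>t. indicator K x * (indicator {0<..} t * \<kappa> t * cos (t * (x \<bullet> \<xi>))) \<partial>lborel \<partial>?M)"
  proof (rule Fubini_integral)
    have Ki: "integrable ?M (indicator K :: 'a \<Rightarrow> real)"
      using finK by (intro integrable_real_indicator) auto
    have pi: "integrable (?M \<Otimes>\<^sub>M lborel) (\<lambda>z. indicator K (fst z) * (indicator {0<..} (snd z) * \<kappa> (snd z)) :: real)"
      by (rule Fubini_integrable) (use ki Ki in \<open>auto simp: abs_mult\<close>)
    show "integrable (?M \<Otimes>\<^sub>M lborel) (\<lambda>(x, t). indicator K x * (indicator {0<..} t * \<kappa> t * cos (t * (x \<bullet> \<xi>))))"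
    proof (rule Bochner_Integration.integrable_bound[OF pi])
      have "(\<lambda>z. indicator K (fst z) * (indicator {0<..} (snd z) * \<kappa> (snd z) * cos (snd z * (fst z \<bullet> \<xi>))) :: real) \<in> borel_measurable (?M \<Otimes>\<^sub>M lborel)"
        by measurable
      then show "(\<lambda>(x, t). indicator K x * (indicator {0<..} t * \<kappa> t * cos (t * (x \<bullet> \<xi>)))) \<in> borel_measurable (?M \<Otimes>\<^sub>M lborel)"
        by (simp add: case_prod_beta')
      show "AE z in ?M \<Otimes>\<^sub>M lborel. norm (case z of (x, t) \<Rightarrow> indicator K x * (indicator {0<..} t * \<kappa> t * cos (t * (x \<bullet> \<xi>))))
        \<le> norm (indicator K (fst z) * (indicator {0<..} (snd z) * \<kappa> (snd z)) :: real)"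
      proof (rule AE_I2)
        fix z :: "'a \<times> real"
        have "\<bar>indicator K (fst z) * (indicator {0<..} (snd z) * \<kappa> (snd z)) * cos (snd z * (fst z \<bullet> \<xi>))\<bar> \<le> \<bar>indicator K (fst z) * (indicator {0<..} (snd z) * \<kappa> (snd z)) :: real\<bar>"
          unfolding abs_mult[of _ "cos _"] by (rule mult_left_le) simp_all
        then show "norm (case z of (x, t) \<Rightarrow> indicator K x * (indicator {0<..} t * \<kappa> t * cos (t * (x \<bullet> \<xi>))))
          \<le> norm (indicator K (fst z) * (indicator {0<..} (snd z) * \<kappa> (snd z)) :: real)"
          by (simp add: case_prod_beta' mult.assoc)
      qed
    qed
  qed
  also have "\<dots> = (\<integral>x. indicator K x * (\<integral>t. indicator {0<..} t * \<kappa> t * cos (t * (x \<bullet> \<xi>)) \<partial>lborel) \<partial>?M)"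
    by (simp only: integral_mult_right_zero)
  finally have step: "(\<integral>x. inverse (p x) * exp (- p x) * cos (x \<bullet> \<xi>) \<partial>?M)
    = (\<integral>x. indicator K x * (\<integral>t. indicator {0<..} t * \<kappa> t * cos (t * (x \<bullet> \<xi>)) \<partial>lborel) \<partial>?M)" .
  define g where "g = (\<lambda>v. \<integral>t. indicator {0<..} t * \<kappa> t * cos (t * v) \<partial>lborel)"
  obtain G where G: "\<And>v. (G has_real_derivative g v) (at v)" "\<And>v. v \<ge> 0 \<Longrightarrow> G v \<ge> 0" "\<And>v. v \<le> 0 \<Longrightarrow> G v \<le> 0" "G 0 = 0"
  proof (rule cos_moment_antiderivative[OF m(1)])
    fix G :: "real \<Rightarrow> real"
    assume "\<And>v. (G has_real_derivative (\<integral>t. indicator {0<..} t * (t ^ m * exp (- t) + t ^ Suc m * exp (- t)) * cos (t * v) \<partial>lborel)) (at v)"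
      "\<And>v. v \<ge> 0 \<Longrightarrow> G v \<ge> 0" "\<And>v. v \<le> 0 \<Longrightarrow> G v \<le> 0" "G 0 = 0"
    then show thesis using that[of G] by (simp only: g_def \<kappa>_def)
  qed
  define gC where "gC = (\<integral>t. indicator {0<..} t * \<kappa> t \<partial>lborel)"
  have [measurable]: "g \<in> borel_measurable borel" unfolding g_def by measurable
  define s where "s = norm \<xi>"
  define \<omega> where "\<omega> = \<xi> /\<^sub>R s"
  have s: "s > 0" using \<xi>0 by (simp add: s_def)
  have om: "\<omega> \<in> span B" "norm \<omega> = 1" using \<xi> \<xi>0 by (auto simp: \<omega>_def s_def span_scale)
  have xi: "\<xi> = s *\<^sub>R \<omega>" using s by (simp add: \<omega>_def)
  obtain A where A: "orthonormal_set (insert \<omega> A)" "\<omega> \<notin> A" "span (insert \<omega> A) = span B" "card B = Suc (card A)"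
    using orthonormal_set_split[OF B om] by metis
  have oA: "orthonormal_set A" using A(1) by (rule orthonormal_set_subset) auto
  have o\<omega>: "orthonormal_set {\<omega>}" using om by (simp add: orthonormal_set_def)
  interpret A: pair_sigma_finite "span_lborel {\<omega>}" "span_lborel A"
    using o\<omega> oA by (rule pair_sigma_finite_span_lborel)
  have o: "orthonormal_set ({\<omega>} \<union> A)" "{\<omega>} \<inter> A = {}" using A by auto
  have eq: "?M = distr (span_lborel {\<omega>} \<Otimes>\<^sub>M span_lborel A) borel (\<lambda>z. fst z + snd z)"
    using span_lborel_cong_span[OF B A(1)] A(3) span_lborel_Un[OF o] by (simp add: case_prod_beta')
  have horth: "h \<bullet> \<omega> = 0" if "h \<in> span A" for h
    using orthonormal_set_insertD(3)[OF A(1,2) that] .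
  obtain r where r: "r > 0" "\<And>x. x \<in> K \<Longrightarrow> norm x \<le> r"
    using K(1) compact_imp_bounded bounded_pos by metis
  define Sf where "Sf = (\<lambda>u. \<integral>h. (indicator K (u *\<^sub>R \<omega> + h) :: real) \<partial>span_lborel A)"
  note sfa = section_function_antimono[OF oA K]
  have \<kappa>0: "0 \<le> indicator {0<..} t * \<kappa> t" for t by (auto simp: indicator_def \<kappa>_def)
  have gb: "\<bar>g v\<bar> \<le> gC" for v
    unfolding g_def gC_def
  proof (intro integral_abs_bound[THEN order_trans] integral_mono integrable_abs ki)
    show "\<bar>indicator {0<..} t * \<kappa> t * cos (t * v)\<bar> \<le> indicator {0<..} t * \<kappa> t" for t
      using \<kappa>0[of t] by (simp add: abs_mult[of _ "cos _"] mult_left_le)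
    show "integrable lborel (\<lambda>t. indicator {0<..} t * \<kappa> t * cos (t * v))"
      by (rule Bochner_Integration.integrable_bound[OF ki]) (auto intro!: AE_I2 simp: abs_mult mult_left_le)
  qed
  have Kgi: "integrable ?M (\<lambda>x. indicator K x * g (x \<bullet> \<xi>))"
  proof (rule Bochner_Integration.integrable_bound)
    show "integrable ?M (\<lambda>x. indicator K x * gC)"
      using finK by (intro integrable_mult_left integrable_real_indicator) auto
    show "AE x in ?M. norm (indicator K x * g (x \<bullet> \<xi>)) \<le> norm (indicator K x * gC)"
      using gb by (auto intro!: AE_I2 simp: indicator_def intro: order_trans[OF _ abs_ge_self])
  qed simp
  have Kgi2: "integrable (span_lborel {\<omega>} \<Otimes>\<^sub>M span_lborel A) (\<lambda>z. indicator K (fst z + snd z) * g ((fst z + snd z) \<bullet> \<xi>))"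
    using Kgi unfolding eq by (subst (asm) integrable_distr_eq) auto
  have slice: "(\<integral>h. indicator K (a + h) * g ((a + h) \<bullet> \<xi>) \<partial>span_lborel A) = (\<integral>h. indicator K (a + h) \<partial>span_lborel A) * g (a \<bullet> \<xi>)" for a
  proof -
    have "(\<integral>h. indicator K (a + h) * g ((a + h) \<bullet> \<xi>) \<partial>span_lborel A) = (\<integral>h. indicator K (a + h) * g (a \<bullet> \<xi>) \<partial>span_lborel A)"
    proof (rule integral_cong_AE)
      show "AE h in span_lborel A. indicator K (a + h) * g ((a + h) \<bullet> \<xi>) = indicator K (a + h) * g (a \<bullet> \<xi>)"
        using AE_span_lborel by eventually_elim (simp add: xi inner_add_left horth)
    qed simp_all
    then show ?thesis by simp
  qed
  have "(\<integral>x. indicator K x * g (x \<bullet> \<xi>) \<partial>?M) = (\<integral>a. \<integral>h. indicator K (a + h) * g ((a + h) \<bullet> \<xi>) \<partial>span_lborel A \<partial>span_lborel {\<omega>})"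
    using A.integral_fst'[OF Kgi2] unfolding eq by (subst integral_distr) auto
  also have "\<dots> = (\<integral>u. Sf u * g (s * u) \<partial>lborel)"
  proof -
    interpret sA: sigma_finite_measure "span_lborel A" by (rule sigma_finite_span_lborel[OF oA])
    have "(\<lambda>a. (\<integral>h. indicator K (a + h) \<partial>span_lborel A) * g (a \<bullet> \<xi>)) \<in> borel_measurable borel" by measurable
    moreover have "\<omega> \<bullet> \<xi> = s" using om by (simp add: xi dot_square_norm)
    ultimately show ?thesis
      unfolding slice span_lborel_singleton by (subst integral_distr) (auto simp: Sf_def mult.commute)
  qed
  finally have slices: "(\<integral>x. indicator K x * g (x \<bullet> \<xi>) \<partial>?M) = (\<integral>u. Sf u * g (s * u) \<partial>lborel)" .
  have Sint: "integrable lborel (\<lambda>u. Sf u * g (s * u))"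
  proof -
    have "integrable (span_lborel {\<omega>}) (\<lambda>a. \<integral>h. indicator K (a + h) * g ((a + h) \<bullet> \<xi>) \<partial>span_lborel A)"
      using A.integrable_fst'[OF Kgi2] by simp
    moreover have "\<omega> \<bullet> \<xi> = s" using om by (simp add: xi dot_square_norm)
    ultimately show ?thesis
      unfolding slice span_lborel_singleton by (subst (asm) integrable_distr_eq) (auto simp: Sf_def mult.commute)
  qed
  \<comment> \<open>Points of K have norm at most r, with equality possible, so sections are
    certainly empty from distance r + 1 on. The antiderivative of g (s u) is G (s u) / s, which
    inherits its sign from G because s > 0.\<close>
  have "0 \<le> (\<integral>u. Sf u * g (s * u) \<partial>lborel)"
  proof (rule integral_antimono_even_nonneg[where R="r + 1" and G="\<lambda>u. G (s * u) / s"])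
    show "Sf (- u) = Sf u" for u using sfa(1)[of "u *\<^sub>R \<omega>"] by (simp add: Sf_def)
    show "Sf u \<ge> 0" for u using sfa(3)[of "u *\<^sub>R \<omega>"] by (simp add: Sf_def)
    show "Sf v \<le> Sf u" if "0 \<le> u" "u \<le> v" for u v
    proof (cases "v = 0")
      case False
      then have "0 \<le> u / v" "u / v \<le> 1" "(u / v) *\<^sub>R v *\<^sub>R \<omega> = u *\<^sub>R \<omega>" using that by auto
      then show ?thesis using sfa(2)[of "u / v" "v *\<^sub>R \<omega>"] False by (simp add: Sf_def)
    qed (use that in auto)
    show "Sf u = 0" if "r + 1 \<le> \<bar>u\<bar>" for u
    proof -
      have "Sf u = (\<integral>h. 0 \<partial>span_lborel A)"
        unfolding Sf_def
      proof (rule integral_cong_AE)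
        show "AE h in span_lborel A. indicator K (u *\<^sub>R \<omega> + h) = (0::real)"
          using AE_span_lborel
        proof eventually_elim
          case (elim h)
          have "r < norm (u *\<^sub>R \<omega> + h)"
            using norm_add_orthogonal_unit_ge(2)[OF horth[OF elim] om(2), of u] that by (simp add: add.commute)
          then show ?case using r(2) by (force simp: indicator_def)
        qed
      qed simp_all
      then show ?thesis by simp
    qed
    show "((\<lambda>u. G (s * u) / s) has_real_derivative g (s * u)) (at u)" for u
      using s by (auto intro!: derivative_eq_intros DERIV_chain2[OF G(1)])
    show "G (s * v) / s \<ge> 0" if "v \<ge> 0" for v using G(2)[of "s * v"] that s by simp
    show "G (s * v) / s \<le> 0" if "v \<le> 0" for v using G(3)[of "s * v"] that s by (simp add: mult_nonneg_nonpos divide_nonpos_pos)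
  qed (use Sint r G(4) in auto)
  then show ?thesis unfolding step using slices by (simp add: g_def)
qed

subsection \<open>Positive definite distributions and Gaussian test functions\<close>

text \<open>Directional derivatives of polynomials are again polynomials; this makes the products of
  a polynomial with exp (- Q) stable under \<open>iter_partial\<close>.\<close>

lemma real_polynomial_function_derivative:
  fixes q :: "'a::euclidean_space \<Rightarrow> real"
  assumes "real_polynomial_function q"
  obtains q' where "\<And>x. (q has_derivative q' x) (at x)" "\<And>b. real_polynomial_function (\<lambda>x. q' x b)"
proof -
  have "\<exists>q'. (\<forall>x. (q has_derivative q' x) (at x)) \<and> (\<forall>b. real_polynomial_function (\<lambda>x. q' x b))"
    using assms
  proof (induction rule: real_polynomial_function.induct)
    case (linear f)
    then show ?case
      by (intro exI[of _ "\<lambda>x. f"]) (auto intro: bounded_linear_imp_has_derivative real_polynomial_function.intros(2))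
  next
    case (const c)
    then show ?case
      by (intro exI[of _ "\<lambda>x h. 0"]) (auto intro: real_polynomial_function.intros(2))
  next
    case (add f g)
    then obtain f' g' where "\<forall>x. (f has_derivative f' x) (at x)" "\<forall>b. real_polynomial_function (\<lambda>x. f' x b)"
      "\<forall>x. (g has_derivative g' x) (at x)" "\<forall>b. real_polynomial_function (\<lambda>x. g' x b)" by auto
    then show ?case
      by (intro exI[of _ "\<lambda>x h. f' x h + g' x h"]) (auto intro: real_polynomial_function.intros(3) has_derivative_add)
  next
    case (mult f g)
    then obtain f' g' where "\<forall>x. (f has_derivative f' x) (at x)" "\<forall>b. real_polynomial_function (\<lambda>x. f' x b)"
      "\<forall>x. (g has_derivative g' x) (at x)" "\<forall>b. real_polynomial_function (\<lambda>x. g' x b)" by auto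
    then show ?case
      using mult.hyps
      by (intro exI[of _ "\<lambda>x h. f x * g' x h + f' x h * g x"])
         (auto intro!: real_polynomial_function.intros(3) real_polynomial_function.intros(4) has_derivative_mult)
  qed
  then show thesis using that by blast
qed

lemma real_polynomial_function_growth:
  fixes q :: "'a::euclidean_space \<Rightarrow> real"
  assumes "real_polynomial_function q"
  obtains C k where "C \<ge> 0" "\<And>x. \<bar>q x\<bar> \<le> C * (1 + norm x) ^ k"
proof -
  have "\<exists>C k. C \<ge> 0 \<and> (\<forall>x. \<bar>q x\<bar> \<le> C * (1 + norm x) ^ k)"
    using assms
  proof (induction rule: real_polynomial_function.induct)
    case (linear f)
    then obtain K where K: "K > 0" "\<And>x. norm (f x) \<le> norm x * K" using bounded_linear.pos_bounded by blast
    have "\<bar>f x\<bar> \<le> K * (1 + norm x) ^ 1" for x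
      using K(2)[of x] K(1) by (simp add: algebra_simps)
    then show ?case using K(1) by (intro exI[of _ K] exI[of _ 1]) auto
  next
    case (const c)
    then show ?case by (intro exI[of _ "\<bar>c\<bar>"] exI[of _ 0]) auto
  next
    case (add f g)
    then obtain C k D l where *: "C \<ge> 0" "\<forall>x. \<bar>f x\<bar> \<le> C * (1 + norm x) ^ k" "D \<ge> 0" "\<forall>x. \<bar>g x\<bar> \<le> D * (1 + norm x) ^ l" by auto
    have "\<bar>f x + g x\<bar> \<le> (C + D) * (1 + norm x) ^ (k + l)" for x
    proof -
      have "(1 + norm x) ^ k \<le> (1 + norm x) ^ (k + l)" "(1 + norm x) ^ l \<le> (1 + norm x) ^ (k + l)"
        by (auto intro!: power_increasing)
      then have "C * (1 + norm x) ^ k \<le> C * (1 + norm x) ^ (k + l)" "D * (1 + norm x) ^ l \<le> D * (1 + norm x) ^ (k + l)"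
        using * by (auto intro: mult_left_mono)
      then show ?thesis using *(2)[rule_format, of x] *(4)[rule_format, of x] unfolding distrib_right by linarith
    qed
    then show ?case using * by (intro exI[of _ "C + D"] exI[of _ "k + l"]) auto
  next
    case (mult f g)
    then obtain C k D l where *: "C \<ge> 0" "\<forall>x. \<bar>f x\<bar> \<le> C * (1 + norm x) ^ k" "D \<ge> 0" "\<forall>x. \<bar>g x\<bar> \<le> D * (1 + norm x) ^ l" by auto
    have "\<bar>f x * g x\<bar> \<le> (C * D) * (1 + norm x) ^ (k + l)" for x
    proof -
      have "\<bar>f x * g x\<bar> \<le> (C * (1 + norm x) ^ k) * (D * (1 + norm x) ^ l)"
        unfolding abs_mult using * by (intro mult_mono) auto
      then show ?thesis by (simp add: power_add mult_ac)
    qed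
    then show ?case using * by (intro exI[of _ "C * D"] exI[of _ "k + l"]) auto
  qed
  then show thesis using that by blast
qed

text \<open>The inequality y \<le> exp y at y = (1 + r) / (k + 1) bounds the power by a multiple of
  exp (1 + r), and completing the square bounds r - \<delta> r^2 by 1 / (4 \<delta>). Working with k
  + 1 avoids a division by zero for k = 0.\<close>

lemma power_mult_gaussian_bounded:
  fixes r \<delta> :: real
  assumes "r \<ge> 0" "\<delta> > 0"
  shows "(1 + r) ^ k * exp (- (\<delta> * r\<^sup>2)) \<le> real (Suc k) ^ Suc k * exp (1 + 1 / (4 * \<delta>))"
proof -
  have "(1 + r) ^ k \<le> (1 + r) ^ Suc k" using assms by (intro power_increasing) auto
  also have "\<dots> \<le> (real (Suc k) * exp ((1 + r) / real (Suc k))) ^ Suc k"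
  proof (rule power_mono)
    have "(1 + r) / real (Suc k) \<le> exp ((1 + r) / real (Suc k))"
      using exp_ge_add_one_self[of "(1 + r) / real (Suc k)"] by linarith
    then show "1 + r \<le> real (Suc k) * exp ((1 + r) / real (Suc k))"
      by (simp add: pos_divide_le_eq mult.commute del: of_nat_Suc)
  qed (use assms in auto)
  also have "\<dots> = real (Suc k) ^ Suc k * exp (1 + r)"
    by (simp only: power_mult_distrib exp_of_nat_mult[symmetric]) (simp del: of_nat_Suc power_Suc)
  finally have "(1 + r) ^ k * exp (- (\<delta> * r\<^sup>2)) \<le> real (Suc k) ^ Suc k * exp (1 + r) * exp (- (\<delta> * r\<^sup>2))"
    by (rule mult_right_mono) simp
  also have "\<dots> = real (Suc k) ^ Suc k * exp (1 + r - \<delta> * r\<^sup>2)"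
    by (simp only: mult.assoc mult_exp_exp) simp
  also have "\<dots> \<le> real (Suc k) ^ Suc k * exp (1 + 1 / (4 * \<delta>))"
  proof (rule mult_left_mono)
    have "0 \<le> \<delta> * (r - 1 / (2 * \<delta>))\<^sup>2" using assms by simp
    also have "\<dots> = \<delta> * r\<^sup>2 - r + 1 / (4 * \<delta>)" using assms by (simp add: power2_eq_square field_simps)
    finally show "exp (1 + r - \<delta> * r\<^sup>2) \<le> exp (1 + 1 / (4 * \<delta>))" by simp
  qed simp
  finally show ?thesis .
qed

text \<open>Every iterated partial derivative of exp (- Q) is a polynomial times exp (- Q), and the
  quadratic lower bound on Q outweighs polynomial growth.\<close>

lemma schwartz_gaussian:
  fixes Q :: "'a::euclidean_space \<Rightarrow> real"
  assumes Q: "real_polynomial_function Q" and \<delta>: "\<delta> > 0" and Q_ge: "\<And>x. \<delta> * (norm x)\<^sup>2 - C \<le> Q x"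
  shows "schwartz (\<lambda>x. complex_of_real (exp (- Q x)))"
proof -
  obtain Q' where Q': "\<And>x. (Q has_derivative Q' x) (at x)" "\<And>b. real_polynomial_function (\<lambda>x. Q' x b)"
    using real_polynomial_function_derivative[OF Q] by blast
  have der: "((\<lambda>x. complex_of_real (q x * exp (- Q x))) has_derivative (\<lambda>h. complex_of_real ((q' x h - q x * Q' x h) * exp (- Q x)))) (at x)"
    if "\<And>x. (q has_derivative q' x) (at x)" for q q' x
    by (rule has_derivative_of_real) (auto intro!: derivative_eq_intros that Q'(1) simp: algebra_simps)
  have form: "\<exists>q. real_polynomial_function q \<and> iter_partial bs (\<lambda>x. complex_of_real (exp (- Q x))) = (\<lambda>x. complex_of_real (q x * exp (- Q x)))" for bs
  proof (induction bs)
    case Nil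
    then show ?case by (intro exI[of _ "\<lambda>_. 1"]) (auto intro: real_polynomial_function.intros(2))
  next
    case (Cons b bs)
    then obtain q where q: "real_polynomial_function q" "iter_partial bs (\<lambda>x. complex_of_real (exp (- Q x))) = (\<lambda>x. complex_of_real (q x * exp (- Q x)))" by blast
    obtain q' where q': "\<And>x. (q has_derivative q' x) (at x)" "\<And>b. real_polynomial_function (\<lambda>x. q' x b)"
      using real_polynomial_function_derivative[OF q(1)] by blast
    have "iter_partial (b # bs) (\<lambda>x. complex_of_real (exp (- Q x))) = (\<lambda>x. complex_of_real ((q' x b - q x * Q' x b) * exp (- Q x)))"
      unfolding iter_partial.simps q(2) using frechet_derivative_at[OF der[of q q', OF q'(1)], symmetric] by simp
    moreover have "real_polynomial_function (\<lambda>x. q' x b - q x * Q' x b)"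
      using q(1) q'(2) Q'(2) by (intro real_polynomial_function_diff real_polynomial_function.intros(4))
    ultimately show ?case by blast
  qed
  show ?thesis
    unfolding schwartz_def
  proof (intro ballI conjI allI)
    fix bs :: "'a list" and n :: nat
    obtain q where q: "real_polynomial_function q" "iter_partial bs (\<lambda>x. complex_of_real (exp (- Q x))) = (\<lambda>x. complex_of_real (q x * exp (- Q x)))"
      using form by blast
    obtain q' where q': "\<And>x. (q has_derivative q' x) (at x)" "\<And>b. real_polynomial_function (\<lambda>x. q' x b)"
      using real_polynomial_function_derivative[OF q(1)] by blast
    show "iter_partial bs (\<lambda>x. complex_of_real (exp (- Q x))) differentiable_on UNIV"
      unfolding q(2) differentiable_on_def differentiable_def using der[of q q', OF q'(1)] by blast
    obtain D k where D: "D \<ge> 0" "\<And>x. \<bar>q x\<bar> \<le> D * (1 + norm x) ^ k"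
      using real_polynomial_function_growth[OF q(1)] by blast
    define L where "L = D * exp C * (real (Suc (k + n)) ^ Suc (k + n) * exp (1 + 1 / (4 * \<delta>)))"
    have "norm (norm x ^ n *\<^sub>R iter_partial bs (\<lambda>x. complex_of_real (exp (- Q x))) x) \<le> L" for x
    proof -
      have "norm (norm x ^ n *\<^sub>R iter_partial bs (\<lambda>x. complex_of_real (exp (- Q x))) x) = norm x ^ n * (\<bar>q x\<bar> * exp (- Q x))"
        unfolding q(2) by (simp only: norm_scaleR norm_of_real abs_mult abs_exp_cancel power_abs abs_norm_cancel)
      also have "\<dots> \<le> (1 + norm x) ^ n * ((D * (1 + norm x) ^ k) * (exp C * exp (- (\<delta> * (norm x)\<^sup>2))))"
      proof (intro mult_mono)
        show "exp (- Q x) \<le> exp C * exp (- (\<delta> * (norm x)\<^sup>2))" using Q_ge[of x] by (simp add: mult_exp_exp)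
      qed (use D in \<open>auto intro!: power_mono\<close>)
      also have "\<dots> = D * exp C * ((1 + norm x) ^ (k + n) * exp (- (\<delta> * (norm x)\<^sup>2)))"
        by (simp add: power_add mult_ac)
      also have "\<dots> \<le> L"
        unfolding L_def using D(1) \<delta> by (intro mult_left_mono power_mult_gaussian_bounded) auto
      finally show ?thesis .
    qed
    then show "bounded (range (\<lambda>x. norm x ^ n *\<^sub>R iter_partial bs (\<lambda>x. complex_of_real (exp (- Q x))) x))"
      unfolding bounded_iff by blast
  qed
qed

text \<open>The test function is a Gaussian centred at \<xi>. Its transform is a centred Gaussian
  with the reciprocal coefficients 1 / c b, times the character of \<xi>; the real part of its
  pairing with N is the cosine integral. Moving the centre thus probes the transform of the damped N
  at every frequency.\<close>

lemma gaussian_positive_definite: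
  fixes N :: "'a::euclidean_space \<Rightarrow> real"
  assumes pd: "positive_definite (distribution_of N)" and N [measurable]: "N \<in> borel_measurable borel"
    and B: "orthonormal_set B" "span B = UNIV" and c: "\<And>b. b \<in> B \<Longrightarrow> c b > 0"
    and int: "integrable lborel (\<lambda>x. N x * exp (- (\<Sum>b\<in>B. (x \<bullet> b)\<^sup>2 / c b) / 2))"
  shows "0 \<le> (\<integral>x. N x * exp (- (\<Sum>b\<in>B. (x \<bullet> b)\<^sup>2 / c b) / 2) * cos (x \<bullet> \<xi>) \<partial>lborel)"
proof -
  have M: "span_lborel B = lborel"
    using span_lborel_cong_span[OF B(1) orthonormal_set_Basis] B(2) by (simp add: span_lborel_Basis)
  have fin: "finite B" using B by auto
  have ne: "B \<noteq> {}" using B(2) by (auto simp: span_empty)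
  define Q where "Q = (\<lambda>x. (\<Sum>b\<in>B. c b * ((x - \<xi>) \<bullet> b)\<^sup>2) / 2)"
  define \<phi> where "\<phi> = (\<lambda>x. complex_of_real (exp (- Q x)))"
  have "schwartz \<phi>"
    unfolding \<phi>_def
  proof (rule schwartz_gaussian)
    have "real_polynomial_function (\<lambda>x. (x - \<xi>) \<bullet> b)" for b
      unfolding inner_diff_left
      by (intro real_polynomial_function_diff real_polynomial_function.intros(2) real_polynomial_function.intros(1) bounded_linear_inner_left)
    then show "real_polynomial_function Q"
      unfolding Q_def divide_inverse
      by (intro real_polynomial_function.intros(4) real_polynomial_function_sum real_polynomial_function.intros(2) real_polynomial_function_power fin)
    \<comment> \<open>The smallest coefficient gives Q x \<ge> c0 / 2 * \<parallel>x -
      \<xi>\<parallel>^2; passing from x - \<xi> to x by \<parallel>x\<parallel>^2 \<le> 2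
      \<parallel>x - \<xi>\<parallel>^2 + 2 \<parallel>\<xi>\<parallel>^2 halves the coefficient to
      c0 / 4.\<close>
    define c0 where "c0 = Min (c ` B)"
    have c0: "c0 > 0" "\<And>b. b \<in> B \<Longrightarrow> c0 \<le> c b" using fin ne c by (auto simp: c0_def)
    show "c0 / 4 > 0" using c0 by simp
    show "c0 / 4 * (norm x)\<^sup>2 - c0 / 2 * (norm \<xi>)\<^sup>2 \<le> Q x" for x
    proof -
      have "(norm x)\<^sup>2 \<le> (norm (x - \<xi>) + norm \<xi>)\<^sup>2"
        using norm_triangle_ineq[of "x - \<xi>" \<xi>] by (intro power_mono) auto
      also have "\<dots> \<le> 2 * (norm (x - \<xi>))\<^sup>2 + 2 * (norm \<xi>)\<^sup>2"
        using sum_squares_bound[of "norm (x - \<xi>)" "norm \<xi>"] by (simp add: power2_sum)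
      finally have 1: "c0 / 4 * (norm x)\<^sup>2 \<le> c0 / 4 * (2 * (norm (x - \<xi>))\<^sup>2 + 2 * (norm \<xi>)\<^sup>2)"
        using c0 by (intro mult_left_mono) auto
      have "c0 * (norm (x - \<xi>))\<^sup>2 = (\<Sum>b\<in>B. c0 * ((x - \<xi>) \<bullet> b)\<^sup>2)"
        using inner_orthonormal_sum[OF B(1), of "x - \<xi>"] B(2) by (simp add: sum_distrib_left)
      also have "\<dots> \<le> (\<Sum>b\<in>B. c b * ((x - \<xi>) \<bullet> b)\<^sup>2)"
        using c0 by (intro sum_mono mult_right_mono) auto
      finally show ?thesis using 1 by (simp add: Q_def algebra_simps)
    qed
  qed
  moreover have "\<phi> x \<in> \<real>\<^sub>\<ge>\<^sub>0" for x by (simp add: \<phi>_def del: of_real_exp)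
  ultimately have nn: "fourier_distribution (distribution_of N) \<phi> \<in> \<real>\<^sub>\<ge>\<^sub>0"
    using pd by (simp add: positive_definite_def)
  define S where "S = (\<Prod>b\<in>B. sqrt (2 * pi / c b))"
  have S: "S > 0" unfolding S_def using c by (intro prod_pos) auto
  define w where "w = (\<lambda>x. exp (- (\<Sum>b\<in>B. (x \<bullet> b)\<^sup>2 / c b) / 2))"
  have FT: "fourier_transform \<phi> x = complex_of_real (S * w x) * cis (- (x \<bullet> \<xi>))" for x
  proof -
    have m: "(\<lambda>y. \<phi> y * exp (- (\<i> * complex_of_real (y \<bullet> x)))) \<in> borel_measurable borel"
      unfolding \<phi>_def Q_def by measurable
    have "fourier_transform \<phi> x = (\<integral>y. \<phi> (\<xi> + y) * exp (- (\<i> * complex_of_real ((\<xi> + y) \<bullet> x))) \<partial>lborel)"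
      unfolding fourier_transform_def
      by (subst lborel_distr_plus[symmetric, of \<xi>], subst integral_distr) (use m in auto)
    also have "\<dots> = (\<integral>y. cis (- (x \<bullet> \<xi>)) * (complex_of_real (exp (- (\<Sum>b\<in>B. c b * (y \<bullet> b)\<^sup>2) / 2)) * cis (y \<bullet> (- x))) \<partial>lborel)"
    proof (rule Bochner_Integration.integral_cong[OF refl])
      fix y
      have "exp (- (\<i> * complex_of_real ((\<xi> + y) \<bullet> x))) = cis (- (x \<bullet> \<xi>)) * cis (y \<bullet> (- x))"
        unfolding cis_mult unfolding cis_conv_exp by (simp add: inner_add_left inner_commute[of x] algebra_simps)
      moreover have "\<phi> (\<xi> + y) = complex_of_real (exp (- (\<Sum>b\<in>B. c b * (y \<bullet> b)\<^sup>2) / 2))"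
        by (simp add: \<phi>_def Q_def)
      ultimately show "\<phi> (\<xi> + y) * exp (- (\<i> * complex_of_real ((\<xi> + y) \<bullet> x))) = cis (- (x \<bullet> \<xi>)) * (complex_of_real (exp (- (\<Sum>b\<in>B. c b * (y \<bullet> b)\<^sup>2) / 2)) * cis (y \<bullet> (- x)))"
        by (simp only: mult_ac)
    qed
    also have "\<dots> = cis (- (x \<bullet> \<xi>)) * complex_of_real (S * exp (- (\<Sum>b\<in>B. ((- x) \<bullet> b)\<^sup>2 / c b) / 2))"
    proof -
      have "(\<integral>y. complex_of_real (exp (- (\<Sum>b\<in>B. c b * (y \<bullet> b)\<^sup>2) / 2)) * cis (y \<bullet> (- x)) \<partial>span_lborel B)
        = complex_of_real (S * exp (- (\<Sum>b\<in>B. ((- x) \<bullet> b)\<^sup>2 / c b) / 2))"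
        unfolding S_def by (rule gaussian_Fourier(2)[OF B(1)]) (rule c)
      then show ?thesis unfolding integral_mult_right_zero M by (simp only:)
    qed
    finally show ?thesis by (simp add: w_def mult.commute)
  qed
  have wi: "integrable lborel (\<lambda>x. complex_of_real (N x) * (complex_of_real (S * w x) * cis (- (x \<bullet> \<xi>))))"
  proof (rule Bochner_Integration.integrable_bound)
    show "integrable lborel (\<lambda>x. S * (N x * w x))" using int unfolding w_def by (rule integrable_mult_right)
    show "AE x in lborel. norm (complex_of_real (N x) * (complex_of_real (S * w x) * cis (- (x \<bullet> \<xi>)))) \<le> norm (S * (N x * w x))"
      by (auto simp: norm_mult abs_mult)
  qed (simp add: w_def)
  have "0 \<le> Re (fourier_distribution (distribution_of N) \<phi>)"
    using nn by (auto simp: complex_nonneg_Reals_iff)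
  also have "Re (fourier_distribution (distribution_of N) \<phi>) = (\<integral>x. Re (complex_of_real (N x) * (complex_of_real (S * w x) * cis (- (x \<bullet> \<xi>)))) \<partial>lborel)"
    unfolding fourier_distribution_def distribution_of_def FT by (rule integral_Re[OF wi, symmetric])
  also have "\<dots> = (\<integral>x. S * (N x * w x * cos (x \<bullet> \<xi>)) \<partial>lborel)"
    by (intro Bochner_Integration.integral_cong) auto
  also have "\<dots> = S * (\<integral>x. N x * w x * cos (x \<bullet> \<xi>) \<partial>lborel)" by (rule integral_mult_right_zero)
  finally show ?thesis using S by (simp add: w_def zero_le_mult_iff)
qed

text \<open>Positive definiteness passes to subspaces: \<open>gaussian_positive_definite\<close> is
  applied with Gaussians of width 1 along A and width \<tau> across it, and \<tau> \<rightarrow> 0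
  concentrates them on \<open>span A\<close>. Continuity of N off the origin makes the limit the
  integral of the restriction.\<close>

lemma positive_definite_span:
  fixes N :: "'a::euclidean_space \<Rightarrow> real"
  assumes pd: "positive_definite (distribution_of N)" and N [measurable]: "N \<in> borel_measurable borel"
    and N0: "\<And>x. N x \<ge> 0" and N_le: "\<And>x. N x \<le> CN / norm x" and N_cont: "\<And>x. x \<noteq> 0 \<Longrightarrow> isCont N x" and CN: "CN \<ge> 0"
    and A: "orthonormal_set A" "card A \<ge> 2" and \<xi>: "\<xi> \<in> span A"
  shows "0 \<le> (\<integral>x. N x * exp (- ((norm x)\<^sup>2) / 2) * cos (x \<bullet> \<xi>) \<partial>span_lborel A)"
proof -
  obtain C where C: "orthonormal_set (A \<union> C)" "A \<inter> C = {}" "span (A \<union> C) = UNIV"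
    using orthonormal_set_extend[OF A(1)] by blast
  have finA: "finite A" and finC: "finite C" using C(1) by (auto simp: orthonormal_set_def)
  have M: "span_lborel (A \<union> C) = lborel"
    using span_lborel_cong_span[OF C(1) orthonormal_set_Basis] C(3) by (simp add: span_lborel_Basis)
  define f where "f = (\<lambda>v x. N x * exp (- (\<Sum>a\<in>A. (x \<bullet> a)\<^sup>2) / 2) * cos (x \<bullet> v))"
  have [measurable]: "f v \<in> borel_measurable borel" for v by (simp add: f_def)
  \<comment> \<open>From (r - 1)^2 \<ge> 0 follows exp (- r^2 / 2) \<le> exp (1 / 2) * exp (- r), so
    a multiple of exp (- r) / r dominates, and this is integrable on \<open>span A\<close> because
    its dimension is at least 2.\<close>
  define g where "g = (\<lambda>a::'a. CN * exp (1 / 2) * (exp (- norm a) / norm a))"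
  have gi: "integrable (span_lborel A) g"
    unfolding g_def using A by (intro integrable_mult_right integrable_exp_neg_homogeneous(2)[OF A(1), of _ 1]) auto
  have orth: "a \<bullet> b = 0" if "a \<in> span A" "b \<in> span C" for a b
    using inner_span_orthogonal[OF C(1,2) that] .
  have bd: "\<bar>f v (a + b)\<bar> \<le> g a" if ab: "a \<in> span A" "b \<in> span C" and False: "a \<noteq> 0" for a b v
  proof -
    have "(a + b) \<bullet> c = a \<bullet> c" if "c \<in> A" for c
      using orth[of c b] that ab by (simp add: inner_add_left span_base inner_commute[of b])
    then have s: "(\<Sum>c\<in>A. ((a + b) \<bullet> c)\<^sup>2) = (norm a)\<^sup>2"
      using inner_orthonormal_sum[OF A(1) ab(1)] by simp
    have na: "norm a \<le> norm (a + b)" using orth[OF ab] by (rule norm_le_norm_add_orthogonal)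
    show "\<bar>f v (a + b)\<bar> \<le> g a"
    proof -
      have "N (a + b) \<le> CN / norm a"
        using N_le[of "a + b"] na False CN by (meson divide_left_mono mult_pos_pos norm_ge_zero order_trans zero_less_norm_iff less_le_trans)
      moreover have "exp (- (norm a)\<^sup>2 / 2) \<le> exp (1 / 2) * exp (- norm a)"
      proof -
        have "0 \<le> (norm a - 1)\<^sup>2" by simp
        then show ?thesis by (simp add: mult_exp_exp power2_eq_square algebra_simps)
      qed
      ultimately have "N (a + b) * exp (- (norm a)\<^sup>2 / 2) \<le> (CN / norm a) * (exp (1 / 2) * exp (- norm a))"
        using N0 CN by (intro mult_mono) auto
      also have "\<dots> = g a" by (simp add: g_def)
      finally have "N (a + b) * exp (- (norm a)\<^sup>2 / 2) * \<bar>cos ((a + b) \<bullet> v)\<bar> \<le> g a"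
        using mult_left_le[of "\<bar>cos ((a + b) \<bullet> v)\<bar>" "N (a + b) * exp (- (norm a)\<^sup>2 / 2)"] N0[of "a + b"] by simp
      then show ?thesis unfolding f_def s using N0[of "a + b"] by (simp add: abs_mult)
    qed
  qed
  have "A \<noteq> {}" using A(2) by auto
  then have fg: "AE a in span_lborel A. \<forall>b\<in>span C. \<bar>f v (a + b)\<bar> \<le> g a" for v
    using AE_span_lborel[of A] AE_span_lborel_neq_0[OF A(1)] by (auto intro: bd elim!: eventually_rev_mp)
  have cont: "AE a in span_lborel A. isCont (f v) a" for v
  proof -
    have "AE a in span_lborel A. a \<noteq> 0" using A by (intro AE_span_lborel_neq_0) auto
    then show ?thesis unfolding f_def by eventually_elim (intro continuous_intros N_cont, auto)
  qed
  define \<tau> where "\<tau> = (\<lambda>n. inverse (real (Suc n)))"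
  have t0: "\<tau> n > 0" for n by (simp add: \<tau>_def)
  have tlim: "\<tau> \<longlonglongrightarrow> 0" unfolding \<tau>_def by (rule LIMSEQ_inverse_real_of_nat)
  have quad: "exp (- (\<Sum>b\<in>A \<union> C. (x \<bullet> b)\<^sup>2 / (if b \<in> A then 1 else (\<tau> n)\<^sup>2)) / 2)
    = exp (- (\<Sum>a\<in>A. (x \<bullet> a)\<^sup>2) / 2) * exp (- (\<Sum>c\<in>C. (x \<bullet> c)\<^sup>2) / (2 * (\<tau> n)\<^sup>2))" for n x
  proof -
    have "(\<Sum>b\<in>A \<union> C. (x \<bullet> b)\<^sup>2 / (if b \<in> A then 1 else (\<tau> n)\<^sup>2)) = (\<Sum>a\<in>A. (x \<bullet> a)\<^sup>2) + (\<Sum>c\<in>C. (x \<bullet> c)\<^sup>2 / (\<tau> n)\<^sup>2)"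
      using C(2) finA finC by (subst sum.union_disjoint) (auto intro!: arg_cong2[of _ _ _ _ "(+)"] sum.cong)
    then show ?thesis by (simp add: mult_exp_exp sum_divide_distrib[symmetric] add_divide_distrib mult.commute)
  qed
  have nonneg: "0 \<le> (\<integral>x. f \<xi> x * exp (- (\<Sum>c\<in>C. (x \<bullet> c)\<^sup>2) / (2 * (\<tau> n)\<^sup>2)) \<partial>span_lborel (A \<union> C)) / \<tau> n ^ card C" for n
  proof -
    have "integrable lborel (\<lambda>x. f 0 x * exp (- (\<Sum>c\<in>C. (x \<bullet> c)\<^sup>2) / (2 * (\<tau> n)\<^sup>2)))"
      using gaussian_scaled(2)[OF C(1,2) _ gi fg[of 0] t0[of n]] by (simp add: M)
    then have "integrable lborel (\<lambda>x. N x * exp (- (\<Sum>b\<in>A \<union> C. (x \<bullet> b)\<^sup>2 / (if b \<in> A then 1 else (\<tau> n)\<^sup>2)) / 2))"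
      unfolding quad f_def by (simp add: mult.assoc)
    then have "0 \<le> (\<integral>x. N x * exp (- (\<Sum>b\<in>A \<union> C. (x \<bullet> b)\<^sup>2 / (if b \<in> A then 1 else (\<tau> n)\<^sup>2)) / 2) * cos (x \<bullet> \<xi>) \<partial>lborel)"
      using t0[of n] by (intro gaussian_positive_definite[OF pd N C(1,3)]) auto
    also have "\<dots> = (\<integral>x. f \<xi> x * exp (- (\<Sum>c\<in>C. (x \<bullet> c)\<^sup>2) / (2 * (\<tau> n)\<^sup>2)) \<partial>lborel)"
      unfolding quad f_def by (simp only: mult_ac)
    finally show ?thesis using t0[of n] by (simp add: M)
  qed
  have "(\<lambda>n. (\<integral>x. f \<xi> x * exp (- (\<Sum>c\<in>C. (x \<bullet> c)\<^sup>2) / (2 * (\<tau> n)\<^sup>2)) \<partial>span_lborel (A \<union> C)) / \<tau> n ^ card C)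
    \<longlonglongrightarrow> sqrt (2 * pi) ^ card C * (\<integral>a. f \<xi> a \<partial>span_lborel A)"
    by (rule gaussian_concentration[OF C(1,2) _ gi fg cont t0 tlim]) simp
  then have "0 \<le> sqrt (2 * pi) ^ card C * (\<integral>a. f \<xi> a \<partial>span_lborel A)"
    by (rule LIMSEQ_le_const) (use nonneg in auto)
  moreover have "sqrt (2 * pi) ^ card C > 0" by simp
  ultimately have "0 \<le> (\<integral>a. f \<xi> a \<partial>span_lborel A)" by (metis zero_le_mult_iff not_less)
  also have "\<dots> = (\<integral>x. N x * exp (- ((norm x)\<^sup>2) / 2) * cos (x \<bullet> \<xi>) \<partial>span_lborel A)"
  proof (rule integral_cong_AE)
    show "AE x in span_lborel A. f \<xi> x = N x * exp (- ((norm x)\<^sup>2) / 2) * cos (x \<bullet> \<xi>)"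
      using AE_span_lborel by eventually_elim (simp add: f_def inner_orthonormal_sum[OF A(1)])
  qed simp_all
  finally show ?thesis .
qed

subsection \<open>Minkowski functionals and the comparison of volumes\<close>

text \<open>For fixed x \<noteq> 0 the admissible dilation factors form a closed set, upward closed
  by star-shapedness and bounded below by \<open>norm x / R\<close> with R a bound on M. So the
  \<open>LEAST\<close> in the definition is attained and equals the infimum.\<close>

lemma minkowski_functional_iff:
  fixes M :: "'a::euclidean_space set"
  assumes M: "compact M" "\<forall>x\<in>M. closed_segment 0 x \<subseteq> M" "0 \<in> interior M" and x: "x \<noteq> 0"
  shows "0 < minkowski_functional M x" and "0 < a \<and> x \<in> (*\<^sub>R) a ` M \<longleftrightarrow> minkowski_functional M x \<le> a"
proof -
  obtain R where R: "R > 0" "\<And>y. y \<in> M \<Longrightarrow> norm y \<le> R"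
    using M(1) compact_imp_bounded bounded_pos by metis
  obtain e where e: "e > 0" "cball 0 e \<subseteq> M"
    using M(3) by (meson mem_interior_cball)
  define \<delta> where "\<delta> = norm x / R"
  have \<delta>: "\<delta> > 0" using R x by (simp add: \<delta>_def)
  \<comment> \<open>Restricting to a \<ge> \<delta> loses no admissible factor and stays away from
    0, where \<open>inverse\<close> is discontinuous; S is then closed as a preimage of M.\<close>
  define S where "S = {a \<in> {\<delta>..}. inverse a *\<^sub>R x \<in> M}"
  have mem: "x \<in> (*\<^sub>R) a ` M \<longleftrightarrow> inverse a *\<^sub>R x \<in> M" if "a > 0" for a
    using that by (auto simp: image_iff intro!: bexI[of _ "inverse a *\<^sub>R x"])
  have S: "0 < a \<and> x \<in> (*\<^sub>R) a ` M \<longleftrightarrow> a \<in> S" for a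
  proof -
    have "\<delta> \<le> a" if "0 < a" "inverse a *\<^sub>R x \<in> M"
      using R(2)[OF that(2)] that(1) R(1) by (simp add: \<delta>_def field_simps)
    then show ?thesis using \<delta> mem by (auto simp: S_def)
  qed
  have up: "b \<in> S" if "a \<in> S" "a \<le> b" for a b
  proof -
    have a: "0 < a" "inverse a *\<^sub>R x \<in> M" using that \<delta> by (auto simp: S_def)
    have "inverse b *\<^sub>R x = (a / b) *\<^sub>R (inverse a *\<^sub>R x)" using a that by (simp add: field_simps)
    also have "\<dots> \<in> closed_segment 0 (inverse a *\<^sub>R x)"
      using a that by (auto simp: in_segment intro!: exI[of _ "a / b"])
    finally show ?thesis using M(2) a(2) that by (auto simp: S_def)
  qed
  have "closed S"
    unfolding S_def using M(1) \<delta>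
    by (intro continuous_closed_preimage[unfolded vimage_def Int_def mem_Collect_eq, where f="\<lambda>a. inverse a *\<^sub>R x"]
        continuous_intros compact_imp_closed) auto
  moreover have "norm x / e \<in> S"
    using S[of "norm x / e"] e x mem[of "norm x / e"] by (auto simp: subset_iff)
  then have "S \<noteq> {}" by auto
  moreover have bdd: "bdd_below S" by (rule bdd_belowI[of _ \<delta>]) (auto simp: S_def)
  ultimately have inf: "Inf S \<in> S" by (intro closed_contains_Inf)
  have "minkowski_functional M x = Inf S"
    unfolding minkowski_functional_def S using x inf bdd
    by (auto intro!: Least_equality cInf_lower)
  moreover have "a \<in> S \<longleftrightarrow> Inf S \<le> a" for a using up[OF inf] cInf_lower[OF _ bdd] by auto
  moreover have "Inf S > 0" using inf \<delta> by (auto simp: S_def)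
  ultimately show "0 < minkowski_functional M x" "0 < a \<and> x \<in> (*\<^sub>R) a ` M \<longleftrightarrow> minkowski_functional M x \<le> a"
    using S[of a] by auto
qed

lemma minkowski_functional_0 [simp]: "minkowski_functional M 0 = 0"
  by (simp add: minkowski_functional_def)

section \<open>The gauge of a symmetric star-shaped body\<close>

locale star_set =
  fixes M :: "'a::euclidean_space set"
  assumes compact_M: "compact M" and star_M: "\<forall>x\<in>M. closed_segment 0 x \<subseteq> M"
    and interior_M: "0 \<in> interior M" and symmetric_M: "origin_symmetric M"
    and continuous_minkowski_nz: "continuous_on (- {0}) (minkowski_functional M)"
begin

abbreviation p :: "'a \<Rightarrow> real" where "p \<equiv> minkowski_functional M"

lemmas p_iff = minkowski_functional_iff[OF compact_M star_M interior_M]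

lemma p_nonneg: "p x \<ge> 0"
  using p_iff(1)[of x] by (cases "x = 0") auto

lemma p_scale:
  assumes c: "c > 0"
  shows "p (c *\<^sub>R x) = c * p x"
proof (cases "x = 0")
  case False
  have "p (c *\<^sub>R x) \<le> a \<longleftrightarrow> p x \<le> a / c" for a
  proof -
    have "c *\<^sub>R x \<in> (*\<^sub>R) a ` M \<longleftrightarrow> x \<in> (*\<^sub>R) (a / c) ` M"
    proof
      assume "c *\<^sub>R x \<in> (*\<^sub>R) a ` M"
      then obtain m where m: "m \<in> M" "c *\<^sub>R x = a *\<^sub>R m" by auto
      then have "inverse c *\<^sub>R (c *\<^sub>R x) = inverse c *\<^sub>R (a *\<^sub>R m)" by simp
      then have "x = (a / c) *\<^sub>R m" using c by (simp add: divide_inverse mult.commute)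
      then show "x \<in> (*\<^sub>R) (a / c) ` M" using m by blast
    next
      assume "x \<in> (*\<^sub>R) (a / c) ` M"
      then obtain m where m: "m \<in> M" "x = (a / c) *\<^sub>R m" by auto
      then have "c *\<^sub>R x = a *\<^sub>R m" using c by simp
      then show "c *\<^sub>R x \<in> (*\<^sub>R) a ` M" using m by blast
    qed
    moreover have "0 < a \<longleftrightarrow> 0 < a / c" using c by (simp add: zero_less_divide_iff)
    ultimately show ?thesis using p_iff(2)[of "c *\<^sub>R x" a] p_iff(2)[of x "a / c"] False c by auto
  qed
  from this[of "p (c *\<^sub>R x)"] this[of "c * p x"] show ?thesis using c by (auto simp: field_simps)
qed simp

lemma p_minus: "p (- x) = p x"
proof (cases "x = 0")
  case False
  have "- x \<in> (*\<^sub>R) a ` M \<longleftrightarrow> x \<in> (*\<^sub>R) a ` M" for a and x :: 'a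
  proof -
    have *: "- x \<in> (*\<^sub>R) a ` M" if "x \<in> (*\<^sub>R) a ` M" for x
    proof -
      from that obtain m where "m \<in> M" "x = a *\<^sub>R m" by auto
      then have "- m \<in> M" "- x = a *\<^sub>R (- m)" using symmetric_M by (auto simp: origin_symmetric_def)
      then show ?thesis by blast
    qed
    from *[of x] *[of "- x"] show ?thesis by auto
  qed
  then have "p (- x) \<le> a \<longleftrightarrow> p x \<le> a" for a
    using p_iff(2)[of "- x" a] p_iff(2)[of x a] False by auto
  from this[of "p (- x)"] this[of "p x"] show ?thesis by auto
qed simp

lemma p_bounds:
  obtains c1 c2 where "c1 > 0" "c2 > 0" "\<And>x. c1 * norm x \<le> p x" "\<And>x. p x \<le> c2 * norm x"
proof -
  obtain R where R: "R > 0" "\<And>y. y \<in> M \<Longrightarrow> norm y \<le> R"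
    using compact_M compact_imp_bounded bounded_pos by metis
  obtain e where e: "e > 0" "cball 0 e \<subseteq> M"
    using interior_M by (meson mem_interior_cball)
  have "(1 / R) * norm x \<le> p x" for x
  proof (cases "x = 0")
    case False
    then have "x \<in> (*\<^sub>R) (p x) ` M" using p_iff(2)[of x "p x"] by simp
    then obtain m where "m \<in> M" "x = p x *\<^sub>R m" by auto
    then have "norm x = p x * norm m" "norm m \<le> R" using p_nonneg[of x] R(2) by (metis abs_of_nonneg norm_scaleR, blast)
    then have "norm x \<le> p x * R" using p_nonneg[of x] by (simp add: mult_left_mono)
    then show ?thesis using R(1) by (simp add: field_simps)
  qed simp
  moreover have "p x \<le> (1 / e) * norm x" for x
  proof (cases "x = 0")
    case False
    have "(e / norm x) *\<^sub>R x \<in> M" using e False by (auto simp: subset_iff)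
    moreover have "x = (norm x / e) *\<^sub>R ((e / norm x) *\<^sub>R x)" using e False by simp
    ultimately have "x \<in> (*\<^sub>R) (norm x / e) ` M" by blast
    then show ?thesis using p_iff(2)[of x "norm x / e"] e False by simp
  qed simp
  ultimately show thesis using that[of "1 / R" "1 / e"] R(1) e(1) by auto
qed

lemma mem_iff: "x \<in> M \<longleftrightarrow> p x \<le> 1"
proof (cases "x = 0")
  case True
  then show ?thesis using interior_M interior_subset by auto
next
  case False
  then show ?thesis using p_iff(2)[of x 1] by simp
qed

lemma p_continuous: "continuous_on UNIV p"
  unfolding continuous_on_eq_continuous_at[OF open_UNIV]
proof
  fix x :: 'a
  obtain c1 c2 where c: "c1 > 0" "c2 > 0" "\<And>x. c1 * norm x \<le> p x" "\<And>x. p x \<le> c2 * norm x"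
    using p_bounds by blast
  show "isCont p x"
  proof (cases "x = 0")
    case True
    have "(p \<longlongrightarrow> 0) (at 0)"
    proof (rule Lim_null_comparison)
      show "\<forall>\<^sub>F y in at 0. norm (p y) \<le> c2 * norm y" using c(4) p_nonneg by simp
      show "((\<lambda>y. c2 * norm y) \<longlongrightarrow> 0) (at (0::'a))" by (rule tendsto_eq_intros refl | simp)+
    qed
    then show ?thesis using True by (simp add: isCont_def)
  next
    case False
    then show ?thesis using continuous_minkowski_nz by (simp add: continuous_on_eq_continuous_at open_Compl)
  qed
qed

lemma p_measurable [measurable]: "p \<in> borel_measurable borel"
  using p_continuous by (rule borel_measurable_continuous_onI)

lemma isCont_p: "isCont p x"
  using p_continuous by (simp add: continuous_on_eq_continuous_at)

lemma isCont_indicator: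
  assumes "p x \<noteq> 1"
  shows "isCont (indicator M :: 'a \<Rightarrow> real) x"
proof (cases "p x < 1")
  case True
  then have "\<forall>\<^sub>F y in nhds x. p y < 1"
    using isCont_p[of x] by (simp add: continuous_at tendsto_at_iff_tendsto_nhds order_tendstoD(2))
  then have "\<forall>\<^sub>F y in nhds x. indicator M y = (1::real)"
    by eventually_elim (auto simp: indicator_def mem_iff)
  then show ?thesis by (subst isCont_cong[of _ "\<lambda>_. 1"]) auto
next
  case False
  then have "p x > 1" using assms by simp
  then have "\<forall>\<^sub>F y in nhds x. p y > 1"
    using isCont_p[of x] by (simp add: continuous_at tendsto_at_iff_tendsto_nhds order_tendstoD(1))
  then have "\<forall>\<^sub>F y in nhds x. indicator M y = (0::real)"
    by eventually_elim (auto simp: indicator_def mem_iff)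
  then show ?thesis by (subst isCont_cong[of _ "\<lambda>_. 0"]) auto
qed

lemma AE_isCont_indicator:
  assumes "orthonormal_set A" "A \<noteq> {}"
  shows "AE x in span_lborel A. isCont (indicator M :: 'a \<Rightarrow> real) x"
proof -
  obtain c1 c2 where c: "c1 > 0" "c2 > 0" "\<And>x. c1 * norm x \<le> p x" "\<And>x. p x \<le> c2 * norm x"
    using p_bounds by blast
  have "AE x in span_lborel A. p x \<noteq> 1"
    by (rule AE_homogeneous_neq_1[OF assms p_measurable _ c(1)]) (use p_scale c in auto)
  then show ?thesis by eventually_elim (rule isCont_indicator)
qed

lemma inverse_p_bound:
  obtains CN where "CN \<ge> 0" "\<And>x. inverse (p x) \<le> CN / norm x"
proof -
  obtain c1 c2 where c: "c1 > 0" "c2 > 0" "\<And>x. c1 * norm x \<le> p x" "\<And>x. p x \<le> c2 * norm x"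
    using p_bounds by blast
  have "inverse (p x) \<le> (1 / c1) / norm x" for x
  proof (cases "x = 0")
    case False
    have "inverse (p x) \<le> inverse (c1 * norm x)"
      using c(3)[of x] c(1) False by (intro le_imp_inverse_le) auto
    then show ?thesis by (simp add: divide_inverse)
  qed simp
  then show thesis using that[of "1 / c1"] c(1) by auto
qed

lemma isCont_inverse_p: "x \<noteq> 0 \<Longrightarrow> isCont (\<lambda>x. inverse (p x)) x"
  using p_iff(1)[of x] by (intro continuous_intros isCont_p) auto

text \<open>The damping is Gaussian in the norm because positive definiteness was tested on
  Gaussians. In the constant, exp 2 comes from exp (- r^2 / 2) \<le> exp 2 * exp (- 2 r), whose
  spare factor exp (- r) absorbs one power of r, and 3 / 2 is (2^2 - 1) / 2 as in
  \<open>gaussian_difference_bounds\<close>.\<close>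

lemma intersection_kernel_positive_definite:
  assumes pd: "positive_definite (distribution_of (\<lambda>x. inverse (p x)))"
    and B: "orthonormal_set B" "2 \<le> card B"
  shows "\<exists>CN c1 c2 CE. intersection_kernel B (\<lambda>x. inverse (p x)) norm (\<lambda>r. exp (- (r\<^sup>2) / 2)) CN c1 c2 CE"
proof -
  obtain CN where CN: "CN \<ge> 0" "\<And>x. inverse (p x) \<le> CN / norm x" using inverse_p_bound by blast
  have "intersection_kernel B (\<lambda>x. inverse (p x)) norm (\<lambda>r. exp (- (r\<^sup>2) / 2)) CN 1 1 (3 / 2 * exp 2)"
  proof
    fix r :: real assume r: "r \<ge> 0"
    have q: "exp (- (r\<^sup>2) / 2) \<le> exp 2 * exp (- (2 * r))"
    proof -
      have "0 \<le> (r - 2)\<^sup>2" by simp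
      then show ?thesis by (simp add: mult_exp_exp power2_eq_square algebra_simps)
    qed
    have er: "exp (- (2 * r)) \<le> exp (- r)" using r by simp
    have "exp 2 * exp (- (2 * r)) \<le> 3 / 2 * exp 2 * exp (- r)"
      using er by (intro mult_mono) auto
    then show "exp (- (r\<^sup>2) / 2) \<le> 3 / 2 * exp 2 * exp (- r)" using q by linarith
    show "exp (- ((2 * r)\<^sup>2) / 2) \<le> exp (- (r\<^sup>2) / 2)" by (simp add: power_mult_distrib)
    have "exp (- (r\<^sup>2) / 2) - exp (- ((2 * r)\<^sup>2) / 2) = exp (- (r\<^sup>2) / 2) * (1 - exp (- (3 / 2 * r\<^sup>2)))"
      by (simp add: right_diff_distrib mult_exp_exp power_mult_distrib)
    also have "\<dots> \<le> exp (- (r\<^sup>2) / 2) * (3 / 2 * r\<^sup>2)"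
      using exp_ge_add_one_self[of "- (3 / 2 * r\<^sup>2)"] by (intro mult_left_mono) auto
    also have "\<dots> \<le> (exp 2 * exp (- (2 * r))) * (3 / 2 * r\<^sup>2)"
      using q by (intro mult_right_mono) auto
    also have "\<dots> = 3 / 2 * exp 2 * r * exp (- r) * (r * exp (- r))"
    proof -
      have "exp (- (2 * r)) = exp (- r) * exp (- r)" by (simp add: mult_exp_exp)
      then show ?thesis by (simp add: power2_eq_square)
    qed
    also have "\<dots> \<le> 3 / 2 * exp 2 * r * exp (- r) * 1"
    proof (rule mult_left_mono)
      have "r \<le> exp r" using exp_ge_add_one_self[of r] by linarith
      then show "r * exp (- r) \<le> 1" by (simp add: exp_minus field_simps)
    qed (use r in auto)
    finally show "exp (- (r\<^sup>2) / 2) - exp (- ((2 * r)\<^sup>2) / 2) \<le> 3 / 2 * exp 2 * r * exp (- r)" by simp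
  next
    fix \<xi> assume "\<xi> \<in> span B"
    then show "0 \<le> (\<integral>x. inverse (p x) * exp (- ((norm x)\<^sup>2) / 2) * cos (x \<bullet> \<xi>) \<partial>span_lborel B)"
      using CN by (intro positive_definite_span[OF pd _ _ CN(2) isCont_inverse_p CN(1) B]) (auto simp: p_nonneg)
  next
    show "(\<lambda>x. inverse (p x)) \<in> borel_measurable borel" by measurable
    show "0 \<le> inverse (p x)" for x using p_nonneg[of x] by simp
    show "inverse (p (c *\<^sub>R x)) = inverse (p x) / c" if "c > 0" for c x
      by (simp add: p_scale[OF that] divide_inverse mult.commute)
    show "inverse (p (- x)) = inverse (p x)" for x by (simp add: p_minus)
    show "inverse (p x) \<le> CN / norm x" for x by (rule CN)
    show "isCont (\<lambda>x. inverse (p x)) x" if "x \<noteq> 0" for x by (rule isCont_inverse_p[OF that])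
    show "orthonormal_set B" "2 \<le> card B" by (rule B)+
    show "continuous_on UNIV (norm :: 'a \<Rightarrow> real)" "continuous_on UNIV (\<lambda>r::real. exp (- (r\<^sup>2) / 2))"
      by (intro continuous_intros; simp)+
  qed simp_all
  then show ?thesis by blast
qed

text \<open>Here the damping depends on the gauge itself, so that the damped kernel is a function of
  the gauge and its layers are dilates of the body; this is the form
  \<open>convex_kernel_positive_definite\<close> handles.\<close>

lemma intersection_kernel_convex:
  assumes conv: "convex M" and B: "orthonormal_set B" "card B = 3 \<or> card B = 4"
  shows "\<exists>CN c1 c2 CE. intersection_kernel B (\<lambda>x. inverse (p x)) p (\<lambda>r. exp (- r)) CN c1 c2 CE"
proof -
  obtain CN where CN: "CN \<ge> 0" "\<And>x. inverse (p x) \<le> CN / norm x" using inverse_p_bound by blast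
  obtain c1 c2 where c: "c1 > 0" "c2 > 0" "\<And>x. c1 * norm x \<le> p x" "\<And>x. p x \<le> c2 * norm x"
    using p_bounds by blast
  have "intersection_kernel B (\<lambda>x. inverse (p x)) p (\<lambda>r. exp (- r)) CN c1 c2 1"
  proof
    fix r :: real assume r: "r \<ge> 0"
    have "exp (- r) - exp (- (2 * r)) = exp (- r) * (1 - exp (- r))"
      by (simp add: right_diff_distrib mult_exp_exp)
    also have "\<dots> \<le> exp (- r) * r"
      using exp_ge_add_one_self[of "- r"] by (intro mult_left_mono) auto
    finally show "exp (- r) - exp (- (2 * r)) \<le> 1 * r * exp (- r)" by (simp add: mult.commute)
  next
    fix \<xi> assume xi: "\<xi> \<in> span B"
    show "0 \<le> (\<integral>x. inverse (p x) * exp (- p x) * cos (x \<bullet> \<xi>) \<partial>span_lborel B)"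
    proof (rule convex_kernel_positive_definite[OF B compact_M conv _ p_measurable _ c(1) c(3) _ xi])
      show "- x \<in> M" if "x \<in> M" for x using that symmetric_M by (auto simp: origin_symmetric_def)
    qed (auto simp: p_scale mem_iff)
  next
    show "(\<lambda>x. inverse (p x)) \<in> borel_measurable borel" by measurable
    show "0 \<le> inverse (p x)" for x using p_nonneg[of x] by simp
    show "inverse (p (c *\<^sub>R x)) = inverse (p x) / c" if "c > 0" for c x
      by (simp add: p_scale[OF that] divide_inverse mult.commute)
    show "inverse (p (- x)) = inverse (p x)" for x by (simp add: p_minus)
    show "inverse (p x) \<le> CN / norm x" for x by (rule CN)
    show "isCont (\<lambda>x. inverse (p x)) x" if "x \<noteq> 0" for x by (rule isCont_inverse_p[OF that])
    show "orthonormal_set B" "2 \<le> card B" using B by auto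
    show "continuous_on UNIV p" "c1 > 0" "c1 * norm x \<le> p x" "p x \<le> c2 * norm x" for x
      using p_continuous c by auto
    show "p (- x) = p x" for x by (rule p_minus)
    show "p (c *\<^sub>R x) = c * p x" if "c > 0" for c x by (rule p_scale[OF that])
    show "continuous_on UNIV (\<lambda>r::real. exp (- r))" by (intro continuous_intros)
  qed simp_all
  then show ?thesis by blast
qed

end

lemma star_set_star_body:
  assumes "star_body M" "origin_symmetric M"
  shows "star_set M"
  using assms by (auto simp: star_body_def star_set_def)

text \<open>By symmetry the origin is the midpoint of an interior point and its negative, hence
  interior. Convexity makes the gauge subadditive, and with a ball of radius e inside K the gauge is
  Lipschitz with constant 1 / e, hence continuous.\<close>

lemma star_set_convex_body:
  fixes K :: "'a::euclidean_space set"
  assumes "convex_body K" "origin_symmetric K"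
  shows "star_set K"
proof -
  have K: "compact K" "convex K" "interior K \<noteq> {}" using assms(1) by (auto simp: convex_body_def)
  have sym: "uminus ` K = K"
    using assms(2) by (force simp: origin_symmetric_def)
  have int0: "0 \<in> interior K"
  proof -
    obtain x where x: "x \<in> interior K" using K(3) by auto
    then have "- x \<in> uminus ` interior K" by simp
    then have "- x \<in> interior K" using interior_negations[of K] sym by simp
    then have "(1 / 2) *\<^sub>R x + (1 / 2) *\<^sub>R (- x) \<in> interior K"
      using x convex_interior[OF K(2)] by (intro convexD) auto
    then show ?thesis by simp
  qed
  then have "0 \<in> K" using interior_subset by auto
  then have star: "\<forall>x\<in>K. closed_segment 0 x \<subseteq> K"
    using K(2) by (simp add: closed_segment_subset)
  note iff = minkowski_functional_iff[OF K(1) star int0]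
  let ?p = "minkowski_functional K"
  obtain e where e: "e > 0" "cball 0 e \<subseteq> K" using int0 by (meson mem_interior_cball)
  have ub: "?p x \<le> (1 / e) * norm x" for x
  proof (cases "x = 0")
    case False
    have "(e / norm x) *\<^sub>R x \<in> K" using e False by (auto simp: subset_iff)
    moreover have "x = (norm x / e) *\<^sub>R ((e / norm x) *\<^sub>R x)" using e False by simp
    ultimately have "x \<in> (*\<^sub>R) (norm x / e) ` K" by blast
    then show ?thesis using iff(2)[of x "norm x / e"] e False by simp
  qed simp
  have sub: "?p (x + y) \<le> ?p x + ?p y" for x y
  proof -
    consider "x = 0" | "y = 0" | "x + y = 0" | "x \<noteq> 0" "y \<noteq> 0" "x + y \<noteq> 0" by blast
    then show ?thesis
    proof cases
      case 3
      then show ?thesis using iff(1)[of x] iff(1)[of y] by (cases "x = 0"; cases "y = 0") auto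
    next
      case 4
      have pos: "?p x > 0" "?p y > 0" using iff(1) 4 by auto
      obtain k where k: "k \<in> K" "x = ?p x *\<^sub>R k" using iff(2)[of x "?p x"] 4 by auto
      obtain l where l: "l \<in> K" "y = ?p y *\<^sub>R l" using iff(2)[of y "?p y"] 4 by auto
      define s where "s = ?p x + ?p y"
      have s: "s > 0" using pos by (simp add: s_def)
      have "(?p x / s) *\<^sub>R k + (?p y / s) *\<^sub>R l \<in> K"
        using k l pos s by (intro convexD[OF K(2)]) (auto simp: s_def add_divide_distrib[symmetric])
      moreover have "x + y = s *\<^sub>R ((?p x / s) *\<^sub>R k + (?p y / s) *\<^sub>R l)"
        using k(2) l(2) s by (simp add: scaleR_add_right)
      ultimately have "x + y \<in> (*\<^sub>R) s ` K" by blast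
      then show ?thesis using iff(2)[of "x + y" s] 4 s by (simp add: s_def)
    qed simp_all
  qed
  have "(1 / e)-lipschitz_on UNIV ?p"
  proof (rule lipschitz_onI)
    fix x y
    have "?p x \<le> ?p y + ?p (x - y)" "?p y \<le> ?p x + ?p (y - x)" using sub[of y "x - y"] sub[of x "y - x"] by auto
    then show "dist (?p x) (?p y) \<le> (1 / e) * dist x y"
      using ub[of "x - y"] ub[of "y - x"] by (simp add: dist_real_def dist_norm norm_minus_commute abs_le_iff)
  qed (use e in simp)
  then have "continuous_on UNIV ?p" by (rule lipschitz_on_continuous_on)
  then have "continuous_on (- {0}) ?p" by (rule continuous_on_subset) auto
  then show ?thesis using K star int0 assms(2) by (auto simp: star_set_def)
qed

section \<open>The comparison, raised dimension by dimension\<close>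

locale comparison = M: star_set M + K: star_set K + L: star_set L
  for M K L :: "'a::euclidean_space set" +
  assumes convex_K: "convex K"
begin

text \<open>The difference of the two weighted bodies as one function, nonpositive on K and
  nonnegative off K. The exponent j counts the factors of the gauge of M that are still available
  for later steps.\<close>

definition G :: "nat \<Rightarrow> 'a \<Rightarrow> real" where
  "G j x = M.p x ^ j * (indicator L x - indicator K x)"

definition section_le :: "nat \<Rightarrow> nat \<Rightarrow> bool" where
  "section_le d j \<longleftrightarrow> (\<forall>A. orthonormal_set A \<and> card A = d \<longrightarrow> 0 \<le> (\<integral>x. G j x \<partial>span_lborel A))"

lemma K_meas [measurable]: "K \<in> sets borel" and L_meas [measurable]: "L \<in> sets borel"
  using K.compact_M L.compact_M by (auto simp: borel_compact)

lemma G_meas [measurable]: "G j \<in> borel_measurable borel"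
  unfolding G_def by measurable

lemma G_bound:
  obtains CG R where "R \<ge> 0" "\<And>x. \<bar>G j x\<bar> \<le> CG * indicator (cball 0 R) x"
proof -
  obtain c1 c2 where c: "c1 > 0" "c2 > 0" "\<And>x. c1 * norm x \<le> M.p x" "\<And>x. M.p x \<le> c2 * norm x"
    using M.p_bounds by blast
  obtain R where R: "R > 0" "\<And>x. x \<in> K \<union> L \<Longrightarrow> norm x \<le> R"
    using bounded_Un K.compact_M L.compact_M compact_imp_bounded bounded_pos by metis
  have "\<bar>G j x\<bar> \<le> (c2 * R) ^ j * indicator (cball 0 R) x" for x
  proof (cases "x \<in> K \<union> L")
    case True
    then have nx: "norm x \<le> R" using R by blast
    have "M.p x \<le> c2 * R" using c(4)[of x] nx c(2) by (meson mult_left_mono order_trans less_imp_le)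
    then have "M.p x ^ j \<le> (c2 * R) ^ j" using M.p_nonneg by (intro power_mono)
    moreover have "\<bar>G j x\<bar> \<le> M.p x ^ j"
      using M.p_nonneg[of x] by (auto simp: G_def indicator_def)
    ultimately show ?thesis using nx by simp
  next
    case False
    then show ?thesis using c R by (auto simp: G_def indicator_def)
  qed
  then show thesis using that[of R] R(1) by auto
qed

lemma AE_isCont_G:
  assumes "orthonormal_set A" "A \<noteq> {}"
  shows "AE x in span_lborel A. isCont (G j) x"
  using K.AE_isCont_indicator[OF assms] L.AE_isCont_indicator[OF assms]
  by eventually_elim (auto simp: G_def[abs_def] intro!: continuous_intros M.isCont_p)

text \<open>\<open>integral_kernel_nonneg\<close> for the function G. Its requirement of continuity
  almost everywhere on hyperplanes holds because the boundaries of K and L are null sets on every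
  subspace of positive dimension.\<close>

lemma integral_G_kernel:
  assumes "intersection_kernel B N q E CN c1 c2 CE" and sec: "section_le (card B - 1) j"
  shows "0 \<le> (\<integral>x. G j x * N x \<partial>span_lborel B)" "integrable (span_lborel B) (\<lambda>x. G j x * N x)" "integrable (span_lborel B) (G j)"
proof -
  interpret intersection_kernel B N q E CN c1 c2 CE by fact
  obtain CG R where R: "R \<ge> 0" "\<And>x. \<bar>G j x\<bar> \<le> CG * indicator (cball 0 R) x" using G_bound by blast
  have hyp: "\<forall>A. orthonormal_set A \<and> card A = card B - 1 \<and> span A \<subseteq> span B \<longrightarrow> 0 \<le> (\<integral>x. G j x \<partial>span_lborel A) \<and> (AE x in span_lborel A. isCont (G j) x)"
  proof (intro allI impI)
    fix A :: "'a set" assume A: "orthonormal_set A \<and> card A = card B - 1 \<and> span A \<subseteq> span B"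
    then have "A \<noteq> {}" using card_B by auto
    then show "0 \<le> (\<integral>x. G j x \<partial>span_lborel A) \<and> (AE x in span_lborel A. isCont (G j) x)"
      using A sec AE_isCont_G[of A j] by (simp add: section_le_def)
  qed
  show "0 \<le> (\<integral>x. G j x * N x \<partial>span_lborel B)"
    by (rule integral_kernel_nonneg[OF G_meas R(2,1) hyp])
  have i: "integrable (span_lborel B) (\<lambda>x. \<bar>G j x\<bar> / norm x)"
    by (rule kernel_difference_nonneg(1)[OF G_meas R(2,1) hyp zero_less_one])
  show "integrable (span_lborel B) (\<lambda>x. G j x * N x)"
  proof (rule Bochner_Integration.integrable_bound[OF integrable_mult_right[OF i, of CN]])
    show "AE x in span_lborel B. norm (G j x * N x) \<le> norm (CN * (\<bar>G j x\<bar> / norm x))"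
    proof (rule AE_I2)
      fix x
      have "\<bar>G j x\<bar> * N x \<le> \<bar>G j x\<bar> * (CN / norm x)" by (intro mult_left_mono N_le) simp
      then show "norm (G j x * N x) \<le> norm (CN * (\<bar>G j x\<bar> / norm x))"
        using N_nonneg[of x] CN_nonneg by (simp add: abs_mult mult.commute)
    qed
  qed simp
  show "integrable (span_lborel B) (G j)" by (rule integrable_bounded_support[OF B G_meas R])
qed

text \<open>Busemann--Petty step: \<open>1 / \<parallel>x\<parallel>\<^sub>K \<le> 1\<close> off \<open>K\<close> and \<open>\<ge> 1\<close> on \<open>K\<close>, so replacing the kernel
  by the constant \<open>1\<close> only increases the integral.\<close>

lemma section_le_convex_step:
  assumes sec: "section_le d j" and d: "d = 2 \<or> d = 3"
  shows "section_le (Suc d) j"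
  unfolding section_le_def
proof (intro allI impI)
  fix B :: "'a set" assume B: "orthonormal_set B \<and> card B = Suc d"
  obtain CN c1 c2 CE where ik: "intersection_kernel B (\<lambda>x. inverse (K.p x)) K.p (\<lambda>r. exp (- r)) CN c1 c2 CE"
    using K.intersection_kernel_convex[OF convex_K, of B] B d by auto
  note i = integral_G_kernel[OF ik, of j]
  have s: "section_le (card B - 1) j" using B sec by simp
  note i(1)[OF s]
  also have "(\<integral>x. G j x * inverse (K.p x) \<partial>span_lborel B) \<le> (\<integral>x. G j x \<partial>span_lborel B)"
  proof (rule integral_mono_AE[OF i(2)[OF s] i(3)[OF s]])
    have "B \<noteq> {}" using B by auto
    then have "AE x in span_lborel B. x \<noteq> 0" using B by (intro AE_span_lborel_neq_0) auto
    then show "AE x in span_lborel B. G j x * inverse (K.p x) \<le> G j x"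
    proof eventually_elim
      case (elim x)
      have pos: "K.p x > 0" using K.p_iff(1)[OF elim] .
      have m: "M.p x ^ j \<ge> 0" using M.p_nonneg[of x] by simp
      show ?case
      proof (cases "x \<in> K")
        case True
        then have "1 \<le> inverse (K.p x)" using pos K.mem_iff[of x] by (simp add: one_le_inverse)
        moreover have "G j x \<le> 0" using True m by (auto simp: G_def indicator_def)
        ultimately show ?thesis using mult_left_mono_neg[of 1 "inverse (K.p x)" "G j x"] by simp
      next
        case False
        then have "inverse (K.p x) \<le> 1" using K.mem_iff[of x] by (simp add: inverse_le_1_iff)
        moreover have "G j x \<ge> 0" using False m by (auto simp: G_def indicator_def)
        ultimately show ?thesis by (simp add: mult_left_le)
      qed
    qed
  qed
  finally show "0 \<le> (\<integral>x. G j x \<partial>span_lborel B)" .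
qed

text \<open>Away from the origin the kernel cancels one factor of the weight, so
  \<open>G (Suc j)\<close> times the kernel is \<open>G j\<close>: the dimension rises by one while
  the exponent falls by one.\<close>

lemma section_le_positive_definite_step:
  assumes pd: "positive_definite (distribution_of (\<lambda>x. inverse (M.p x)))"
    and sec: "section_le d (Suc j)" and d: "d \<ge> 1"
  shows "section_le (Suc d) j"
  unfolding section_le_def
proof (intro allI impI)
  fix B :: "'a set" assume B: "orthonormal_set B \<and> card B = Suc d"
  obtain CN c1 c2 CE where ik: "intersection_kernel B (\<lambda>x. inverse (M.p x)) norm (\<lambda>r. exp (- (r\<^sup>2) / 2)) CN c1 c2 CE"
    using M.intersection_kernel_positive_definite[OF pd, of B] B d by auto
  have s: "section_le (card B - 1) (Suc j)" using B sec by simp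
  note integral_G_kernel(1)[OF ik s]
  also have "(\<integral>x. G (Suc j) x * inverse (M.p x) \<partial>span_lborel B) = (\<integral>x. G j x \<partial>span_lborel B)"
  proof (rule integral_cong_AE)
    have "B \<noteq> {}" using B by auto
    then have "AE x in span_lborel B. x \<noteq> 0" using B by (intro AE_span_lborel_neq_0) auto
    then show "AE x in span_lborel B. G (Suc j) x * inverse (M.p x) = G j x"
    proof eventually_elim
      case (elim x)
      then show ?case using M.p_iff(1)[OF elim] by (simp add: G_def)
    qed
  qed simp_all
  finally show "0 \<le> (\<integral>x. G j x \<partial>span_lborel B)" .
qed

lemma integrable_indicator_weight:
  assumes A: "orthonormal_set A" and S: "S = K \<or> S = L"
  shows "integrable (span_lborel A) (\<lambda>x. indicator S x * M.p x ^ j)"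
proof -
  have S': "compact S" "S \<in> sets borel" using S K.compact_M L.compact_M by auto
  obtain c1 c2 where c: "c2 > 0" "\<And>x. M.p x \<le> c2 * norm x"
    using M.p_bounds by metis
  obtain R where R: "R > 0" "\<And>x. x \<in> S \<Longrightarrow> norm x \<le> R"
    using S'(1) compact_imp_bounded bounded_pos by metis
  show ?thesis
  proof (rule integrable_bounded_support[OF A])
    show "(\<lambda>x. indicator S x * M.p x ^ j) \<in> borel_measurable borel" using S'(2) by simp
    show "R \<ge> 0" using R(1) by simp
    show "\<bar>indicator S x * M.p x ^ j\<bar> \<le> (c2 * R) ^ j * indicator (cball 0 R) x" for x
    proof (cases "x \<in> S")
      case True
      have "M.p x \<le> c2 * R" using c(2)[of x] R(2)[OF True] c(1) by (meson mult_left_mono order_trans less_imp_le)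
      then have "M.p x ^ j \<le> (c2 * R) ^ j" using M.p_nonneg by (intro power_mono)
      then show ?thesis using R(2)[OF True] True M.p_nonneg[of x] by simp
    qed (use R(1) c(1) in simp)
  qed
qed

lemma integral_G:
  assumes "orthonormal_set A"
  shows "(\<integral>x. G j x \<partial>span_lborel A) = (\<integral>x. indicator L x * M.p x ^ j \<partial>span_lborel A) - (\<integral>x. indicator K x * M.p x ^ j \<partial>span_lborel A)"
proof -
  have "(\<integral>x. G j x \<partial>span_lborel A) = (\<integral>x. indicator L x * M.p x ^ j - indicator K x * M.p x ^ j \<partial>span_lborel A)"
    by (simp add: G_def algebra_simps)
  also have "\<dots> = (\<integral>x. indicator L x * M.p x ^ j \<partial>span_lborel A) - (\<integral>x. indicator K x * M.p x ^ j \<partial>span_lborel A)"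
    using integrable_indicator_weight[OF assms] by (intro Bochner_Integration.integral_diff) auto
  finally show ?thesis .
qed

theorem volume_comparison:
  assumes pd: "positive_definite (distribution_of (\<lambda>x. inverse (minkowski_functional M x)))"
    and n: "DIM('a) \<ge> 4" and m: "m = 2 \<or> m = 3"
    and sec: "\<forall>H\<in>Grassmannian m.
        (LINT x:K \<inter> H|subspace_lborel H. minkowski_functional M x ^ (DIM('a) - 4))
        \<le> (LINT x:L \<inter> H|subspace_lborel H. minkowski_functional M x ^ (DIM('a) - 4))"
  shows "measure lborel K \<le> measure lborel L"
proof -
  define j where "j = DIM('a) - 4"
  have "section_le m j"
    unfolding section_le_def
  proof (intro allI impI)
    fix A :: "'a set" assume A: "orthonormal_set A \<and> card A = m"
    have "span A \<in> Grassmannian m"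
      using A orthonormal_set_independent[of A] by (auto simp: Grassmannian_def dim_eq_card_independent)
    moreover have "subspace_lborel (span A) = span_lborel A"
      using A by (intro subspace_lborel_eq_span_lborel) auto
    ultimately have le: "(LINT x:K \<inter> span A|span_lborel A. minkowski_functional M x ^ j) \<le> (LINT x:L \<inter> span A|span_lborel A. minkowski_functional M x ^ j)"
      using sec by (auto simp: j_def)
    have "(LINT x:S \<inter> span A|span_lborel A. minkowski_functional M x ^ j) = (\<integral>x. indicator S x * minkowski_functional M x ^ j \<partial>span_lborel A)"
      if [measurable]: "S \<in> sets borel" for S
      unfolding set_lebesgue_integral_def
    proof (rule integral_cong_AE)
      have [measurable]: "span A \<in> sets borel" by (intro borel_closed closed_subspace subspace_span)
      show "(\<lambda>x. indicator (S \<inter> span A) x *\<^sub>R minkowski_functional M x ^ j) \<in> borel_measurable (span_lborel A)" by simp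
      show "AE x in span_lborel A. indicator (S \<inter> span A) x *\<^sub>R minkowski_functional M x ^ j = indicator S x * minkowski_functional M x ^ j"
        using AE_span_lborel by eventually_elim (auto simp: indicator_def)
    qed simp
    then show "0 \<le> (\<integral>x. G j x \<partial>span_lborel A)" using le integral_G[of A j] A by simp
  qed
  \<comment> \<open>From m = 2 the convex step is taken twice and from m = 3 once; the weight is
    untouched.\<close>
  then have "section_le 3 j" using m section_le_convex_step[of 2 j] by auto
  then have s4: "section_le 4 j" using section_le_convex_step[of 3 j] by simp
  \<comment> \<open>Dimension and exponent always add up to 4 + j, which is the dimension of the
    space, so the exponent reaches 0 exactly when the subspace is everything.\<close>
  have "section_le (4 + i) (j - i)" if "i \<le> j" for i
    using that
  proof (induction i)
    case (Suc i)
    then show ?case using section_le_positive_definite_step[OF pd, of "4 + i" "j - Suc i"] by (simp add: Suc_diff_Suc)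
  qed (use s4 in simp)
  from this[of j] have "section_le (DIM('a)) 0" using n by (simp add: j_def)
  then have "0 \<le> (\<integral>x. G 0 x \<partial>span_lborel (Basis :: 'a set))"
    using orthonormal_set_Basis by (auto simp: section_le_def)
  then show ?thesis using integral_G[OF orthonormal_set_Basis, of 0] by (simp add: span_lborel_Basis)
qed

end

theorem corollary3:
  fixes M :: "(real ^ 'n) set" and k :: nat
  assumes "CARD('n) \<ge> 4"
    and "star_body M" and "origin_symmetric M"
    and "positive_definite (distribution_of (\<lambda>x. inverse (minkowski_functional M x)))"
    and "CARD('n) - k \<in> {2, 3}"
  shows "\<forall>K L :: (real ^ 'n) set.
     convex_body K \<and> origin_symmetric K \<and> convex_body L \<and> origin_symmetric L \<and>
     (\<forall>H \<in> Grassmannian (CARD('n) - k).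
        (LINT x:K \<inter> H|subspace_lborel H. minkowski_functional M x ^ (CARD('n) - 4))
        \<le> (LINT x:L \<inter> H|subspace_lborel H. minkowski_functional M x ^ (CARD('n) - 4)))
     \<longrightarrow> measure lborel K \<le> measure lborel L"
proof (intro allI impI, elim conjE)
  fix K L :: "(real ^ 'n) set"
  assume KL: "convex_body K" "origin_symmetric K" "convex_body L" "origin_symmetric L"
    and sec: "\<forall>H \<in> Grassmannian (CARD('n) - k).
        (LINT x:K \<inter> H|subspace_lborel H. minkowski_functional M x ^ (CARD('n) - 4))
        \<le> (LINT x:L \<inter> H|subspace_lborel H. minkowski_functional M x ^ (CARD('n) - 4))"
  interpret comparison M K L
    using star_set_star_body[OF assms(2,3)] star_set_convex_body[OF KL(1,2)] star_set_convex_body[OF KL(3,4)] KL(1)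
    by (simp add: comparison_def comparison_axioms_def convex_body_def)
  show "measure lborel K \<le> measure lborel L"
    using volume_comparison[OF assms(4), of "CARD('n) - k"] assms(1,5) sec by simp
qed

end
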